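(* Let $E,A\in\mathbb{K}^{n\times m}$ be such that $\operatorname{ran}\begin{bmatrix}E\\ A\end{bmatrix}=\mathcal{D}\mathcal{L}$ for some maximally dissipative linear relation $\mathcal{D}\subseteq\mathbb{K}^{2n}$ and some maximally nonnegative linear relation $\mathcal{L}\subseteq\mathbb{K}^{2n}$. Then there exist invertible $S\in\mathbb{K}^{n\times n}$, $T\in\mathbb{K}^{m\times m}$ and $n_1,n_2,n_3,n_4\in\mathbb{N}$ such that $$S(sE-A)T=\begin{bmatrix} s\tilde L_{11}-\tilde D_{11}&0&0&0&0&0\\ \tilde D_{21}&sI_{n_2}&0&0&0&0\\ s\tilde L_{21}&0&I_{n_3}&0&0&0\\ 0&0&0&sI_{n_4}&-I_{n_4}&0\\ 0&0&0&0&0&0\end{bmatrix}$$ for some matrices $\tilde L_{11},\tilde D_{11}\in\mathbb{K}^{n_1\times n_1}$, $\tilde D_{21}\in\mathbb{K}^{n_2\times n_1}$, $\tilde L_{21}\in\mathbb{K}^{n_3\times n_1}$, where $s\tilde L_{11}-\tilde D_{11}\in\mathbb{K}[s]^{n_1\times n_1}$ is regular and positive real and $\ker\tilde L_{11}\subseteq\ker\tilde L_{21}$. In particular, the Kronecker form of $sE-A$ has the following properties: (a) The column minimal indices are at most one (if there are any). (b) The row minimal indices are zero (if there are any). (c) $\sigma(E,A)\subseteq\overline{\mathbb{C}_-}$. Furthermore, the non-zero eigenvalues on the imaginary axis are semi-simple. The Jordan blocks at $\infty$ and at zero have size at most two; in particular, the index of $sE-A$ is at most two.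
   Context: $\mathbb{K}\in\{\mathbb{R},\mathbb{C}\}$; $\mathbb{N}$ includes $0$, and block rows/columns of size zero are allowed (the last zero block row and block column have whatever sizes are needed to give an $n\times m$ matrix). $\mathbb{K}^n$ carries the inner product $\langle x,y\rangle=y^*x$. $\overline{\mathbb{C}_-}$ is the closed left half-plane. A linear relation in $\mathbb{K}^n$ is a linear subspace of $\mathbb{K}^{2n}\cong\mathbb{K}^n\times\mathbb{K}^n$. The product of linear relations is $\mathcal{D}\mathcal{L}=\{(x,z) : \exists y\in\mathbb{K}^n,\ (x,y)\in\mathcal{L},\ (y,z)\in\mathcal{D}\}$. The adjoint is $\mathcal{M}^*=\{(x,y)\in\mathbb{K}^{2n} : \langle w,x\rangle=\langle v,y\rangle\ \forall (v,w)\in\mathcal{M}\}$. $\mathcal{M}$ is symmetric if $\mathcal{M}\subseteq\mathcal{M}^*$; dissipative if $\operatorname{Re}\langle x,y\rangle\le 0$ for all $(x,y)\in\mathcal{M}$; nonnegative if it is symmetric and $\langle x,y\rangle\ge0$ for all $(x,y)\in\mathcal{M}$. It is maximally dissipative (maximally nonnegative) if it is dissipative (nonnegative) and not a proper subspace of a dissipative (nonnegative) linear relation. A square pencil $sE-A$ is regular if $\det(sE-A)$ is not the zero polynomial. A matrix $G(s)\in\mathbb{K}(s)^{k\times k}$ of rational functions is positive real if it has no poles in the open right half-plane and $G(\lambda)+G(\lambda)^*\ge0$ (positive semi-definite) for all $\lambda\in\mathbb{C}$ with $\operatorname{Re}\lambda>0$. Kronecker form: for every pencil $sE-A\in\mathbb{K}[s]^{n\times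 m}$ there are invertible $S,T$ with $S(sE-A)T=\operatorname{diag}(sI_{n_0}-J,\ sN_\alpha-I_{|\alpha|},\ sK_\beta-L_\beta,\ sK_\gamma^\top-L_\gamma^\top)$, where $J$ is in Jordan canonical form over $\mathbb{K}$, and for multi-indices $\alpha,\beta,\gamma$ with entries $\ge1$, $N_\alpha=\operatorname{diag}(N_{\alpha_i})$, $K_\beta=\operatorname{diag}(K_{\beta_i})$, $L_\beta=\operatorname{diag}(L_{\beta_i})$ (similarly for $\gamma$), $N_k$ is the nilpotent $k\times k$ Jordan block, $K_k=[I_{k-1},0]$, $L_k=[0,I_{k-1}]\in\mathbb{R}^{(k-1)\times k}$. The $\alpha_i$ are the sizes of the Jordan blocks at $\infty$; the numbers $\beta_i-1$ are the column minimal indices and the numbers $\gamma_j-1$ the row minimal indices. The index is $\max\{\alpha_1,\dots,\alpha_{\ell_\alpha},\gamma_1,\dots,\gamma_{\ell_\gamma},0\}$. A number $\lambda\in\mathbb{C}$ is an eigenvalue of $sE-A$ if $\operatorname{rk}_{\mathbb{C}}(\lambda E-A)<\operatorname{rk}_{\mathbb{K}(s)}(sE-A)$, equivalently if it is an eigenvalue of $J$; $\sigma(E,A)$ is the set of eigenvalues. The (finite) Jordan blocks of $sE-A$ at $\lambda$ are those of $J$ at $\lambda$; $\lambda$ is semi-simple if $J$ has no Jordan blocks of size $\ge2$ at $\lambda$ (Jordan blocks understood over $\mathbb{C}$). *)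

theory Defs
  imports
    "Jordan_Normal_Form.Jordan_Normal_Form"
    "Jordan_Normal_Form.Schur_Decomposition"
    "Jordan_Normal_Form.Matrix_Kernel"
    "Jordan_Normal_Form.DL_Rank"
    "HOL-Computational_Algebra.Normalized_Fraction"
begin

section \<open>The scalar field\<close>

text \<open>
  The axioms force a type of this class to be a copy of the real or of the complex numbers,
  together with its conjugation, its order (on the complex numbers, \<open>0 \<le> z\<close> means that
  \<open>z\<close> is real and nonnegative) and its embedding into the complex numbers.
\<close>

class real_or_complex = conjugatable_ordered_field +
  fixes to_complex :: "'a \<Rightarrow> complex"
  assumes to_complex_one: "to_complex 1 = 1"
    and to_complex_add: "to_complex (x + y) = to_complex x + to_complex y"
    and to_complex_mult: "to_complex (x * y) = to_complex x * to_complex y"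
    and to_complex_conjugate: "to_complex (conjugate x) = cnj (to_complex x)"
    and to_complex_le_iff: "x \<le> y \<longleftrightarrow> to_complex x \<le> to_complex y"
    and range_to_complex: "range to_complex = \<real> \<or> range to_complex = UNIV"

instantiation real :: real_or_complex
begin
definition "to_complex = complex_of_real"
instance
  by standard (auto simp: to_complex_real_def less_eq_complex_def Reals_def)
end

instantiation complex :: real_or_complex
begin
definition "to_complex = (\<lambda>z :: complex. z)"
instance
  by standard (auto simp: to_complex_complex_def)
end


section \<open>Linear relations\<close>

text \<open>
  The inner product \<open>\<langle>x, y\<rangle> = y\<^sup>* x\<close> is \<open>x \<bullet>c y\<close>.  The product \<open>\<D>\<L>\<close> of linear relations
  (first \<open>\<L>\<close>, then \<open>\<D>\<close>) is the relational composition \<open>L O D\<close>.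
\<close>

definition linear_relation :: "nat \<Rightarrow> ('k :: real_or_complex vec) rel \<Rightarrow> bool" where
  "linear_relation n M \<longleftrightarrow>
     M \<subseteq> carrier_vec n \<times> carrier_vec n \<and>
     (0\<^sub>v n, 0\<^sub>v n) \<in> M \<and>
     (\<forall>(x, y) \<in> M. \<forall>(x', y') \<in> M. (x + x', y + y') \<in> M) \<and>
     (\<forall>c. \<forall>(x, y) \<in> M. (c \<cdot>\<^sub>v x, c \<cdot>\<^sub>v y) \<in> M)"

definition adjoint_relation :: "nat \<Rightarrow> ('k :: real_or_complex vec) rel \<Rightarrow> 'k vec rel" where
  "adjoint_relation n M =
     {(x, y). x \<in> carrier_vec n \<and> y \<in> carrier_vec n \<and> (\<forall>(v, w) \<in> M. w \<bullet>c x = v \<bullet>c y)}"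

definition symmetric_relation :: "nat \<Rightarrow> ('k :: real_or_complex vec) rel \<Rightarrow> bool" where
  "symmetric_relation n M \<longleftrightarrow> linear_relation n M \<and> M \<subseteq> adjoint_relation n M"

definition dissipative :: "nat \<Rightarrow> ('k :: real_or_complex vec) rel \<Rightarrow> bool" where
  "dissipative n M \<longleftrightarrow> linear_relation n M \<and> (\<forall>(x, y) \<in> M. Re (to_complex (x \<bullet>c y)) \<le> 0)"

definition nonnegative :: "nat \<Rightarrow> ('k :: real_or_complex vec) rel \<Rightarrow> bool" where
  "nonnegative n M \<longleftrightarrow> symmetric_relation n M \<and> (\<forall>(x, y) \<in> M. x \<bullet>c y \<ge> 0)"

definition maximally_dissipative :: "nat \<Rightarrow> ('k :: real_or_complex vec) rel \<Rightarrow> bool" where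
  "maximally_dissipative n M \<longleftrightarrow> dissipative n M \<and> \<not> (\<exists>M'. dissipative n M' \<and> M \<subset> M')"

definition maximally_nonnegative :: "nat \<Rightarrow> ('k :: real_or_complex vec) rel \<Rightarrow> bool" where
  "maximally_nonnegative n M \<longleftrightarrow> nonnegative n M \<and> \<not> (\<exists>M'. nonnegative n M' \<and> M \<subset> M')"

text \<open>The range of the stacked matrix \<open>[E; A]\<close>, as a subspace of \<open>K\<^sup>n \<times> K\<^sup>n\<close>.\<close>

definition ran_stacked :: "'k :: real_or_complex mat \<Rightarrow> 'k mat \<Rightarrow> 'k vec rel" where
  "ran_stacked E A = {(E *\<^sub>v x, A *\<^sub>v x) | x. x \<in> carrier_vec (dim_col E)}"


section \<open>Matrix pencils\<close>

abbreviation const_mat :: "'k :: real_or_complex mat \<Rightarrow> 'k poly mat" where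
  "const_mat M \<equiv> map_mat (\<lambda>c. [:c:]) M"

abbreviation s_times :: "'k :: real_or_complex mat \<Rightarrow> 'k poly mat" where
  "s_times M \<equiv> [:0, 1:] \<cdot>\<^sub>m const_mat M"

definition pencil :: "'k :: real_or_complex mat \<Rightarrow> 'k mat \<Rightarrow> 'k poly mat" where
  "pencil E A = s_times E - const_mat A"

definition regular_pencil :: "'k :: real_or_complex mat \<Rightarrow> 'k mat \<Rightarrow> bool" where
  "regular_pencil E A \<longleftrightarrow> square_mat (pencil E A) \<and> det (pencil E A) \<noteq> 0"

definition pencil_spectrum :: "'k :: real_or_complex mat \<Rightarrow> 'k mat \<Rightarrow> complex set" where
  "pencil_spectrum E A =
     {z. vec_space.rank (dim_row E) (z \<cdot>\<^sub>m map_mat to_complex E - map_mat to_complex A)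
         < vec_space.rank (dim_row E) (map_mat to_fract (pencil E A))}"


section \<open>Positive real matrices of rational functions\<close>

definition poly_at :: "'k :: real_or_complex poly \<Rightarrow> complex \<Rightarrow> complex" where
  "poly_at p z = poly (map_poly to_complex p) z"

text \<open>
  A rational function has a pole at \<open>z\<close> if it cannot be written as a fraction whose denominator
  does not vanish at \<open>z\<close>; otherwise its value at \<open>z\<close> is that of any such fraction.
\<close>

definition has_pole :: "'k :: real_or_complex poly fract \<Rightarrow> complex \<Rightarrow> bool" where
  "has_pole r z \<longleftrightarrow> \<not> (\<exists>p q. r = Fract p q \<and> poly_at q z \<noteq> 0)"

definition fract_at :: "'k :: real_or_complex poly fract \<Rightarrow> complex \<Rightarrow> complex" where
  "fract_at r z = (THE v. \<exists>p q. r = Fract p q \<and> poly_at q z \<noteq> 0 \<and> v = poly_at p z / poly_at q z)"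

definition positive_semidefinite :: "complex mat \<Rightarrow> bool" where
  "positive_semidefinite M \<longleftrightarrow>
     square_mat M \<and> (\<forall>v \<in> carrier_vec (dim_row M). (M *\<^sub>v v) \<bullet>c v \<ge> 0)"

definition positive_real :: "'k :: real_or_complex poly fract mat \<Rightarrow> bool" where
  "positive_real G \<longleftrightarrow>
     square_mat G \<and>
     (\<forall>z. Re z > 0 \<longrightarrow> (\<forall>r \<in> elements_mat G. \<not> has_pole r z)) \<and>
     (\<forall>z. Re z > 0 \<longrightarrow> (let Gz = map_mat (\<lambda>r. fract_at r z) G
                       in positive_semidefinite (Gz + mat_adjoint Gz)))"


section \<open>Block matrices\<close>

fun hcat :: "'a :: zero mat list \<Rightarrow> 'a mat" where
  "hcat [] = 0\<^sub>m 0 0"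
| "hcat [A] = A"
| "hcat (A # B # Bs) =
     (let C = hcat (B # Bs) in four_block_mat A C (0\<^sub>m 0 (dim_col A)) (0\<^sub>m 0 (dim_col C)))"

fun vcat :: "'a :: zero mat list \<Rightarrow> 'a mat" where
  "vcat [] = 0\<^sub>m 0 0"
| "vcat [A] = A"
| "vcat (A # B # Bs) = A @\<^sub>r vcat (B # Bs)"

definition block_mat :: "'a :: zero mat list list \<Rightarrow> 'a mat" where
  "block_mat Bss = vcat (map hcat Bss)"


section \<open>The Kronecker form\<close>

text \<open>
  The real Jordan block of the conjugate pair \<open>a \<plusminus> ib\<close>: \<open>k\<close> diagonal \<open>2 \<times> 2\<close> blocks
  \<open>[a, b; -b, a]\<close>, with \<open>2 \<times> 2\<close> identity blocks on the block superdiagonal.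
\<close>

definition real_jordan_block :: "nat \<Rightarrow> 'k :: real_or_complex \<Rightarrow> 'k \<Rightarrow> 'k mat" where
  "real_jordan_block k a b = mat (2 * k) (2 * k) (\<lambda>(i, j).
     if i div 2 = j div 2 then (if i = j then a else if i < j then b else - b)
     else if j = i + 2 then 1 else 0)"

definition jordan_cell :: "'k :: real_or_complex mat \<Rightarrow> bool" where
  "jordan_cell B \<longleftrightarrow>
     (\<exists>k a. k \<ge> 1 \<and> B = jordan_block k a) \<or>
     (range (to_complex :: 'k \<Rightarrow> complex) = \<real> \<and>
      (\<exists>k a b. k \<ge> 1 \<and> b \<noteq> 0 \<and> B = real_jordan_block k a b))"

definition jordan_canonical :: "'k :: real_or_complex mat \<Rightarrow> bool" where
  "jordan_canonical J \<longleftrightarrow> (\<exists>Bs. (\<forall>B \<in> set Bs. jordan_cell B) \<and> J = diag_block_mat Bs)"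

definition N_mat :: "nat list \<Rightarrow> 'k :: real_or_complex mat" where
  "N_mat \<alpha> = diag_block_mat (map (\<lambda>k. jordan_block k 0) \<alpha>)"

definition K_mat :: "nat list \<Rightarrow> 'k :: real_or_complex mat" where
  "K_mat \<beta> = diag_block_mat (map (\<lambda>k. mat (k - 1) k (\<lambda>(i, j). if j = i then 1 else 0)) \<beta>)"

definition L_mat :: "nat list \<Rightarrow> 'k :: real_or_complex mat" where
  "L_mat \<beta> = diag_block_mat (map (\<lambda>k. mat (k - 1) k (\<lambda>(i, j). if j = i + 1 then 1 else 0)) \<beta>)"

definition kronecker_form ::
  "'k :: real_or_complex mat \<Rightarrow> 'k mat \<Rightarrow> 'k mat \<Rightarrow> 'k mat \<Rightarrow>
     'k mat \<Rightarrow> nat list \<Rightarrow> nat list \<Rightarrow> nat list \<Rightarrow> bool" where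
  "kronecker_form E A S T J \<alpha> \<beta> \<gamma> \<longleftrightarrow>
     S \<in> carrier_mat (dim_row E) (dim_row E) \<and> invertible_mat S \<and>
     T \<in> carrier_mat (dim_col E) (dim_col E) \<and> invertible_mat T \<and>
     jordan_canonical J \<and>
     (\<forall>k \<in> set \<alpha> \<union> set \<beta> \<union> set \<gamma>. k \<ge> 1) \<and>
     const_mat S * pencil E A * const_mat T =
       diag_block_mat
         [pencil (1\<^sub>m (dim_row J)) J,
          pencil (N_mat \<alpha>) (1\<^sub>m (sum_list \<alpha>)),
          pencil (K_mat \<beta>) (L_mat \<beta>),
          pencil (transpose_mat (K_mat \<gamma>)) (transpose_mat (L_mat \<gamma>))]"

definition minimal_indices :: "nat list \<Rightarrow> nat list" where
  "minimal_indices \<beta> = map (\<lambda>k. k - 1) \<beta>"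

definition kronecker_index :: "nat list \<Rightarrow> nat list \<Rightarrow> nat" where
  "kronecker_index \<alpha> \<gamma> = Max (set \<alpha> \<union> set \<gamma> \<union> {0})"

text \<open>Jordan blocks (of size \<open>k\<close> at \<open>z\<close>) are understood over the complex numbers.\<close>

definition has_jordan_block :: "'k :: real_or_complex mat \<Rightarrow> nat \<Rightarrow> complex \<Rightarrow> bool" where
  "has_jordan_block J k z \<longleftrightarrow> (\<exists>n_as. jordan_nf (map_mat to_complex J) n_as \<and> (k, z) \<in> set n_as)"

definition semi_simple :: "'k :: real_or_complex mat \<Rightarrow> complex \<Rightarrow> bool" where
  "semi_simple J z \<longleftrightarrow> \<not> (\<exists>k \<ge> 2. has_jordan_block J k z)"

end

theory Submission
  imports Defs
begin

text \<open>
  Maximality of \<open>D\<close> and \<open>L\<close> enters only through \<open>(ran L)\<^sup>\<bottom> \<times> 0 \<subseteq> L\<close> and \<open>0 \<times> (dom D)\<^sup>\<bottom> \<subseteq> D\<close>,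
  which survives complexification.  Let \<open>X = ran L \<inter> dom D\<close>, so that \<open>X\<^sup>\<bottom> = ker L + mul D\<close>.
  Choosing for each \<open>y \<in> X\<close> some \<open>(x, y) \<in> L\<close> and \<open>(y, z) \<in> D\<close> and compressing \<open>x\<close> and \<open>z\<close> to \<open>X\<close>
  gives a positive semidefinite \<open>L11\<close> and a dissipative \<open>D11\<close>; their pencil becomes regular once
  their common kernel \<open>N\<close> is split off, and \<open>D N \<inter> X\<^sup>\<bottom>\<close> (which contains \<open>mul D\<close>) is free in
  the second component.  With \<open>R = ker L\<close> and \<open>W = D N \<inter> X\<^sup>\<bottom>\<close> one has \<open>X\<^sup>\<bottom> = R + W\<close>, and the orthogonal
  complements of \<open>W\<close> and of \<open>R\<close> in \<open>X\<^sup>\<bottom>\<close> together with \<open>R \<inter> W\<close> are the second, third and fourth block row.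

  The statements on the Kronecker form do not need the block form.  If \<open>(x, y) \<in> L\<close> and \<open>\<langle>x, y\<rangle> = 0\<close>,
  then \<open>(x, 0), (0, y) \<in> L\<close> by the Cauchy-Schwarz inequality, and the real part of the form on \<open>D\<close>
  behaves likewise. Applied to the chain of vectors carried by a Kronecker block that is too
  large, this produces a pair \<open>(x, 0)\<close> or \<open>(0, x)\<close> in \<open>DL\<close> that the block does not contain.
\<close>

section \<open>Matrices as linear maps\<close>

text \<open>\<open>L\<close> and \<open>D\<close> need be neither graphs nor injective, so no matrix
  represents them until kernels and multivalued parts are split off. Moreover, for real scalars the
  eigenvalues and Jordan blocks live over the complex numbers. Both difficulties are met by the
  locale \<open>dissipative_nonnegative\<close>, which is instantiated twice: over the given field
  for the block form and the minimal indices, and over the complex numbers for the finite spectrum.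
  The number 1 is the test point for regularity: a vector with \<open>L11 c = D11 c\<close> makes
  one number both nonnegative and of nonpositive real part. The same point bounds the minimal
  indices, since the all-ones vector is a null vector of the rectangular Kronecker blocks at s = 1.
  The row transformation is the adjoint of a matrix of bases rather than an inverse, so that its
  blocks are inner products and the signs of the forms of \<open>L\<close> and \<open>D\<close> pass
  to \<open>L11\<close> and \<open>D11\<close>. The zero block row belongs to \<N>, to which all
  pairs of the product turn out to be orthogonal; the zero block column is the common kernel of
  \<open>E\<close> and \<open>A\<close>.\<close>

definition subspace_vec :: "nat \<Rightarrow> 'a :: comm_ring_1 vec set \<Rightarrow> bool" where
  "subspace_vec n U \<longleftrightarrow> U \<subseteq> carrier_vec n \<and> 0\<^sub>v n \<in> U \<and> (\<forall>x\<in>U. \<forall>y\<in>U. x + y \<in> U) \<and> (\<forall>c. \<forall>x\<in>U. c \<cdot>\<^sub>v x \<in> U)"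

lemma subspace_vecI:
  assumes "U \<subseteq> carrier_vec n" "0\<^sub>v n \<in> U" "\<And>x y. x \<in> U \<Longrightarrow> y \<in> U \<Longrightarrow> x + y \<in> U"
    "\<And>c x. x \<in> U \<Longrightarrow> c \<cdot>\<^sub>v x \<in> U"
  shows "subspace_vec n U"
  using assms by (auto simp: subspace_vec_def)

lemma subspace_vecD:
  assumes "subspace_vec n U"
  shows "U \<subseteq> carrier_vec n" "0\<^sub>v n \<in> U" "x \<in> U \<Longrightarrow> x \<in> carrier_vec n"
    "x \<in> U \<Longrightarrow> y \<in> U \<Longrightarrow> x + y \<in> U" "x \<in> U \<Longrightarrow> c \<cdot>\<^sub>v x \<in> U"
  using assms by (auto simp: subspace_vec_def)

lemma subspace_vec_diff:
  assumes "subspace_vec n U" "x \<in> U" "y \<in> U" shows "x - y \<in> U"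
proof -
  have "x + (-1) \<cdot>\<^sub>v y \<in> U" using assms by (auto simp: subspace_vec_def)
  moreover have "x + (-1) \<cdot>\<^sub>v y = x - y"
    using subspace_vecD(3)[OF assms(1)] assms(2,3) by (auto intro!: eq_vecI)
  ultimately show ?thesis by simp
qed

lemma subspace_vec_Int:
  assumes "subspace_vec n U" "subspace_vec n V" shows "subspace_vec n (U \<inter> V)"
  using assms by (auto simp: subspace_vec_def)

text \<open>Induction on the number \<open>j\<close> of leading coordinates kept: each truncation of
  \<open>c\<close> stays in \<open>U\<close>. This stands in for expansion in the standard
  basis.\<close>

lemma subspace_vec_unit_vecs:
  fixes U :: "'a :: comm_ring_1 vec set"
  assumes U: "subspace_vec k U" and units: "\<And>i. i < k \<Longrightarrow> unit_vec k i \<in> U" and c: "c \<in> carrier_vec k"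
  shows "c \<in> U"
proof -
  have "j \<le> k \<Longrightarrow> vec k (\<lambda>i. if i < j then c $ i else 0) \<in> U" for j
  proof (induction j)
    case 0
    have "vec k (\<lambda>i. if i < 0 then c $ i else 0) = 0\<^sub>v k" by auto
    then show ?case using U by (simp add: subspace_vecD)
  next
    case (Suc j)
    have "vec k (\<lambda>i. if i < Suc j then c $ i else 0) =
      vec k (\<lambda>i. if i < j then c $ i else 0) + (c $ j) \<cdot>\<^sub>v unit_vec k j"
      using Suc.prems by (auto intro!: eq_vecI simp: less_Suc_eq)
    then show ?case using Suc units[of j] U by (auto simp: subspace_vec_def)
  qed
  from this[of k] have "vec k (\<lambda>i. if i < k then c $ i else 0) \<in> U" by simp
  moreover have "vec k (\<lambda>i. if i < k then c $ i else 0) = c" using c by auto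
  ultimately show ?thesis by simp
qed

lemma mult_mat_vec_unit:
  fixes M :: "'a :: comm_ring_1 mat"
  assumes "M \<in> carrier_mat n k" "i < k" shows "M *\<^sub>v unit_vec k i = col M i"
  using assms by (intro eq_vecI) auto

lemma mult_mat_zero_vec:
  fixes M :: "'a :: comm_ring_1 mat"
  shows "M \<in> carrier_mat n k \<Longrightarrow> M *\<^sub>v 0\<^sub>v k = 0\<^sub>v n"
  by (intro eq_vecI) auto

lemma subspace_vec_image:
  fixes M :: "'a :: field mat"
  assumes M: "M \<in> carrier_mat n k" shows "subspace_vec n ((\<lambda>v. M *\<^sub>v v) ` carrier_vec k)"
proof (rule subspace_vecI)
  show "(\<lambda>v. M *\<^sub>v v) ` carrier_vec k \<subseteq> carrier_vec n" using mult_mat_vec_carrier[OF M] by blast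
  show "0\<^sub>v n \<in> (\<lambda>v. M *\<^sub>v v) ` carrier_vec k"
    using mult_mat_zero_vec[OF M] by (intro image_eqI[of _ _ "0\<^sub>v k"]) simp_all
next
  fix x y assume "x \<in> (\<lambda>v. M *\<^sub>v v) ` carrier_vec k" "y \<in> (\<lambda>v. M *\<^sub>v v) ` carrier_vec k"
  then obtain a b where "a \<in> carrier_vec k" "x = M *\<^sub>v a" "b \<in> carrier_vec k" "y = M *\<^sub>v b" by blast
  then show "x + y \<in> (\<lambda>v. M *\<^sub>v v) ` carrier_vec k"
    using mult_add_distrib_mat_vec[OF M, of a b] by (intro image_eqI[of _ _ "a + b"]) simp_all
next
  fix c x assume "x \<in> (\<lambda>v. M *\<^sub>v v) ` carrier_vec k"
  then obtain a where "a \<in> carrier_vec k" "x = M *\<^sub>v a" by blast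
  then show "c \<cdot>\<^sub>v x \<in> (\<lambda>v. M *\<^sub>v v) ` carrier_vec k"
    using mult_mat_vec[OF M, of a c] by (intro image_eqI[of _ _ "c \<cdot>\<^sub>v a"]) simp_all
qed

lemma eq_mat_mult_vecI:
  fixes A B :: "'a :: comm_ring_1 mat"
  assumes A: "A \<in> carrier_mat n k" and B: "B \<in> carrier_mat n k"
    and eq: "\<And>v. v \<in> carrier_vec k \<Longrightarrow> A *\<^sub>v v = B *\<^sub>v v"
  shows "A = B"
proof (rule mat_col_eqI)
  fix i assume "i < dim_col B"
  then have "i < k" using B by simp
  then show "col A i = col B i"
    using eq[of "unit_vec k i"] mult_mat_vec_unit[OF A] mult_mat_vec_unit[OF B] by simp
qed (use A B in auto)

text \<open>A linear relation with full domain contains the graph of a linear map. Images are chosen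
  for the unit vectors only, and the vectors at which the resulting matrix is correct form a
  subspace. Factorizations of matrices and linear choices of elements of \<open>L\<close> and
  \<open>D\<close> both come from here.\<close>

lemma linear_selection:
  fixes R :: "'a :: field vec \<Rightarrow> 'a vec \<Rightarrow> bool"
  assumes total: "\<And>i. i < k \<Longrightarrow> \<exists>x\<in>carrier_vec p. R (unit_vec k i) x"
    and zero: "R (0\<^sub>v k) (0\<^sub>v p)"
    and add: "\<And>c d x y. c \<in> carrier_vec k \<Longrightarrow> d \<in> carrier_vec k \<Longrightarrow> x \<in> carrier_vec p \<Longrightarrow>
      y \<in> carrier_vec p \<Longrightarrow> R c x \<Longrightarrow> R d y \<Longrightarrow> R (c + d) (x + y)"
    and smult: "\<And>a c x. c \<in> carrier_vec k \<Longrightarrow> x \<in> carrier_vec p \<Longrightarrow> R c x \<Longrightarrow> R (a \<cdot>\<^sub>v c) (a \<cdot>\<^sub>v x)"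
  obtains X where "X \<in> carrier_mat p k" "\<And>c. c \<in> carrier_vec k \<Longrightarrow> R c (X *\<^sub>v c)"
proof -
  have "\<exists>x. \<forall>i\<in>{..<k}. x i \<in> carrier_vec p \<and> R (unit_vec k i) (x i)"
    using total by (intro bchoice) blast
  then obtain x where x: "\<And>i. i < k \<Longrightarrow> x i \<in> carrier_vec p" "\<And>i. i < k \<Longrightarrow> R (unit_vec k i) (x i)"
    by blast
  define X where "X = mat_of_cols p (map x [0..<k])"
  have X: "X \<in> carrier_mat p k" using mat_of_cols_carrier(1)[of p "map x [0..<k]"] by (simp add: X_def)
  have "subspace_vec k {c \<in> carrier_vec k. R c (X *\<^sub>v c)}"
  proof (intro subspace_vecI)
    show "0\<^sub>v k \<in> {c \<in> carrier_vec k. R c (X *\<^sub>v c)}" using zero mult_mat_zero_vec[OF X] by simp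
  next
    fix c d assume "c \<in> {c \<in> carrier_vec k. R c (X *\<^sub>v c)}" "d \<in> {c \<in> carrier_vec k. R c (X *\<^sub>v c)}"
    then show "c + d \<in> {c \<in> carrier_vec k. R c (X *\<^sub>v c)}"
      using add[of c d "X *\<^sub>v c" "X *\<^sub>v d"] X mult_add_distrib_mat_vec[OF X, of c d] by simp
  next
    fix a c assume "c \<in> {c \<in> carrier_vec k. R c (X *\<^sub>v c)}"
    then show "a \<cdot>\<^sub>v c \<in> {c \<in> carrier_vec k. R c (X *\<^sub>v c)}"
      using smult[of c "X *\<^sub>v c" a] X mult_mat_vec[OF X, of c a] by simp
  qed auto
  moreover have "unit_vec k i \<in> {c \<in> carrier_vec k. R c (X *\<^sub>v c)}" if "i < k" for i
  proof -
    have "X *\<^sub>v unit_vec k i = x i"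
      using mult_mat_vec_unit[OF X that] x(1)[OF that] that by (simp add: X_def)
    then show ?thesis using x(2)[OF that] by simp
  qed
  ultimately have "R c (X *\<^sub>v c)" if "c \<in> carrier_vec k" for c
    using subspace_vec_unit_vecs[OF _ _ that] by blast
  then show ?thesis by (rule that[OF X])
qed

section \<open>Injective matrices, bases of subspaces and dimension counts\<close>

definition inj_mat :: "'a :: comm_ring_1 mat \<Rightarrow> bool" where
  "inj_mat M \<longleftrightarrow> (\<forall>v\<in>carrier_vec (dim_col M). M *\<^sub>v v = 0\<^sub>v (dim_row M) \<longrightarrow> v = 0\<^sub>v (dim_col M))"

lemma inj_matI:
  assumes "M \<in> carrier_mat n k" "\<And>v. v \<in> carrier_vec k \<Longrightarrow> M *\<^sub>v v = 0\<^sub>v n \<Longrightarrow> v = 0\<^sub>v k"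
  shows "inj_mat M"
  using assms by (auto simp: inj_mat_def)

lemma inj_matD:
  assumes "inj_mat M" "M \<in> carrier_mat n k" "v \<in> carrier_vec k" "M *\<^sub>v v = 0\<^sub>v n"
  shows "v = 0\<^sub>v k"
  using assms by (auto simp: inj_mat_def)

text \<open>If \<open>k\<close> exceeded \<open>n\<close>, padding \<open>M\<close> with zero rows
  would give a singular square matrix, and a null vector of it is a null vector of
  \<open>M\<close>.\<close>

lemma inj_mat_le:
  fixes M :: "'a :: field mat"
  assumes M: "M \<in> carrier_mat n k" and "inj_mat M" shows "k \<le> n"
proof (rule ccontr)
  assume "\<not> k \<le> n"
  define Z where "Z = mat k k (\<lambda>(i, j). if i < n then M $$ (i, j) else 0)"
  have Z: "Z \<in> carrier_mat k k" by (simp add: Z_def)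
  have "col (transpose_mat Z) n = 0\<^sub>v k" using \<open>\<not> k \<le> n\<close> by (auto simp: Z_def)
  then have "transpose_mat Z *\<^sub>v unit_vec k n = 0\<^sub>v k"
    using mult_mat_vec_unit[of "transpose_mat Z" k k n] Z \<open>\<not> k \<le> n\<close> by simp
  moreover have "unit_vec k n \<noteq> (0\<^sub>v k :: 'a vec)" using \<open>\<not> k \<le> n\<close> by simp
  ultimately have "\<exists>v. v \<in> carrier_vec k \<and> v \<noteq> 0\<^sub>v k \<and> transpose_mat Z *\<^sub>v v = 0\<^sub>v k"
    by (intro exI[of _ "unit_vec k n"]) simp
  then have "det (transpose_mat Z) = 0"
    using det_0_iff_vec_prod_zero_field[of "transpose_mat Z" k] Z by simp
  then have "det Z = 0" using det_transpose[OF Z] by simp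
  then obtain v where v: "v \<in> carrier_vec k" "v \<noteq> 0\<^sub>v k" "Z *\<^sub>v v = 0\<^sub>v k"
    using det_0_iff_vec_prod_zero_field[OF Z] by blast
  have "M *\<^sub>v v = 0\<^sub>v n"
  proof (rule eq_vecI)
    fix i assume "i < dim_vec (0\<^sub>v n :: 'a vec)"
    then have i: "i < n" by simp
    have "(M *\<^sub>v v) $ i = (Z *\<^sub>v v) $ i"
      using M Z v(1) i \<open>\<not> k \<le> n\<close> by (auto simp: Z_def scalar_prod_def intro!: sum.cong)
    then show "(M *\<^sub>v v) $ i = 0\<^sub>v n $ i" using v i \<open>\<not> k \<le> n\<close> by simp
  qed (use M in simp)
  then show False using v inj_matD[OF \<open>inj_mat M\<close> M] by blast
qed

definition hcat2 :: "'a :: comm_ring_1 mat \<Rightarrow> 'a mat \<Rightarrow> 'a mat" where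
  "hcat2 A B = four_block_mat A B (0\<^sub>m 0 (dim_col A)) (0\<^sub>m 0 (dim_col B))"

lemma hcat2_carrier [simp]:
  "A \<in> carrier_mat n k \<Longrightarrow> B \<in> carrier_mat n l \<Longrightarrow> hcat2 A B \<in> carrier_mat n (k + l)"
  by (auto simp: hcat2_def)

lemma hcat2_mult_vec:
  assumes "A \<in> carrier_mat n k" "B \<in> carrier_mat n l" "a \<in> carrier_vec k" "b \<in> carrier_vec l"
  shows "hcat2 A B *\<^sub>v (a @\<^sub>v b) = A *\<^sub>v a + B *\<^sub>v b"
proof -
  have "hcat2 A B *\<^sub>v (a @\<^sub>v b) =
      (A *\<^sub>v a + B *\<^sub>v b) @\<^sub>v (0\<^sub>m 0 k *\<^sub>v a + 0\<^sub>m 0 l *\<^sub>v b)"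
    unfolding hcat2_def using assms
    by (subst four_block_mat_mult_vec[of _ n k _ l _ 0]) auto
  also have "\<dots> = A *\<^sub>v a + B *\<^sub>v b" using assms by (intro eq_vecI) auto
  finally show ?thesis .
qed

lemma carrier_vec_appendE:
  assumes "v \<in> carrier_vec (k + l)"
  obtains a b where "v = a @\<^sub>v b" "a \<in> carrier_vec k" "b \<in> carrier_vec l"
  using vec_first_last_append[OF assms] vec_first_carrier vec_last_carrier that by metis

lemma append_vec_zero [simp]: "0\<^sub>v k @\<^sub>v 0\<^sub>v l = 0\<^sub>v (k + l)"
  by (intro eq_vecI) auto

lemma append_vec_assoc: "(u @\<^sub>v v) @\<^sub>v w = u @\<^sub>v (v @\<^sub>v w)"
  by (intro eq_vecI) auto

text \<open>A maximal injective matrix with columns in \<open>U\<close> spans \<open>U\<close>.\<close>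

lemma subspace_vec_basis:
  fixes U :: "'a :: field vec set"
  assumes U: "subspace_vec n U"
  obtains k M where "M \<in> carrier_mat n k" "inj_mat M" "U = (\<lambda>v. M *\<^sub>v v) ` carrier_vec k"
proof -
  define P where "P k \<longleftrightarrow> (\<exists>M. M \<in> carrier_mat n k \<and> inj_mat M \<and> (\<lambda>v. M *\<^sub>v v) ` carrier_vec k \<subseteq> U)" for k
  have "0\<^sub>m n 0 *\<^sub>v v = 0\<^sub>v n" if "v \<in> carrier_vec 0" for v :: "'a vec"
    using that by (intro eq_vecI) (auto simp: scalar_prod_def)
  then have "P 0" unfolding P_def using U
    by (intro exI[of _ "0\<^sub>m n 0"]) (auto simp: inj_mat_def subspace_vec_def)
  have "P k \<Longrightarrow> k \<le> n" for k unfolding P_def using inj_mat_le by blast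
  then obtain k where "P k" "\<And>l. P l \<Longrightarrow> l \<le> k"
    using \<open>P 0\<close> GreatestI_nat[of P 0 n] Greatest_le_nat[of P _ n] by blast
  then obtain M where M: "M \<in> carrier_mat n k" "inj_mat M"
    and sub: "(\<lambda>v. M *\<^sub>v v) ` carrier_vec k \<subseteq> U" unfolding P_def by blast
  have "u \<in> (\<lambda>v. M *\<^sub>v v) ` carrier_vec k" if u: "u \<in> U" for u
  proof (rule ccontr)
    assume notin: "u \<notin> (\<lambda>v. M *\<^sub>v v) ` carrier_vec k"
    have uc: "u \<in> carrier_vec n" using u U by (auto simp: subspace_vec_def)
    define C where "C = mat n 1 (\<lambda>(i, j). u $ i)"
    have C: "C \<in> carrier_mat n 1" by (simp add: C_def)
    have Cv: "C *\<^sub>v v = (v $ 0) \<cdot>\<^sub>v u" if "v \<in> carrier_vec 1" for v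
      using that uc by (intro eq_vecI) (auto simp: C_def scalar_prod_def)
    have MC: "hcat2 M C \<in> carrier_mat n (k + 1)" using hcat2_carrier[OF M(1) C] .
    have "inj_mat (hcat2 M C)"
    proof (rule inj_matI[OF MC])
      fix v assume "v \<in> carrier_vec (k + 1)" and eq: "hcat2 M C *\<^sub>v v = 0\<^sub>v n"
      then obtain a b where v: "v = a @\<^sub>v b" and a: "a \<in> carrier_vec k" and b: "b \<in> carrier_vec 1"
        using carrier_vec_appendE by blast
      have eq0: "M *\<^sub>v a + (b $ 0) \<cdot>\<^sub>v u = 0\<^sub>v n"
        using eq unfolding v hcat2_mult_vec[OF M(1) C a b] Cv[OF b] .
      \<comment> \<open>With a non-zero last coefficient the equation could be solved for
        \<open>u\<close>, which would put \<open>u\<close> into the span.\<close>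
      have "b $ 0 = 0"
      proof (rule ccontr)
        assume ne: "b $ 0 \<noteq> 0"
        have "u = M *\<^sub>v ((- inverse (b $ 0)) \<cdot>\<^sub>v a)"
        proof (rule eq_vecI)
          fix i assume "i < dim_vec (M *\<^sub>v ((- inverse (b $ 0)) \<cdot>\<^sub>v a))"
          then have i: "i < n" using M by simp
          have "(M *\<^sub>v a) $ i + b $ 0 * u $ i = 0"
            using arg_cong[OF eq0, of "\<lambda>v. v $ i"] i uc M(1) by simp
          then have "u $ i = - inverse (b $ 0) * (M *\<^sub>v a) $ i"
            using ne by (simp add: field_simps add_eq_0_iff)
          then show "u $ i = (M *\<^sub>v ((- inverse (b $ 0)) \<cdot>\<^sub>v a)) $ i"
            using i M(1) a by (simp add: mult_mat_vec[OF M(1)])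
        qed (use uc M in auto)
        then have "u \<in> (\<lambda>v. M *\<^sub>v v) ` carrier_vec k" by (rule image_eqI) (use a in simp)
        then show False using notin by contradiction
      qed
      moreover have "b = 0\<^sub>v 1" using b calculation by (intro eq_vecI) simp_all
      moreover have "0 \<cdot>\<^sub>v u = 0\<^sub>v n" using uc by (intro eq_vecI) simp_all
      then have "M *\<^sub>v a = 0\<^sub>v n" using eq0 \<open>b $ 0 = 0\<close> M(1) a by simp
      then have "a = 0\<^sub>v k" using inj_matD[OF M(2,1) a] by blast
      ultimately show "v = 0\<^sub>v (k + 1)" unfolding v by simp
    qed
    moreover have "hcat2 M C *\<^sub>v v \<in> U" if "v \<in> carrier_vec (k + 1)" for v
    proof -
      obtain a b where v: "v = a @\<^sub>v b" and a: "a \<in> carrier_vec k" and b: "b \<in> carrier_vec 1"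
        using carrier_vec_appendE \<open>v \<in> carrier_vec (k + 1)\<close> by blast
      show ?thesis unfolding v hcat2_mult_vec[OF M(1) C a b] Cv[OF b]
        using U u sub a by (auto simp: subspace_vec_def)
    qed
    ultimately have "P (k + 1)" unfolding P_def using MC by blast
    then show False using \<open>\<And>l. P l \<Longrightarrow> l \<le> k\<close>[of "k + 1"] by simp
  qed
  then show ?thesis using that M sub by blast
qed

lemma mat_factorization:
  fixes M U :: "'a :: field mat"
  assumes M: "M \<in> carrier_mat n m" and U: "U \<in> carrier_mat n p"
    and sub: "\<And>v. v \<in> carrier_vec m \<Longrightarrow> M *\<^sub>v v \<in> (\<lambda>w. U *\<^sub>v w) ` carrier_vec p"
  obtains M' where "M' \<in> carrier_mat p m" "M = U * M'"
proof -
  obtain M' where M': "M' \<in> carrier_mat p m" "\<And>c. c \<in> carrier_vec m \<Longrightarrow> U *\<^sub>v (M' *\<^sub>v c) = M *\<^sub>v c"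
  proof (rule linear_selection[of m p "\<lambda>c x. U *\<^sub>v x = M *\<^sub>v c"])
    show "\<exists>x\<in>carrier_vec p. U *\<^sub>v x = M *\<^sub>v unit_vec m i" for i
      using sub[of "unit_vec m i"] by (auto intro: sym)
    show "U *\<^sub>v 0\<^sub>v p = M *\<^sub>v 0\<^sub>v m" unfolding mult_mat_zero_vec[OF U] mult_mat_zero_vec[OF M] ..
    show "U *\<^sub>v (x + y) = M *\<^sub>v (c + d)" if "c \<in> carrier_vec m" "d \<in> carrier_vec m" "x \<in> carrier_vec p"
      "y \<in> carrier_vec p" "U *\<^sub>v x = M *\<^sub>v c" "U *\<^sub>v y = M *\<^sub>v d" for c d x y
      using that mult_add_distrib_mat_vec[OF U that(3,4)] mult_add_distrib_mat_vec[OF M that(1,2)] by simp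
    show "U *\<^sub>v (a \<cdot>\<^sub>v x) = M *\<^sub>v (a \<cdot>\<^sub>v c)" if "c \<in> carrier_vec m" "x \<in> carrier_vec p" "U *\<^sub>v x = M *\<^sub>v c" for a c x
      using that mult_mat_vec[OF U that(2)] mult_mat_vec[OF M that(1)] by simp
  qed blast
  have "M = U * M'"
    using assoc_mult_mat_vec[OF U M'(1)] M'(2)
    by (intro eq_mat_mult_vecI[OF M mult_carrier_mat[OF U M'(1)]]) simp
  then show ?thesis using that M'(1) by blast
qed

text \<open>Surjectivity yields a right inverse \<open>Q\<close>, and a right inverse is injective;
  the dimension bound for \<open>M\<close> and for \<open>Q\<close> then gives both inequalities.
  Squareness is a conclusion because the number of columns of the transformation \<open>T\<close> is
  a sum of dimensions found during its construction.\<close>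

lemma bij_mat_square:
  fixes M :: "'a :: field mat"
  assumes M: "M \<in> carrier_mat n k" and inj: "inj_mat M"
    and surj: "\<And>y. y \<in> carrier_vec n \<Longrightarrow> \<exists>v\<in>carrier_vec k. M *\<^sub>v v = y"
  shows "n = k" "invertible_mat M"
proof -
  obtain Q where Q: "Q \<in> carrier_mat k n" "1\<^sub>m n = M * Q"
    by (rule mat_factorization[OF one_carrier_mat M]) (use surj in \<open>auto simp: image_iff intro: sym\<close>)
  have "inj_mat Q"
  proof (rule inj_matI[OF Q(1)])
    fix v assume v: "v \<in> carrier_vec n" "Q *\<^sub>v v = 0\<^sub>v k"
    then have "v = (M * Q) *\<^sub>v v" unfolding Q(2)[symmetric] by simp
    also have "\<dots> = M *\<^sub>v (Q *\<^sub>v v)" using M Q(1) v by simp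
    also have "\<dots> = 0\<^sub>v n" using v M by auto
    finally show "v = 0\<^sub>v n" .
  qed
  then show nk: "n = k" using inj_mat_le[OF M inj] inj_mat_le[OF Q(1)] by simp
  have "Q * M = 1\<^sub>m n" using mat_mult_left_right_inverse[of M n Q] M Q nk by simp
  then show "invertible_mat M" unfolding invertible_mat_def inverts_mat_def using M Q nk by auto
qed

lemma inj_square_invertible:
  fixes M :: "'a :: field mat"
  assumes M: "M \<in> carrier_mat n n" and inj: "inj_mat M"
  obtains Q where "Q \<in> carrier_mat n n" "M * Q = 1\<^sub>m n" "Q * M = 1\<^sub>m n"
proof -
  have "det M \<noteq> 0" using det_0_iff_vec_prod_zero_field[OF M] inj_matD[OF inj M] by blast
  then show ?thesis using det_non_zero_imp_unit[OF M, of "()"] that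
    by (auto simp: Units_def ring_mat_def)
qed

text \<open>\<open>invertible_mat\<close> does not record the dimensions of the inverse; they are
  recovered by comparing the dimensions of the two products with those of identity matrices.\<close>

lemma invertible_matE:
  fixes M :: "'a :: field mat"
  assumes "M \<in> carrier_mat n n" "invertible_mat M"
  obtains Q where "Q \<in> carrier_mat n n" "M * Q = 1\<^sub>m n" "Q * M = 1\<^sub>m n"
proof -
  obtain Q where Q: "inverts_mat M Q" "inverts_mat Q M" using assms by (auto simp: invertible_mat_def)
  have "M * Q = 1\<^sub>m n" using Q(1) assms(1) by (simp add: inverts_mat_def)
  moreover have "dim_col Q = n" using arg_cong[OF calculation, of dim_col] by simp
  moreover have QM: "Q * M = 1\<^sub>m (dim_row Q)" using Q(2) by (simp add: inverts_mat_def)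
  moreover have "dim_row Q = n" using arg_cong[OF QM, of dim_col] assms(1) by simp
  ultimately show ?thesis using that[of Q] by auto
qed

section \<open>Ranks compared through column spaces\<close>

lemma rank_mono:
  fixes A B :: "'a :: field mat"
  assumes A: "A \<in> carrier_mat n k" and B: "B \<in> carrier_mat n l"
    and sub: "\<And>v. v \<in> carrier_vec k \<Longrightarrow> \<exists>w\<in>carrier_vec l. A *\<^sub>v v = B *\<^sub>v w"
  shows "vec_space.rank n A \<le> vec_space.rank n B"
proof -
  interpret vec_space "TYPE('a)" n .
  have "col_space A \<subseteq> col_space B"
    unfolding col_space_eq[OF A] col_space_eq[OF B] using sub A B by fastforce
  then have sp: "span (set (cols A)) \<subseteq> span (set (cols B))" by (simp add: col_space_def)
  have c: "set (cols A) \<subseteq> carrier_vec n" "set (cols B) \<subseteq> carrier_vec n"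
    using A B cols_dim by blast+
  have subs: "subspace class_ring (span (set (cols A))) V" "subspace class_ring (span (set (cols B))) V"
    using c span_is_subspace by auto
  have s2: "subspace class_ring (span (set (cols A))) (vs (span (set (cols B))))"
    using nested_subspaces[OF subs(2,1) sp] .
  have "vectorspace.fin_dim class_ring (vs (span (set (cols A))))"
    "vectorspace.fin_dim class_ring (vs (span (set (cols B))))"
    using fin_dim_span_cols A B by auto
  then show ?thesis unfolding rank_def
    using vectorspace.subspace_dim[OF subspace_is_vs[OF subs(2)] s2] by auto
qed

lemma rank_inj_mat:
  fixes U :: "'a :: field mat"
  assumes U: "U \<in> carrier_mat n p" and inj: "inj_mat U"
  shows "vec_space.rank n U = p"
proof -
  interpret vec_space "TYPE('a)" n .
  \<comment> \<open>\<open>lin_indpt\<close> speaks of the set of columns, so repetitions have to be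
    excluded separately.\<close>
  have dist: "distinct (cols U)"
  proof (rule ccontr)
    assume "\<not> distinct (cols U)"
    then obtain i j where ij: "i < p" "j < p" "i \<noteq> j" "col U i = col U j"
      using U by (auto simp: distinct_conv_nth)
    have "U *\<^sub>v (unit_vec p i - unit_vec p j) = 0\<^sub>v n"
      using ij U by (simp add: mult_minus_distrib_mat_vec mult_mat_vec_unit[OF U])
    then have "unit_vec p i - unit_vec p j = (0\<^sub>v p :: 'a vec)"
      using inj_matD[OF inj U] by auto
    from arg_cong[OF this, of "\<lambda>v. v $ i"] show False using ij by simp
  qed
  have "lin_indpt (set (cols U))"
    using lin_depE[OF U _ dist] inj_matD[OF inj U] by metis
  then show ?thesis using lin_indpt_full_rank[OF U dist] by blast
qed

section \<open>The inner product\<close>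

interpretation to_complex: field_hom "to_complex :: 'k :: real_or_complex \<Rightarrow> complex"
proof
  have "to_complex (0 :: 'k) + to_complex (0 :: 'k) = to_complex (0 :: 'k)"
    using to_complex_add[of "0 :: 'k" 0] by simp
  then show "to_complex (0 :: 'k) = 0" by simp
qed (auto simp: to_complex_one to_complex_add to_complex_mult)

lemma real_in_range_to_complex: "\<exists>t :: 'k :: real_or_complex. to_complex t = complex_of_real r"
proof -
  have "complex_of_real r \<in> range (to_complex :: 'k \<Rightarrow> complex)" using range_to_complex[where 'a = 'k] by auto
  then show ?thesis by (metis imageE)
qed

text \<open>Complex-valued also for real scalars, so that real and imaginary parts are available in
  one notation for both fields.\<close>

definition cip :: "'k :: real_or_complex vec \<Rightarrow> 'k vec \<Rightarrow> complex" where
  "cip x y = to_complex (x \<bullet>c y)"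

lemma cip_sum:
  assumes "y \<in> carrier_vec n"
  shows "cip x y = (\<Sum>i<n. to_complex (x $ i) * cnj (to_complex (y $ i)))"
  using assms
  by (auto simp: cip_def scalar_prod_def to_complex.hom_sum to_complex_mult to_complex_conjugate
      atLeast0LessThan intro!: sum.cong)

lemma cip_add_left:
  assumes "x \<in> carrier_vec n" "y \<in> carrier_vec n" "z \<in> carrier_vec n"
  shows "cip (x + y) z = cip x z + cip y z"
  using assms by (simp add: cip_sum[of z n] to_complex_add algebra_simps sum.distrib)

lemma cip_add_right:
  assumes "x \<in> carrier_vec n" "y \<in> carrier_vec n" "z \<in> carrier_vec n"
  shows "cip z (x + y) = cip z x + cip z y"
  using assms by (simp add: cip_sum[of _ n] to_complex_add algebra_simps sum.distrib)

lemma cip_smult_left: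
  assumes "x \<in> carrier_vec n" "z \<in> carrier_vec n"
  shows "cip (c \<cdot>\<^sub>v x) z = to_complex c * cip x z"
  using assms by (simp add: cip_sum[of _ n] to_complex_mult sum_distrib_left mult_ac)

lemma cip_smult_right:
  assumes "x \<in> carrier_vec n" "z \<in> carrier_vec n"
  shows "cip z (c \<cdot>\<^sub>v x) = cnj (to_complex c) * cip z x"
  using assms by (simp add: cip_sum[of _ n] to_complex_mult sum_distrib_left mult_ac)

lemma cip_minus_left:
  assumes "x \<in> carrier_vec n" "y \<in> carrier_vec n" "z \<in> carrier_vec n"
  shows "cip (x - y) z = cip x z - cip y z"
  using assms by (simp add: cip_sum[of z n] to_complex.hom_minus algebra_simps sum_subtractf)

lemma cip_cnj:
  assumes "x \<in> carrier_vec n" "y \<in> carrier_vec n"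
  shows "cnj (cip x y) = cip y x"
  using assms by (simp add: cip_sum[of _ n] mult_ac)

lemma cip_commute_zero:
  assumes "x \<in> carrier_vec n" "y \<in> carrier_vec n"
  shows "cip x y = 0 \<longleftrightarrow> cip y x = 0"
  using cip_cnj[OF assms] by (metis complex_cnj_zero_iff)

lemma cip_zero_left [simp]: "z \<in> carrier_vec n \<Longrightarrow> cip (0\<^sub>v n) z = 0"
  by (simp add: cip_sum)

lemma cip_zero_right [simp]: "z \<in> carrier_vec n \<Longrightarrow> cip z (0\<^sub>v n) = 0"
  by (simp add: cip_sum[of _ n])

lemma cip_self_eq_0:
  assumes x: "x \<in> carrier_vec n" and eq: "cip x x = 0"
  shows "x = 0\<^sub>v n"
proof -
  have "Re (cip x x) = (\<Sum>i<n. (cmod (to_complex (x $ i)))\<^sup>2)"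
    unfolding cip_sum[OF x] by (simp add: complex_mult_cnj cmod_power2)
  then have "(\<Sum>i<n. (cmod (to_complex (x $ i)))\<^sup>2) = 0" using eq by simp
  then have "\<forall>i<n. to_complex (x $ i) = 0" by (subst (asm) sum_nonneg_eq_0_iff) auto
  then show ?thesis using x by (intro eq_vecI) auto
qed

text \<open>A non-zero linear functional has arbitrarily large real parts. This turns an inequality
  valid for all scalars into an orthogonality relation; the scalars range over the given field, so
  the contradicting one is built as \<open>r * conjugate s\<close>.\<close>

lemma bounded_real_linear_imp_zero:
  assumes "\<And>t :: 'k :: real_or_complex. Re (to_complex t * to_complex (s :: 'k)) \<le> a"
  shows "s = 0"
proof (rule ccontr)
  assume "s \<noteq> 0"
  then have pos: "(cmod (to_complex s))\<^sup>2 > 0" by simp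
  \<comment> \<open>Scaled so that \<open>r * conjugate s\<close> times \<open>s\<close> is the
    absolute value of \<open>a\<close> plus one, which exceeds the bound \<open>a\<close>.\<close>
  obtain r :: 'k where r: "to_complex r = complex_of_real ((\<bar>a\<bar> + 1) / (cmod (to_complex s))\<^sup>2)"
    using real_in_range_to_complex by blast
  have "to_complex (r * conjugate s) * to_complex s =
      to_complex r * (to_complex s * cnj (to_complex s))"
    by (simp add: to_complex_mult to_complex_conjugate)
  also have "\<dots> = complex_of_real (\<bar>a\<bar> + 1)"
    using pos by (simp add: r flip: complex_norm_square)
  finally have "\<bar>a\<bar> + 1 \<le> a" using assms[of "r * conjugate s"] by simp
  then show False by simp
qed

section \<open>Orthogonal complements and adjoint matrices\<close>

definition orth :: "nat \<Rightarrow> 'k :: real_or_complex vec set \<Rightarrow> 'k vec set" where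
  "orth n U = {x \<in> carrier_vec n. \<forall>u\<in>U. cip x u = 0}"

lemma subspace_vec_orth: "U \<subseteq> carrier_vec n \<Longrightarrow> subspace_vec n (orth n U)"
  by (rule subspace_vecI) (auto simp: orth_def cip_add_left[of _ n] cip_smult_left[of _ n] subset_iff)

lemma orth_anti: "U \<subseteq> V \<Longrightarrow> orth n V \<subseteq> orth n U"
  by (auto simp: orth_def)

lemma adjoint_dim [simp]: "dim_row (mat_adjoint A) = dim_col A" "dim_col (mat_adjoint A) = dim_row A"
  by (auto simp: mat_adjoint_def)

lemma adjoint_carrier [simp]: "A \<in> carrier_mat n k \<Longrightarrow> mat_adjoint A \<in> carrier_mat k n"
  by (rule carrier_matI) auto

lemma adjoint_index [simp]:
  "i < dim_col A \<Longrightarrow> j < dim_row A \<Longrightarrow> mat_adjoint A $$ (i, j) = conjugate (A $$ (j, i))"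
  by (simp add: mat_adjoint_def mat_of_rows_def)

lemma cip_adjoint:
  assumes M: "M \<in> carrier_mat n k" and x: "x \<in> carrier_vec n" and c: "c \<in> carrier_vec k"
  shows "cip (mat_adjoint M *\<^sub>v x) c = cip x (M *\<^sub>v c)"
proof -
  have "cip (mat_adjoint M *\<^sub>v x) c =
      (\<Sum>i<k. (\<Sum>j<n. cnj (to_complex (M $$ (j, i))) * to_complex (x $ j)) * cnj (to_complex (c $ i)))"
    using M x c
    by (auto simp: cip_sum[OF c] scalar_prod_def to_complex.hom_sum to_complex_mult
        to_complex_conjugate atLeast0LessThan intro!: sum.cong)
  also have "\<dots> = (\<Sum>j<n. \<Sum>i<k. cnj (to_complex (M $$ (j, i))) * to_complex (x $ j) * cnj (to_complex (c $ i)))"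
    by (simp add: sum_distrib_right) (rule sum.swap)
  also have "\<dots> = (\<Sum>j<n. to_complex (x $ j) * cnj (\<Sum>i<k. to_complex (M $$ (j, i)) * to_complex (c $ i)))"
    by (simp add: sum_distrib_left mult_ac)
  also have "\<dots> = cip x (M *\<^sub>v c)"
    using M c
    by (auto simp: cip_sum[of "M *\<^sub>v c" n] scalar_prod_def to_complex.hom_sum to_complex_mult
        atLeast0LessThan intro!: sum.cong)
  finally show ?thesis .
qed

text \<open>For the converse, \<open>x\<close> is tested against \<open>M *\<^sub>v c\<close> with
  \<open>c\<close> the vector \<open>mat_adjoint M *\<^sub>v x\<close> itself, which makes
  \<open>c\<close> orthogonal to itself. Through this equivalence the vanishing of a block of
  coordinates becomes orthogonality to a subspace.\<close>

lemma adjoint_mult_eq_0_iff: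
  assumes M: "M \<in> carrier_mat n k" and x: "x \<in> carrier_vec n"
  shows "mat_adjoint M *\<^sub>v x = 0\<^sub>v k \<longleftrightarrow> x \<in> orth n ((\<lambda>c. M *\<^sub>v c) ` carrier_vec k)"
proof
  assume eq: "mat_adjoint M *\<^sub>v x = 0\<^sub>v k"
  have "cip x (M *\<^sub>v c) = 0" if "c \<in> carrier_vec k" for c
    using cip_adjoint[OF M x that] that by (simp add: eq)
  then show "x \<in> orth n ((\<lambda>c. M *\<^sub>v c) ` carrier_vec k)" using x by (auto simp: orth_def)
next
  assume x': "x \<in> orth n ((\<lambda>c. M *\<^sub>v c) ` carrier_vec k)"
  let ?c = "mat_adjoint M *\<^sub>v x"
  have c: "?c \<in> carrier_vec k" by (rule mult_mat_vec_carrier[OF adjoint_carrier[OF M] x])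
  then have "cip x (M *\<^sub>v ?c) = 0" using x' by (auto simp: orth_def)
  then have "cip ?c ?c = 0" using cip_adjoint[OF M x c] by simp
  then show "?c = 0\<^sub>v k" using cip_self_eq_0 c by blast
qed

lemma minus_vec_eq_0:
  fixes x y :: "'a :: ring_1 vec"
  assumes "x \<in> carrier_vec n" "y \<in> carrier_vec n" "x - y = 0\<^sub>v n"
  shows "x = y"
proof (rule eq_vecI)
  fix i assume "i < dim_vec y"
  then have i: "i < n" using assms by simp
  have "x $ i - y $ i = (x - y) $ i" using assms(1,2) i by simp
  also have "\<dots> = 0" unfolding assms(3) using i by simp
  finally show "x $ i = y $ i" by simp
qed (use assms in simp)

text \<open>Orthogonal projection by the normal equations: for injective \<open>M\<close> the Gram
  matrix \<open>?G\<close> is injective, hence invertible, and its inverse gives the coefficients of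
  the projection.\<close>

lemma orth_decomposition:
  assumes U: "subspace_vec n U" and x: "x \<in> carrier_vec n"
  obtains u where "u \<in> U" "x - u \<in> orth n U"
proof -
  obtain k M where M: "M \<in> carrier_mat n k" "inj_mat M" and UM: "U = (\<lambda>v. M *\<^sub>v v) ` carrier_vec k"
    by (rule subspace_vec_basis[OF U])
  let ?G = "mat_adjoint M * M"
  have Mc: "mat_adjoint M \<in> carrier_mat k n" using M by simp
  have G: "?G \<in> carrier_mat k k" by (rule mult_carrier_mat[OF Mc M(1)])
  have "inj_mat ?G"
  proof (rule inj_matI[OF G])
    fix c assume c: "c \<in> carrier_vec k" and "?G *\<^sub>v c = 0\<^sub>v k"
    then have "mat_adjoint M *\<^sub>v (M *\<^sub>v c) = 0\<^sub>v k" using M Mc by simp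
    then have "M *\<^sub>v c \<in> orth n U" using adjoint_mult_eq_0_iff[OF M(1), of "M *\<^sub>v c"] M c UM by simp
    then have "cip (M *\<^sub>v c) (M *\<^sub>v c) = 0" using c UM by (simp add: orth_def)
    then have "M *\<^sub>v c = 0\<^sub>v n" using cip_self_eq_0[of "M *\<^sub>v c" n] M c by simp
    then show "c = 0\<^sub>v k" using inj_matD[OF M(2,1) c] by simp
  qed
  then obtain H where H: "H \<in> carrier_mat k k" "?G * H = 1\<^sub>m k" by (rule inj_square_invertible[OF G])
  define c where "c = H *\<^sub>v (mat_adjoint M *\<^sub>v x)"
  have y: "mat_adjoint M *\<^sub>v x \<in> carrier_vec k" using Mc x by simp
  have c: "c \<in> carrier_vec k" using H y by (simp add: c_def)
  have "mat_adjoint M *\<^sub>v (M *\<^sub>v c) = ?G *\<^sub>v c"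
    by (rule assoc_mult_mat_vec[OF Mc M(1) c, symmetric])
  also have "\<dots> = (?G * H) *\<^sub>v (mat_adjoint M *\<^sub>v x)"
    unfolding c_def by (rule assoc_mult_mat_vec[OF G H(1) y, symmetric])
  also have "\<dots> = mat_adjoint M *\<^sub>v x" unfolding H(2) using y by simp
  finally have "mat_adjoint M *\<^sub>v (x - M *\<^sub>v c) = 0\<^sub>v k"
    using mult_minus_distrib_mat_vec[OF Mc x, of "M *\<^sub>v c"] M c y by simp
  then have "x - M *\<^sub>v c \<in> orth n U"
    using adjoint_mult_eq_0_iff[OF M(1), of "x - M *\<^sub>v c"] M c x UM by simp
  then show ?thesis using that[of "M *\<^sub>v c"] c UM by blast
qed

lemma orth_orth:
  assumes U: "subspace_vec n U" shows "orth n (orth n U) = U"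
proof
  show "U \<subseteq> orth n (orth n U)"
    using subspace_vecD(1)[OF U] by (auto simp: orth_def cip_commute_zero[of _ n] subset_iff)
  show "orth n (orth n U) \<subseteq> U"
  proof
    fix x assume x: "x \<in> orth n (orth n U)"
    then have xc: "x \<in> carrier_vec n" by (simp add: orth_def)
    obtain u where u: "u \<in> U" "x - u \<in> orth n U" by (rule orth_decomposition[OF U xc])
    then have uc: "u \<in> carrier_vec n" using subspace_vecD(1)[OF U] by blast
    have d: "x - u \<in> carrier_vec n" using xc uc by simp
    have "cip x (x - u) = 0" using x u by (simp add: orth_def)
    moreover have "cip u (x - u) = 0"
      using u uc cip_commute_zero[OF uc d] by (simp add: orth_def)
    ultimately have "cip (x - u) (x - u) = 0" using cip_minus_left[OF xc uc d] by simp
    then have "x - u = 0\<^sub>v n" using cip_self_eq_0[OF d] by simp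
    then have "x = u" using minus_vec_eq_0[OF xc uc] by simp
    then show "x \<in> U" using u by simp
  qed
qed

section \<open>Linear relations\<close>

lemma linear_relationD:
  assumes "linear_relation n M"
  shows "(x, y) \<in> M \<Longrightarrow> x \<in> carrier_vec n" "(x, y) \<in> M \<Longrightarrow> y \<in> carrier_vec n"
    "(0\<^sub>v n, 0\<^sub>v n) \<in> M"
    "(x, y) \<in> M \<Longrightarrow> (x', y') \<in> M \<Longrightarrow> (x + x', y + y') \<in> M"
    "(x, y) \<in> M \<Longrightarrow> (c \<cdot>\<^sub>v x, c \<cdot>\<^sub>v y) \<in> M"
  using assms by (auto simp: linear_relation_def)

lemma linear_relationI:
  assumes "\<And>x y. (x, y) \<in> M \<Longrightarrow> x \<in> carrier_vec n \<and> y \<in> carrier_vec n"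
    and "(0\<^sub>v n, 0\<^sub>v n) \<in> M"
    and "\<And>x y x' y'. (x, y) \<in> M \<Longrightarrow> (x', y') \<in> M \<Longrightarrow> (x + x', y + y') \<in> M"
    and "\<And>c x y. (x, y) \<in> M \<Longrightarrow> (c \<cdot>\<^sub>v x, c \<cdot>\<^sub>v y) \<in> M"
  shows "linear_relation n M"
  using assms by (auto simp: linear_relation_def)

lemma linear_relation_diff:
  assumes M: "linear_relation n M" and "(x, y) \<in> M" "(x', y') \<in> M"
  shows "(x - x', y - y') \<in> M"
proof -
  have "(x + (-1) \<cdot>\<^sub>v x', y + (-1) \<cdot>\<^sub>v y') \<in> M"
    using assms by (intro linear_relationD(4)[OF M] linear_relationD(5)[OF M])
  moreover have "x + (-1) \<cdot>\<^sub>v x' = x - x'" "y + (-1) \<cdot>\<^sub>v y' = y - y'"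
    using linear_relationD(1,2)[OF M assms(2)] linear_relationD(1,2)[OF M assms(3)]
    by (auto intro!: eq_vecI)
  ultimately show ?thesis by simp
qed

lemma linear_relation_converse: "linear_relation n M \<Longrightarrow> linear_relation n (M\<inverse>)"
  by (rule linear_relationI) (auto dest: linear_relationD)

lemma linear_relation_selection:
  assumes M: "linear_relation n M" and Y: "Y \<in> carrier_mat n k"
    and total: "\<And>c. c \<in> carrier_vec k \<Longrightarrow> Y *\<^sub>v c \<in> Domain M"
  obtains X where "X \<in> carrier_mat n k" "\<And>c. c \<in> carrier_vec k \<Longrightarrow> (Y *\<^sub>v c, X *\<^sub>v c) \<in> M"
proof (rule linear_selection[of k n "\<lambda>c x. (Y *\<^sub>v c, x) \<in> M"])
  note MD = linear_relationD[OF M]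
  show "\<exists>x\<in>carrier_vec n. (Y *\<^sub>v unit_vec k i, x) \<in> M" for i
    using total[of "unit_vec k i"] MD(2) by (auto simp: Domain_iff)
  show "(Y *\<^sub>v 0\<^sub>v k, 0\<^sub>v n) \<in> M" using MD(3) mult_mat_zero_vec[OF Y] by simp
  show "(Y *\<^sub>v (c + d), x + y) \<in> M" if "c \<in> carrier_vec k" "d \<in> carrier_vec k"
    "(Y *\<^sub>v c, x) \<in> M" "(Y *\<^sub>v d, y) \<in> M" for c d x y
    using MD(4)[OF that(3,4)] mult_add_distrib_mat_vec[OF Y that(1,2)] by simp
  show "(Y *\<^sub>v (a \<cdot>\<^sub>v c), a \<cdot>\<^sub>v x) \<in> M" if "c \<in> carrier_vec k" "(Y *\<^sub>v c, x) \<in> M" for a c x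
    using MD(5)[OF that(2)] mult_mat_vec[OF Y that(1)] by simp
qed (rule that)

lemma linear_relation_Domain: "linear_relation n M \<Longrightarrow> subspace_vec n (Domain M)"
  by (rule subspace_vecI) (auto dest: linear_relationD)

lemma linear_relation_Range: "linear_relation n M \<Longrightarrow> subspace_vec n (Range M)"
  by (rule subspace_vecI) (auto dest: linear_relationD)

lemma linear_relation_relcomp:
  assumes "linear_relation n L" "linear_relation n D"
  shows "linear_relation n (L O D)"
proof -
  note L = linear_relationD[OF assms(1)] and D = linear_relationD[OF assms(2)]
  have "x \<in> carrier_vec n \<and> y \<in> carrier_vec n" if "(x, y) \<in> L O D" for x y
    using that L(1) D(2) by blast
  moreover have "(0\<^sub>v n, 0\<^sub>v n) \<in> L O D" using L(3) D(3) by blast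
  moreover have "(x + x', y + y') \<in> L O D" if xy: "(x, y) \<in> L O D" and xy': "(x', y') \<in> L O D" for x y x' y'
  proof -
    obtain z z' where "(x, z) \<in> L" "(z, y) \<in> D" "(x', z') \<in> L" "(z', y') \<in> D" using xy xy' by blast
    then have "(x + x', z + z') \<in> L" "(z + z', y + y') \<in> D" by (auto intro: L(4) D(4))
    then show ?thesis by blast
  qed
  moreover have "(c \<cdot>\<^sub>v x, c \<cdot>\<^sub>v y) \<in> L O D" if xy: "(x, y) \<in> L O D" for c x y
  proof -
    obtain z where "(x, z) \<in> L" "(z, y) \<in> D" using xy by blast
    then have "(c \<cdot>\<^sub>v x, c \<cdot>\<^sub>v z) \<in> L" "(c \<cdot>\<^sub>v z, c \<cdot>\<^sub>v y) \<in> D" by (auto intro: L(5) D(5))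
    then show ?thesis by blast
  qed
  ultimately show ?thesis by (intro linear_relationI)
qed

section \<open>Null elements of the two forms and their effect on chains in the product\<close>

locale dissipative_nonnegative =
  fixes n :: nat and L D :: "'k :: real_or_complex vec rel"
  assumes nonneg_L: "nonnegative n L" and dissip_D: "dissipative n D"
    and orth_Range_L: "x \<in> orth n (Range L) \<Longrightarrow> (x, 0\<^sub>v n) \<in> L"
    and orth_Domain_D: "w \<in> orth n (Domain D) \<Longrightarrow> (0\<^sub>v n, w) \<in> D"
begin

lemma linear_L: "linear_relation n L" and linear_D: "linear_relation n D"
  using nonneg_L dissip_D by (auto simp: nonnegative_def symmetric_relation_def dissipative_def)

lemmas LD = linear_relationD[OF linear_L] and DD = linear_relationD[OF linear_D]

lemma L_nonneg: "(x, y) \<in> L \<Longrightarrow> cip x y \<ge> 0"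
proof -
  assume "(x, y) \<in> L"
  then have "x \<bullet>c y \<ge> 0" using nonneg_L by (auto simp: nonnegative_def)
  then show ?thesis using to_complex_le_iff[of 0 "x \<bullet>c y"] by (simp add: cip_def)
qed

lemma L_nonneg_Re: "(x, y) \<in> L \<Longrightarrow> Re (cip x y) \<ge> 0"
  and L_nonneg_Im: "(x, y) \<in> L \<Longrightarrow> Im (cip x y) = 0"
  using L_nonneg by (fastforce simp: less_eq_complex_def)+

lemma L_symmetric: "(v, w) \<in> L \<Longrightarrow> (x, y) \<in> L \<Longrightarrow> cip w x = cip v y"
  using nonneg_L by (auto simp: nonnegative_def symmetric_relation_def adjoint_relation_def cip_def)

lemma L_commute: "(x, y) \<in> L \<Longrightarrow> cip y x = cip x y"
  using L_symmetric by blast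

lemma D_dissip: "(x, y) \<in> D \<Longrightarrow> Re (cip x y) \<le> 0"
  using dissip_D by (auto simp: dissipative_def cip_def)

text \<open>Nonnegativity at \<open>(x', y') - t (x, y)\<close> has no quadratic term in
  \<open>t\<close>, so an expression that is real-linear in \<open>t\<close> is bounded above and
  must vanish. Hence \<open>x\<close> is orthogonal to \<open>Range L\<close>, the locale puts
  \<open>(x, 0)\<close> into \<open>L\<close>, and subtraction leaves \<open>(0, y)\<close>.\<close>

lemma L_null:
  assumes xy: "(x, y) \<in> L" and z: "cip x y = 0"
  shows "x \<in> orth n (Range L)" "(x, 0\<^sub>v n) \<in> L" "(0\<^sub>v n, y) \<in> L"
proof -
  have "x \<bullet>c y' = 0" if xy': "(x', y') \<in> L" for x' y'
  proof (rule bounded_real_linear_imp_zero)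
    fix t :: 'k
    note c = LD(1,2)[OF xy] LD(1,2)[OF xy']
    have "(x' + (- t) \<cdot>\<^sub>v x, y' + (- t) \<cdot>\<^sub>v y) \<in> L" using xy xy' by (intro LD)
    then have "0 \<le> Re (cip (x' + (- t) \<cdot>\<^sub>v x) (y' + (- t) \<cdot>\<^sub>v y))" by (rule L_nonneg_Re)
    also have "cip (x' + (- t) \<cdot>\<^sub>v x) (y' + (- t) \<cdot>\<^sub>v y) =
        cip x' y' - to_complex t * cip x y' - cnj (to_complex t) * cip x' y"
      using c z by (simp add: cip_add_left[of _ n] cip_add_right[of _ n] cip_smult_left[of _ n]
          cip_smult_right[of _ n] to_complex.hom_uminus)
    also have "cip x' y = cnj (cip x y')"
      using L_symmetric[OF xy xy'] cip_cnj[OF c(3,2)] by (metis complex_cnj_cnj)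
    also have "Re (cip x' y' - to_complex t * cip x y' - cnj (to_complex t) * cnj (cip x y')) =
        Re (cip x' y') - 2 * Re (to_complex t * cip x y')" by simp
    finally show "Re (to_complex t * to_complex (x \<bullet>c y')) \<le> Re (cip x' y') / 2"
      by (simp add: cip_def)
  qed
  then show *: "x \<in> orth n (Range L)" using LD(1)[OF xy] by (auto simp: orth_def cip_def)
  show x0: "(x, 0\<^sub>v n) \<in> L" using orth_Range_L[OF *] .
  show "(0\<^sub>v n, y) \<in> L"
    using linear_relation_diff[OF linear_L xy x0] LD(1,2)[OF xy] by simp
qed

text \<open>Polarization for a form whose real part alone has a sign: the quadratic term in
  \<open>t\<close> is purely imaginary, so the linear term has to vanish. Unlike for
  \<open>L\<close>, the outcome is an identity and not a new element of the relation; the chain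
  arguments combine it with the symmetry of \<open>L\<close>.\<close>

lemma D_null:
  assumes xy: "(x, y) \<in> D" and z: "Re (cip x y) = 0" and xy': "(x', y') \<in> D"
  shows "cip x y' + cip y x' = 0"
proof -
  note c = DD(1,2)[OF xy] DD(1,2)[OF xy']
  have "x \<bullet>c y' + y \<bullet>c x' = 0"
  proof (rule bounded_real_linear_imp_zero)
    fix t :: 'k
    have "(x' + t \<cdot>\<^sub>v x, y' + t \<cdot>\<^sub>v y) \<in> D" using xy xy' by (intro DD)
    then have "Re (cip (x' + t \<cdot>\<^sub>v x) (y' + t \<cdot>\<^sub>v y)) \<le> 0" by (rule D_dissip)
    moreover have "cip (x' + t \<cdot>\<^sub>v x) (y' + t \<cdot>\<^sub>v y) =
        cip x' y' + (to_complex t * cip x y' + (cnj (to_complex t) * cip x' y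
        + complex_of_real ((cmod (to_complex t))\<^sup>2) * cip x y))"
      using c unfolding complex_norm_square by (simp add: cip_add_left[of _ n] cip_add_right[of _ n]
          cip_smult_left[of _ n] cip_smult_right[of _ n] algebra_simps)
    moreover have "Re (complex_of_real ((cmod (to_complex t))\<^sup>2) * cip x y) = 0"
      using z by simp
    \<comment> \<open>Only real parts count, so the conjugate-linear cross term can be rewritten as
      one that is linear in \<open>t\<close>.\<close>
    moreover have "Re (cnj (to_complex t) * cip x' y) = Re (to_complex t * cip y x')"
      unfolding cip_cnj[OF c(2,3), symmetric] by (simp only: complex_cnj_mult[symmetric] cnj.simps)
    ultimately have "Re (to_complex t * (cip x y' + cip y x')) \<le> - Re (cip x' y')"
      by (simp only: distrib_left plus_complex.simps)
    then show "Re (to_complex t * to_complex (x \<bullet>c y' + y \<bullet>c x')) \<le> - Re (cip x' y')"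
      by (simp add: cip_def to_complex_add)
  qed
  then show ?thesis by (simp add: cip_def flip: to_complex_add)
qed

lemma kernel_L: "(x, 0\<^sub>v n) \<in> L \<longleftrightarrow> x \<in> orth n (Range L)"
proof
  assume x: "(x, 0\<^sub>v n) \<in> L"
  show "x \<in> orth n (Range L)" by (rule L_null[OF x]) (use LD(1)[OF x] in simp)
qed (rule orth_Range_L)

lemma multivalued_D: "(0\<^sub>v n, w) \<in> D \<longleftrightarrow> w \<in> orth n (Domain D)"
proof
  assume w: "(0\<^sub>v n, w) \<in> D"
  have "cip w x = 0" if "(x, y) \<in> D" for x y
    using D_null[OF w _ that] DD(1,2)[OF that] DD(2)[OF w] by simp
  then show "w \<in> orth n (Domain D)" using DD(2)[OF w] by (auto simp: orth_def)
qed (rule orth_Domain_D)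

text \<open>For an intermediate vector \<open>y\<close>, the number \<open>cip x y\<close> is
  nonnegative because of \<open>L\<close> and has nonpositive real part because of \<open>D\<close>,
  hence vanishes. This excludes long column blocks.\<close>

lemma relcomp_diagonal:
  assumes "(x, x) \<in> L O D" shows "(x, 0\<^sub>v n) \<in> L O D"
proof -
  obtain y where xy: "(x, y) \<in> L" and yx: "(y, x) \<in> D" using assms by blast
  have "cip x y = 0"
    using L_nonneg_Re[OF xy] L_nonneg_Im[OF xy] D_dissip[OF yx] L_commute[OF xy]
    by (simp add: complex_eq_iff)
  then show ?thesis using L_null(2)[OF xy] DD(3) by blast
qed

text \<open>The complement of an intersection is the sum of the complements. The nontrivial
  inclusion goes through the complement of the sum, which lies in both double complements, that is
  in \<open>Range L\<close> and in \<open>Domain D\<close>.\<close>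

lemma Range_Domain_orth: "orth n (Range L \<inter> Domain D) = {k + w | k w. (k, 0\<^sub>v n) \<in> L \<and> (0\<^sub>v n, w) \<in> D}"
  (is "?l = ?r")
proof
  have X: "Range L \<inter> Domain D \<subseteq> carrier_vec n" using LD by auto
  have "?r = {k + w | k w. k \<in> orth n (Range L) \<and> w \<in> orth n (Domain D)}"
    by (simp add: kernel_L multivalued_D)
  have sub: "subspace_vec n ?r"
  proof (rule subspace_vecI)
    show "?r \<subseteq> carrier_vec n" using LD(1) DD(2) by auto
    show "0\<^sub>v n \<in> ?r" using LD(3) DD(3) by force
  next
    fix x y assume "x \<in> ?r" "y \<in> ?r"
    then obtain k w k' w' where x: "x = k + w" "(k, 0\<^sub>v n) \<in> L" "(0\<^sub>v n, w) \<in> D"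
      and y: "y = k' + w'" "(k', 0\<^sub>v n) \<in> L" "(0\<^sub>v n, w') \<in> D" by blast
    have c: "k \<in> carrier_vec n" "w \<in> carrier_vec n" "k' \<in> carrier_vec n" "w' \<in> carrier_vec n"
      using x y LD(1) DD(2) by auto
    have "x + y = (k + k') + (w + w')" unfolding x y using c by (intro eq_vecI) auto
    moreover have "(k + k', 0\<^sub>v n) \<in> L" using LD(4)[OF x(2) y(2)] by simp
    moreover have "(0\<^sub>v n, w + w') \<in> D" using DD(4)[OF x(3) y(3)] by simp
    ultimately show "x + y \<in> ?r" by blast
  next
    fix t x assume "x \<in> ?r"
    then obtain k w where x: "x = k + w" "(k, 0\<^sub>v n) \<in> L" "(0\<^sub>v n, w) \<in> D" by blast
    have c: "k \<in> carrier_vec n" "w \<in> carrier_vec n" using x LD(1) DD(2) by auto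
    have "t \<cdot>\<^sub>v x = t \<cdot>\<^sub>v k + t \<cdot>\<^sub>v w" unfolding x using c by (intro eq_vecI) (auto simp: algebra_simps)
    moreover have "t \<cdot>\<^sub>v 0\<^sub>v n = 0\<^sub>v n" by (intro eq_vecI) auto
    then have "(t \<cdot>\<^sub>v k, 0\<^sub>v n) \<in> L" "(0\<^sub>v n, t \<cdot>\<^sub>v w) \<in> D"
      using LD(5)[OF x(2), of t] DD(5)[OF x(3), of t] by simp_all
    ultimately show "t \<cdot>\<^sub>v x \<in> ?r" by blast
  qed
  have k: "k \<in> ?r" if "(k, 0\<^sub>v n) \<in> L" for k
    using that DD(3) LD(1)[OF that] by (intro CollectI exI[of _ k] exI[of _ "0\<^sub>v n"]) simp
  have w: "w \<in> ?r" if "(0\<^sub>v n, w) \<in> D" for w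
    using that LD(3) DD(2)[OF that] by (intro CollectI exI[of _ w] exI[of _ "0\<^sub>v n"]) simp
  have "orth n ?r \<subseteq> orth n (orth n (Range L))" "orth n ?r \<subseteq> orth n (orth n (Domain D))"
    using k w by (auto intro!: orth_anti simp: kernel_L multivalued_D)
  then have "orth n ?r \<subseteq> Range L \<inter> Domain D"
    using orth_orth linear_relation_Range[OF linear_L] linear_relation_Domain[OF linear_D] by blast
  then have "?l \<subseteq> orth n (orth n ?r)" by (rule orth_anti)
  then show "?l \<subseteq> ?r" using orth_orth[OF sub] by simp
  show "?r \<subseteq> ?l"
  proof
    fix x assume "x \<in> ?r"
    then obtain k w where x: "x = k + w" "k \<in> orth n (Range L)" "w \<in> orth n (Domain D)"
      unfolding kernel_L multivalued_D by blast
    then show "x \<in> ?l" using X by (auto simp: orth_def cip_add_left[of _ n] subset_iff)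
  qed
qed

text \<open>Testing with \<open>(k, 0)\<close> and \<open>(0, v)\<close> shows that \<open>w\<close>
  lies in \<open>Range L\<close> and in \<open>Domain D\<close>, so \<open>w\<close> itself can be
  an intermediate vector. For a pair passing through \<open>w\<close> the identity equates \<mu>
  times a nonnegative number with a number of nonpositive real part, so both vanish,
  \<open>(0, w)\<close> lies in \<open>L\<close>, and \<open>w\<close> is orthogonal to the domain
  of \<open>L\<close>. Row minimal indices use \<mu> = 1, the spectrum every \<mu> in the right
  half-plane.\<close>

lemma relcomp_left_kernel:
  assumes w: "w \<in> carrier_vec n" and pos: "Re (to_complex \<mu>) > 0"
    and eq: "\<And>x z. (x, z) \<in> L O D \<Longrightarrow> to_complex \<mu> * cip x w = cip z w"
    and xz: "(x, z) \<in> L O D"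
  shows "cip x w = 0" "cip z w = 0"
proof -
  have "\<mu> \<noteq> 0" using pos by auto
  have "w \<in> orth n (orth n (Range L))"
  proof -
    have "cip w k = 0" if k: "k \<in> orth n (Range L)" for k
    proof -
      have kc: "k \<in> carrier_vec n" using k by (simp add: orth_def)
      have "(k, 0\<^sub>v n) \<in> L O D" using orth_Range_L[OF k] DD(3) by blast
      from eq[OF this] have "cip k w = 0" using w \<open>\<mu> \<noteq> 0\<close> by simp
      then show ?thesis using cip_commute_zero[OF w kc] by simp
    qed
    then show ?thesis using w by (simp add: orth_def)
  qed
  then have "w \<in> Range L" using orth_orth[OF linear_relation_Range[OF linear_L]] by simp
  have "w \<in> orth n (orth n (Domain D))"
  proof -
    have "cip w v = 0" if v: "v \<in> orth n (Domain D)" for v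
    proof -
      have vc: "v \<in> carrier_vec n" using v by (simp add: orth_def)
      have "(0\<^sub>v n, v) \<in> L O D" using orth_Domain_D[OF v] LD(3) by blast
      from eq[OF this] have "cip v w = 0" using w by simp
      then show ?thesis using cip_commute_zero[OF w vc] by simp
    qed
    then show ?thesis using w by (simp add: orth_def)
  qed
  then have "w \<in> Domain D" using orth_orth[OF linear_relation_Domain[OF linear_D]] by simp
  obtain x0 z0 where xw: "(x0, w) \<in> L" and wz: "(w, z0) \<in> D"
    using \<open>w \<in> Range L\<close> \<open>w \<in> Domain D\<close> by blast
  have "to_complex \<mu> * cip x0 w = cip z0 w" using eq[of x0 z0] xw wz by blast
  moreover have "Re (cip z0 w) \<le> 0"
    using D_dissip[OF wz] cip_cnj[OF w DD(2)[OF wz]] by (metis cnj.simps(1))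
  ultimately have "Re (to_complex \<mu> * cip x0 w) \<le> 0" by simp
  then have "Re (to_complex \<mu>) * Re (cip x0 w) \<le> 0" using L_nonneg_Im[OF xw] by simp
  then have "cip x0 w = 0"
    using pos L_nonneg_Re[OF xw] L_nonneg_Im[OF xw]
    by (auto simp: complex_eq_iff mult_le_0_iff)
  then have "(0\<^sub>v n, w) \<in> L" by (rule L_null(3)[OF xw])
  obtain y where xy: "(x, y) \<in> L" using xz by blast
  have "cip w x = 0" using L_symmetric[OF \<open>(0\<^sub>v n, w) \<in> L\<close> xy] LD(2)[OF xy] by simp
  then show "cip x w = 0" using cip_commute_zero[OF w LD(1)[OF xy]] by simp
  then show "cip z w = 0" using eq[OF xz] by simp
qed

text \<open>As \<mu> is imaginary, \<open>(y0, \<mu> u0)\<close> is null for \<open>D\<close>. In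
  the polarized identity the two terms with \<mu> cancel by the symmetry of \<open>L\<close>, which
  leaves \<open>cip u0 y0 = 0\<close>. This puts \<open>(0, \<mu> u0)\<close> into the product, a
  statement without content for \<mu> = 0; there a longer chain is required.\<close>

lemma relcomp_imaginary_chain:
  assumes c0: "(u0, \<mu> \<cdot>\<^sub>v u0) \<in> L O D" and c1: "(u1, \<mu> \<cdot>\<^sub>v u1 + u0) \<in> L O D"
    and im: "Re (to_complex \<mu>) = 0" and nz: "\<mu> \<noteq> 0"
  shows "(0\<^sub>v n, u0) \<in> L O D"
proof -
  obtain y0 where L0: "(u0, y0) \<in> L" and D0: "(y0, \<mu> \<cdot>\<^sub>v u0) \<in> D" using c0 by blast
  obtain y1 where L1: "(u1, y1) \<in> L" and D1: "(y1, \<mu> \<cdot>\<^sub>v u1 + u0) \<in> D" using c1 by blast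
  note c = LD(1,2)[OF L0] LD(1,2)[OF L1]
  have cm: "cnj (to_complex \<mu>) = - to_complex \<mu>" using im by (simp add: complex_eq_iff)
  have "cip y0 (\<mu> \<cdot>\<^sub>v u0) = - to_complex \<mu> * cip u0 y0"
    using c cm L_commute[OF L0] by (simp add: cip_smult_right[of _ n])
  then have "Re (cip y0 (\<mu> \<cdot>\<^sub>v u0)) = 0" using im L_nonneg_Im[OF L0] by simp
  from D_null[OF D0 this D1] have "cip y0 (\<mu> \<cdot>\<^sub>v u1 + u0) + cip (\<mu> \<cdot>\<^sub>v u0) y1 = 0" .
  then have "- to_complex \<mu> * cip y0 u1 + cip y0 u0 + to_complex \<mu> * cip u0 y1 = 0"
    using c cm by (simp add: cip_add_right[of _ n] cip_smult_right[of _ n] cip_smult_left[of _ n])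
  then have "cip u0 y0 = 0" using L_symmetric[OF L0 L1] L_commute[OF L0] by simp
  then have "(0\<^sub>v n, y0) \<in> L" by (rule L_null(3)[OF L0])
  then have "(0\<^sub>v n, \<mu> \<cdot>\<^sub>v u0) \<in> L O D" using D0 by blast
  then have "(inverse \<mu> \<cdot>\<^sub>v 0\<^sub>v n, inverse \<mu> \<cdot>\<^sub>v (\<mu> \<cdot>\<^sub>v u0)) \<in> L O D"
    by (rule linear_relationD(5)[OF linear_relation_relcomp[OF linear_L linear_D]])
  moreover have "inverse \<mu> \<cdot>\<^sub>v 0\<^sub>v n = 0\<^sub>v n" by (intro eq_vecI) auto
  moreover have "inverse \<mu> \<cdot>\<^sub>v (\<mu> \<cdot>\<^sub>v u0) = u0" using nz by (intro eq_vecI) auto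
  ultimately show ?thesis by simp
qed

text \<open>The polarized identity is applied twice. Its first use makes \<open>y0\<close>
  orthogonal to the domain of \<open>L\<close>, which removes the mixed terms from the second use;
  the latter shows that \<open>y1\<close> is multivalued for \<open>L\<close>, and \<open>D\<close>
  maps \<open>y1\<close> to \<open>u0\<close>.\<close>

lemma relcomp_zero_chain:
  assumes "(u0, 0\<^sub>v n) \<in> L O D" "(u1, u0) \<in> L O D" "(u2, u1) \<in> L O D"
  shows "(0\<^sub>v n, u0) \<in> L O D"
proof -
  obtain y0 where L0: "(u0, y0) \<in> L" and D0: "(y0, 0\<^sub>v n) \<in> D" using assms by blast
  obtain y1 where L1: "(u1, y1) \<in> L" and D1: "(y1, u0) \<in> D" using assms by blast
  obtain y2 where L2: "(u2, y2) \<in> L" and D2: "(y2, u1) \<in> D" using assms by blast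
  note c = LD(1,2)[OF L0] LD(1,2)[OF L1] LD(1,2)[OF L2]
  have z: "Re (cip y0 (0\<^sub>v n)) = 0" using c by simp
  have "cip y0 u0 = 0" using D_null[OF D0 z D1] c by simp
  then have "(0\<^sub>v n, y0) \<in> L" using L_null(3)[OF L0] L_commute[OF L0] by simp
  have y0: "cip y0 u = 0" if "(u, y) \<in> L" for u y
    using L_symmetric[OF \<open>(0\<^sub>v n, y0) \<in> L\<close> that] LD(1,2)[OF that] by simp
  have "cip u0 y1 = 0" using L_symmetric[OF L0 L1] y0[OF L1] by simp
  then have "Re (cip y1 u0) = 0" using cip_commute_zero[OF c(1,4)] by simp
  from D_null[OF D1 this D2] have "cip y1 u1 + cip u0 y2 = 0" .
  moreover have "cip u0 y2 = 0" using L_symmetric[OF L0 L2] y0[OF L2] by simp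
  ultimately have "cip u1 y1 = 0" using L_commute[OF L1] by simp
  then have "(0\<^sub>v n, y1) \<in> L" by (rule L_null(3)[OF L1])
  then show ?thesis using D1 by blast
qed

text \<open>\<open>(0, y0)\<close> in \<open>L\<close> makes \<open>y0\<close> orthogonal to the
  domain of \<open>L\<close>, in particular to \<open>u0\<close> and to \<open>u1\<close>; the third
  pair enters by placing \<open>u1\<close> in that domain. What remains of the polarized identity is
  \<open>cip u0 y1 = 0\<close>.\<close>

lemma relcomp_infinity_chain:
  assumes "(0\<^sub>v n, u0) \<in> L O D" "(u0, u1) \<in> L O D" "(u1, u2) \<in> L O D"
  shows "(u0, 0\<^sub>v n) \<in> L O D"
proof -
  obtain y0 where L0: "(0\<^sub>v n, y0) \<in> L" and D0: "(y0, u0) \<in> D" using assms by blast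
  obtain y1 where L1: "(u0, y1) \<in> L" and D1: "(y1, u1) \<in> D" using assms by blast
  obtain y2 where L2: "(u1, y2) \<in> L" and D2: "(y2, u2) \<in> D" using assms by blast
  note c = LD(1,2)[OF L0] LD(1,2)[OF L1] LD(1,2)[OF L2]
  have "cip y0 u0 = 0" using L_symmetric[OF L0 L1] c by simp
  then have "Re (cip y0 u0) = 0" by simp
  from D_null[OF D0 this D1] have "cip y0 u1 + cip u0 y1 = 0" .
  moreover have "cip y0 u1 = 0" using L_symmetric[OF L0 L2] c by simp
  ultimately have "cip u0 y1 = 0" by simp
  then show ?thesis using L_null(2)[OF L1] DD(3) by blast
qed

end

section \<open>Maximality, exploited through extensions by one vector\<close>

lemma extend_linear_relation:
  assumes M: "linear_relation n M" and x: "x \<in> carrier_vec n" and y: "y \<in> carrier_vec n"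
  shows "linear_relation n {(v + c \<cdot>\<^sub>v x, w + c \<cdot>\<^sub>v y) | v w c. (v, w) \<in> M}" (is "linear_relation n ?M")
    and "M \<subseteq> {(v + c \<cdot>\<^sub>v x, w + c \<cdot>\<^sub>v y) | v w c. (v, w) \<in> M}"
    and "(x, y) \<in> {(v + c \<cdot>\<^sub>v x, w + c \<cdot>\<^sub>v y) | v w c. (v, w) \<in> M}"
proof -
  note MD = linear_relationD[OF M]
  have zero: "0 \<cdot>\<^sub>v x = 0\<^sub>v n" "0 \<cdot>\<^sub>v y = 0\<^sub>v n" using x y by (auto intro!: eq_vecI)
  show sub: "M \<subseteq> ?M"
  proof (rule subrelI)
    fix v w assume "(v, w) \<in> M"
    moreover have "v = v + 0 \<cdot>\<^sub>v x" "w = w + 0 \<cdot>\<^sub>v y" using MD(1,2)[OF \<open>(v, w) \<in> M\<close>] zero by auto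
    ultimately show "(v, w) \<in> ?M" by blast
  qed
  have "x = 0\<^sub>v n + 1 \<cdot>\<^sub>v x" "y = 0\<^sub>v n + 1 \<cdot>\<^sub>v y" using x y by auto
  then show "(x, y) \<in> ?M" using MD(3) by blast
  have "(a + a', b + b') \<in> ?M" if ab: "(a, b) \<in> ?M" and ab': "(a', b') \<in> ?M" for a b a' b'
  proof -
    obtain v w c where a: "a = v + c \<cdot>\<^sub>v x" "b = w + c \<cdot>\<^sub>v y" "(v, w) \<in> M"
      using ab by blast
    obtain v' w' c' where a': "a' = v' + c' \<cdot>\<^sub>v x" "b' = w' + c' \<cdot>\<^sub>v y" "(v', w') \<in> M"
      using ab' by blast
    have "a + a' = (v + v') + (c + c') \<cdot>\<^sub>v x" "b + b' = (w + w') + (c + c') \<cdot>\<^sub>v y"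
      using MD(1,2)[OF a(3)] MD(1,2)[OF a'(3)] x y unfolding a a'
      by (auto intro!: eq_vecI simp: algebra_simps)
    then show ?thesis using MD(4)[OF a(3) a'(3)] by blast
  qed
  moreover have "(t \<cdot>\<^sub>v a, t \<cdot>\<^sub>v b) \<in> ?M" if ab: "(a, b) \<in> ?M" for t a b
  proof -
    obtain v w c where a: "a = v + c \<cdot>\<^sub>v x" "b = w + c \<cdot>\<^sub>v y" "(v, w) \<in> M" using ab by blast
    have "t \<cdot>\<^sub>v a = t \<cdot>\<^sub>v v + (t * c) \<cdot>\<^sub>v x" "t \<cdot>\<^sub>v b = t \<cdot>\<^sub>v w + (t * c) \<cdot>\<^sub>v y"
      using MD(1,2)[OF a(3)] x y unfolding a by (auto intro!: eq_vecI simp: algebra_simps)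
    then show ?thesis using MD(5)[OF a(3)] by blast
  qed
  moreover have "a \<in> carrier_vec n \<and> b \<in> carrier_vec n" if "(a, b) \<in> ?M" for a b
    using that MD(1,2) x y by auto
  moreover have "(0\<^sub>v n, 0\<^sub>v n) \<in> ?M" using sub MD(3) by blast
  ultimately show "linear_relation n ?M" by (intro linear_relationI)
qed

text \<open>If \<open>x\<close> is orthogonal to \<open>Range L\<close>, adding multiples of
  \<open>(x, 0)\<close> changes no inner product between a first and a second component. The
  extension is therefore again nonnegative, and maximality forces \<open>(x, 0)\<close> into
  \<open>L\<close>. For \<open>D\<close> the roles of the two components are exchanged.\<close>

lemma maximal_dissipative_nonnegative:
  fixes L D :: "'k :: real_or_complex vec rel"
  assumes D: "maximally_dissipative n D" and L: "maximally_nonnegative n L"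
  shows "dissipative_nonnegative n L D"
proof
  show nL: "nonnegative n L" using L by (simp add: maximally_nonnegative_def)
  show dD: "dissipative n D" using D by (simp add: maximally_dissipative_def)
  have lL: "linear_relation n L" using nL by (simp add: nonnegative_def symmetric_relation_def)
  have lD: "linear_relation n D" using dD by (simp add: dissipative_def)
  note LD = linear_relationD[OF lL] and DD = linear_relationD[OF lD]
  have sym: "cip w x = cip v y" if "(v, w) \<in> L" "(x, y) \<in> L" for v w x y
    using nL that by (auto simp: nonnegative_def symmetric_relation_def adjoint_relation_def cip_def)
  have zero: "c \<cdot>\<^sub>v 0\<^sub>v n = (0\<^sub>v n :: 'k vec)" for c by (intro eq_vecI) auto
  {
    fix x assume x: "x \<in> orth n (Range L)"
    then have xc: "x \<in> carrier_vec n" by (simp add: orth_def)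
    have x0: "cip x w = 0" if "(v, w) \<in> L" for v w using x that by (auto simp: orth_def)
    have x0': "cip w x = 0" if "(v, w) \<in> L" for v w
      using x0[OF that] cip_commute_zero[OF xc LD(2)[OF that]] by simp
    let ?M = "{(v + c \<cdot>\<^sub>v x, w + c \<cdot>\<^sub>v 0\<^sub>v n) | v w c. (v, w) \<in> L}"
    note ext = extend_linear_relation[OF lL xc zero_carrier_vec[of n]]
    have M: "\<exists>c w. (w, b) \<in> L \<and> a = w + c \<cdot>\<^sub>v x" if "(a, b) \<in> ?M" for a b
    proof -
      obtain v w c where "a = v + c \<cdot>\<^sub>v x" "b = w + c \<cdot>\<^sub>v 0\<^sub>v n" "(v, w) \<in> L" using \<open>(a, b) \<in> ?M\<close> by blast
      then show ?thesis using LD(2) by (auto simp: zero)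
    qed
    have "b' \<bullet>c a = a' \<bullet>c b" if ab: "(a, b) \<in> ?M" and ab': "(a', b') \<in> ?M" for a b a' b'
    proof -
      obtain c w c' w' where w: "(w, b) \<in> L" "a = w + c \<cdot>\<^sub>v x" "(w', b') \<in> L" "a' = w' + c' \<cdot>\<^sub>v x"
        using M[OF ab] M[OF ab'] by blast
      have "cip b' a = cip a' b"
        using LD(1,2)[OF w(1)] LD(1,2)[OF w(3)] xc x0[OF w(1)] x0'[OF w(3)] sym[OF w(3,1)]
        by (simp add: w(2,4) cip_add_left[of _ n] cip_add_right[of _ n] cip_smult_left[of _ n]
            cip_smult_right[of _ n])
      then show ?thesis by (simp add: cip_def)
    qed
    then have "?M \<subseteq> adjoint_relation n ?M"
      unfolding adjoint_relation_def using linear_relationD(1,2)[OF ext(1)] by (intro subrelI) blast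
    then have "symmetric_relation n ?M" using ext(1) by (simp add: symmetric_relation_def)
    moreover have "a \<bullet>c b \<ge> 0" if ab: "(a, b) \<in> ?M" for a b
    proof -
      obtain c w where w: "(w, b) \<in> L" "a = w + c \<cdot>\<^sub>v x" using M[OF ab] by blast
      have "cip a b = cip w b"
        using LD(1,2)[OF w(1)] xc x0[OF w(1)] by (simp add: w(2) cip_add_left[of _ n] cip_smult_left[of _ n])
      then have "a \<bullet>c b = w \<bullet>c b" by (simp add: cip_def)
      also have "\<dots> \<ge> 0" using nL w(1) by (auto simp: nonnegative_def)
      finally show ?thesis .
    qed
    ultimately have "nonnegative n ?M" unfolding nonnegative_def by blast
    then have "?M = L" using L ext(2) unfolding maximally_nonnegative_def by blast
    then show "(x, 0\<^sub>v n) \<in> L" using ext(3) by blast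
  }
  {
    fix y assume y: "y \<in> orth n (Domain D)"
    then have yc: "y \<in> carrier_vec n" by (simp add: orth_def)
    have y0: "cip v y = 0" if "(v, w) \<in> D" for v w
      using y that cip_commute_zero[OF yc DD(1)[OF that]] by (auto simp: orth_def)
    let ?M = "{(v + c \<cdot>\<^sub>v 0\<^sub>v n, w + c \<cdot>\<^sub>v y) | v w c. (v, w) \<in> D}"
    note ext = extend_linear_relation[OF lD zero_carrier_vec[of n] yc]
    have "Re (to_complex (a \<bullet>c b)) \<le> 0" if ab: "(a, b) \<in> ?M" for a b
    proof -
      obtain c w where w: "(a, w) \<in> D" "b = w + c \<cdot>\<^sub>v y"
      proof -
        obtain v w c where "a = v + c \<cdot>\<^sub>v 0\<^sub>v n" "b = w + c \<cdot>\<^sub>v y" "(v, w) \<in> D" using ab by blast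
        then show ?thesis using DD(1)[of v w] by (intro that[of w c]) (auto simp: zero)
      qed
      have "cip a b = cip a w"
        using DD(1,2)[OF w(1)] yc y0[OF w(1)] by (simp add: w(2) cip_add_right[of _ n] cip_smult_right[of _ n])
      then show ?thesis using dD w(1) by (auto simp: dissipative_def cip_def)
    qed
    then have "dissipative n ?M" unfolding dissipative_def using ext(1) by blast
    then have "?M = D" using D ext(2) unfolding maximally_dissipative_def by blast
    then show "(0\<^sub>v n, y) \<in> D" using ext(3) by blast
  }
qed

section \<open>The normal form of a product of relations\<close>

text \<open>Double complement relative to \<open>B\<close>: the remainder of the projection of
  \<open>x\<close> to \<open>A\<close> stays in \<open>B\<close>, so the hypothesis applies to it
  and makes it orthogonal to itself.\<close>

lemma relative_orth_orth:
  assumes A: "subspace_vec n A" and B: "subspace_vec n B" and AB: "A \<subseteq> B" and x: "x \<in> B"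
    and orth: "x \<in> orth n (B \<inter> orth n A)"
  shows "x \<in> A"
proof -
  have xc: "x \<in> carrier_vec n" using orth by (simp add: orth_def)
  obtain a where a: "a \<in> A" "x - a \<in> orth n A" by (rule orth_decomposition[OF A xc])
  have ac: "a \<in> carrier_vec n" by (rule subspace_vecD(3)[OF A a(1)])
  have d: "x - a \<in> carrier_vec n" using xc ac by simp
  have "x - a \<in> B" using subspace_vec_diff[OF B x] a(1) AB by blast
  then have "cip x (x - a) = 0" using orth a(2) by (simp add: orth_def)
  moreover have "cip a (x - a) = 0"
    using a cip_commute_zero[OF ac d] by (simp add: orth_def)
  ultimately have "cip (x - a) (x - a) = 0" using cip_minus_left[OF xc ac d] by simp
  then have "x = a" using minus_vec_eq_0[OF xc ac] cip_self_eq_0[OF d] by simp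
  then show ?thesis using a(1) by simp
qed

lemma orth_sym: "U \<subseteq> orth n V \<Longrightarrow> V \<subseteq> carrier_vec n \<Longrightarrow> V \<subseteq> orth n U"
  unfolding orth_def using cip_commute_zero by blast

lemma append_rows_mult_vec:
  fixes A B :: "'a :: comm_ring_1 mat"
  assumes "A \<in> carrier_mat p k" "B \<in> carrier_mat q k" "v \<in> carrier_vec k"
  shows "(A @\<^sub>r B) *\<^sub>v v = (A *\<^sub>v v) @\<^sub>v (B *\<^sub>v v)"
  by (rule mat_mult_append[OF assms])

lemma append_vec_eq_zero_iff:
  assumes "a \<in> carrier_vec k"
  shows "a @\<^sub>v b = 0\<^sub>v (k + l) \<longleftrightarrow> a = 0\<^sub>v k \<and> b = 0\<^sub>v l"
  using append_vec_eq[OF assms, of "0\<^sub>v k" b "0\<^sub>v l"] by simp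

section \<open>The subspaces behind the block rows\<close>

context dissipative_nonnegative
begin

definition middle_space :: "'k vec set" ("\<X>") where "\<X> = Range L \<inter> Domain D"

definition singular_space :: "'k vec set" ("\<N>") where
  "\<N> = {v. (0\<^sub>v n, v) \<in> L \<and> (\<exists>z\<in>orth n \<X>. (v, z) \<in> D)}"

definition ker_space :: "'k vec set" ("\<R>") where "\<R> = {k. (k, 0\<^sub>v n) \<in> L}"

text \<open>The multivalued part of \<open>L O D\<close>, cut down to the complement of \<X>. The
  intermediate vectors \<open>v\<close> that occur here are exactly of the kind collected in
  \<N>.\<close>

definition mul_space :: "'k vec set" ("\<W>") where
  "\<W> = {z \<in> orth n \<X>. \<exists>v. (0\<^sub>v n, v) \<in> L \<and> (v, z) \<in> D}"

lemma smult_zero [simp]: "c \<cdot>\<^sub>v 0\<^sub>v n = (0\<^sub>v n :: 'k vec)"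
  by (intro eq_vecI) auto

lemma add_zero [simp]: "0\<^sub>v n + 0\<^sub>v n = (0\<^sub>v n :: 'k vec)"
  by (intro eq_vecI) auto

lemma subspace_X: "subspace_vec n \<X>"
  unfolding middle_space_def
  by (intro subspace_vec_Int linear_relation_Range linear_relation_Domain linear_L linear_D)

lemmas X_carrier = subspace_vecD(1)[OF subspace_X]
lemmas subspace_Xo = subspace_vec_orth[OF X_carrier]
lemmas Xo_D = subspace_vecD[OF subspace_Xo]

lemma subspace_N: "subspace_vec n \<N>"
proof (rule subspace_vecI)
  show "\<N> \<subseteq> carrier_vec n" using LD(2) by (auto simp: singular_space_def)
  show "0\<^sub>v n \<in> \<N>" using LD(3) DD(3) Xo_D(2) by (auto simp: singular_space_def)
next
  fix x y assume x: "x \<in> \<N>" and y: "y \<in> \<N>"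
  obtain z where z: "z \<in> orth n \<X>" "(x, z) \<in> D" using x by (auto simp: singular_space_def)
  obtain z' where z': "z' \<in> orth n \<X>" "(y, z') \<in> D" using y by (auto simp: singular_space_def)
  have "(0\<^sub>v n + 0\<^sub>v n, x + y) \<in> L" using x y by (intro LD(4)) (auto simp: singular_space_def)
  then show "x + y \<in> \<N>"
    using DD(4)[OF z(2) z'(2)] Xo_D(4)[OF z(1) z'(1)] by (auto simp: singular_space_def)
next
  fix c x assume x: "x \<in> \<N>"
  obtain z where z: "z \<in> orth n \<X>" "(x, z) \<in> D" using x by (auto simp: singular_space_def)
  have "(c \<cdot>\<^sub>v 0\<^sub>v n, c \<cdot>\<^sub>v x) \<in> L" using x by (intro LD(5)) (auto simp: singular_space_def)
  then show "c \<cdot>\<^sub>v x \<in> \<N>"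
    using DD(5)[OF z(2), of c] Xo_D(5)[OF z(1), of c] by (auto simp: singular_space_def)
qed

lemma subspace_W: "subspace_vec n \<W>"
proof (rule subspace_vecI)
  show "\<W> \<subseteq> carrier_vec n" using DD(2) by (auto simp: mul_space_def)
  show "0\<^sub>v n \<in> \<W>" using LD(3) DD(3) Xo_D(2) by (auto simp: mul_space_def)
next
  fix x y assume x: "x \<in> \<W>" and y: "y \<in> \<W>"
  obtain v where v: "(0\<^sub>v n, v) \<in> L" "(v, x) \<in> D" using x by (auto simp: mul_space_def)
  obtain v' where v': "(0\<^sub>v n, v') \<in> L" "(v', y) \<in> D" using y by (auto simp: mul_space_def)
  show "x + y \<in> \<W>"
    using LD(4)[OF v(1) v'(1)] DD(4)[OF v(2) v'(2)] Xo_D(4)[of x y] x y by (auto simp: mul_space_def)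
next
  fix c x assume x: "x \<in> \<W>"
  obtain v where v: "(0\<^sub>v n, v) \<in> L" "(v, x) \<in> D" using x by (auto simp: mul_space_def)
  show "c \<cdot>\<^sub>v x \<in> \<W>"
    using LD(5)[OF v(1), of c] DD(5)[OF v(2), of c] Xo_D(5)[of x c] x by (auto simp: mul_space_def)
qed

lemma R_eq: "\<R> = orth n (Range L)"
  by (auto simp: ker_space_def kernel_L)

lemma subspace_R: "subspace_vec n \<R>"
  unfolding R_eq by (rule subspace_vec_orth) (auto dest: LD(2))

lemma N_subset_X: "\<N> \<subseteq> \<X>"
  by (auto simp: singular_space_def middle_space_def)

lemma R_subset_Xo: "\<R> \<subseteq> orth n \<X>"
  unfolding R_eq by (rule orth_anti) (simp add: middle_space_def)

lemma W_subset_Xo: "\<W> \<subseteq> orth n \<X>"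
  by (auto simp: mul_space_def)

lemma orth_Domain_subset_Xo: "(0\<^sub>v n, w) \<in> D \<Longrightarrow> w \<in> orth n \<X>"
  using orth_anti[of \<X> "Domain D" n] by (auto simp: multivalued_D middle_space_def)

lemma XoE:
  assumes "x \<in> orth n \<X>"
  obtains k w where "x = k + w" "k \<in> \<R>" "w \<in> \<W>"
proof -
  obtain k w where "x = k + w" "(k, 0\<^sub>v n) \<in> L" "(0\<^sub>v n, w) \<in> D"
    using assms unfolding middle_space_def Range_Domain_orth by blast
  then show ?thesis
    using that[of k w] orth_Domain_subset_Xo[of w] LD(3) by (auto simp: ker_space_def mul_space_def)
qed

lemma XE:
  assumes "y \<in> \<X>"
  obtains v y1 where "y = v + y1" "v \<in> \<N>" "y1 \<in> \<X> \<inter> orth n \<N>"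
proof -
  have yc: "y \<in> carrier_vec n" using assms X_carrier by blast
  obtain v where v: "v \<in> \<N>" "y - v \<in> orth n \<N>" by (rule orth_decomposition[OF subspace_N yc])
  have vc: "v \<in> carrier_vec n" by (rule subspace_vecD(3)[OF subspace_N v(1)])
  have "y - v \<in> \<X>" using subspace_vec_diff[OF subspace_X assms] v(1) N_subset_X by blast
  moreover have "y = v + (y - v)" using yc vc by (intro eq_vecI) auto
  ultimately show ?thesis using that v by blast
qed

text \<open>\<X> is the sum of \<N> and its relative complement. The condition is split accordingly
  because \<open>S\<close> has separate blocks for the two summands.\<close>

lemma orth_X_iff: "x \<in> orth n \<X> \<longleftrightarrow> x \<in> orth n (\<X> \<inter> orth n \<N>) \<and> x \<in> orth n \<N>"
proof
  assume "x \<in> orth n \<X>"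
  then show "x \<in> orth n (\<X> \<inter> orth n \<N>) \<and> x \<in> orth n \<N>"
    using N_subset_X by (auto simp: orth_def)
next
  assume x: "x \<in> orth n (\<X> \<inter> orth n \<N>) \<and> x \<in> orth n \<N>"
  then have xc: "x \<in> carrier_vec n" by (simp add: orth_def)
  have "cip x y = 0" if y: "y \<in> \<X>" for y
  proof -
    obtain v y1 where vy: "y = v + y1" "v \<in> \<N>" "y1 \<in> \<X> \<inter> orth n \<N>" by (rule XE[OF y])
    have "v \<in> carrier_vec n" "y1 \<in> carrier_vec n"
      using subspace_vecD(3)[OF subspace_N vy(2)] vy(3) X_carrier by auto
    then show ?thesis using x vy xc by (simp add: vy(1) cip_add_right[of _ n] orth_def)
  qed
  then show "x \<in> orth n \<X>" using xc by (simp add: orth_def)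
qed

text \<open>Membership is expressed by orthogonality alone, so that it can be read off from
  vanishing blocks of coordinates. The blocks left free are those for the complement of \<W> and for
  the intersection of \<R> and \<W>.\<close>

lemma R_iff: "k \<in> \<R> \<longleftrightarrow> k \<in> orth n \<X> \<and> k \<in> orth n (orth n \<X> \<inter> orth n \<R>)"
proof
  assume k: "k \<in> \<R>"
  have "orth n \<X> \<inter> orth n \<R> \<subseteq> orth n \<R>" by blast
  then have "\<R> \<subseteq> orth n (orth n \<X> \<inter> orth n \<R>)"
    using orth_sym subspace_vecD(1)[OF subspace_R] by blast
  then show "k \<in> orth n \<X> \<and> k \<in> orth n (orth n \<X> \<inter> orth n \<R>)" using k R_subset_Xo by blast
qed (use relative_orth_orth[OF subspace_R subspace_Xo R_subset_Xo] in blast)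

lemma W_iff: "k \<in> \<W> \<longleftrightarrow> k \<in> orth n \<X> \<and> k \<in> orth n (orth n \<X> \<inter> orth n \<W>)"
proof
  assume k: "k \<in> \<W>"
  have "orth n \<X> \<inter> orth n \<W> \<subseteq> orth n \<W>" by blast
  then have "\<W> \<subseteq> orth n (orth n \<X> \<inter> orth n \<W>)"
    using orth_sym subspace_vecD(1)[OF subspace_W] by blast
  then show "k \<in> orth n \<X> \<and> k \<in> orth n (orth n \<X> \<inter> orth n \<W>)" using k W_subset_Xo by blast
qed (use relative_orth_orth[OF subspace_W subspace_Xo W_subset_Xo] in blast)

text \<open>This is the injectivity of \<open>S\<close>: the first three conditions place
  \<open>x\<close> in the intersection of \<R> and \<W>, the last makes it orthogonal to that
  intersection.\<close>

lemma orth_complements_zero: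
  assumes "x \<in> orth n \<X>" "x \<in> orth n (orth n \<X> \<inter> orth n \<W>)" "x \<in> orth n (orth n \<X> \<inter> orth n \<R>)"
    "x \<in> orth n (\<R> \<inter> \<W>)"
  shows "x = 0\<^sub>v n"
proof -
  have "x \<in> \<R> \<inter> \<W>" using assms R_iff W_iff by blast
  then have "cip x x = 0" using assms(4) by (simp add: orth_def)
  moreover have "x \<in> carrier_vec n" using assms(1) by (simp add: orth_def)
  ultimately show ?thesis using cip_self_eq_0 by blast
qed

text \<open>All pairs are orthogonal except for \<open>b2\<close> and \<open>b3\<close>, whose sum is handled by
  \<open>\<X>\<^sup>\<bottom> = \<R> + \<W>\<close>.\<close>

lemma pieces_independent:
  assumes y: "y \<in> \<X> \<inter> orth n \<N>" and b2: "b2 \<in> orth n \<X> \<inter> orth n \<W>"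
    and b3: "b3 \<in> orth n \<X> \<inter> orth n \<R>" and b4: "b4 \<in> \<R> \<inter> \<W>" and v: "v \<in> \<N>"
    and sum: "y + (b2 + (b3 + (b4 + v))) = 0\<^sub>v n"
  shows "y = 0\<^sub>v n" "b2 = 0\<^sub>v n" "b3 = 0\<^sub>v n" "b4 = 0\<^sub>v n" "v = 0\<^sub>v n"
proof -
  have c: "y \<in> carrier_vec n" "b2 \<in> carrier_vec n" "b3 \<in> carrier_vec n" "b4 \<in> carrier_vec n"
    "v \<in> carrier_vec n"
    using y b2 b3 b4 subspace_vecD(3)[OF subspace_N v] subspace_vecD(3)[OF subspace_R]
    by (auto simp: orth_def)
  have cip_sum5: "cip y e + (cip b2 e + (cip b3 e + (cip b4 e + cip v e))) = 0" if e: "e \<in> carrier_vec n" for e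
  proof -
    have "cip (y + (b2 + (b3 + (b4 + v)))) e = 0" unfolding sum using e by simp
    then show ?thesis using c e by (simp add: cip_add_left[of _ n])
  qed
  have vX: "v \<in> \<X>" using v N_subset_X by blast
  have b4Xo: "b4 \<in> orth n \<X>" using b4 R_subset_Xo by blast
  have "cip b2 y = 0" "cip b3 y = 0" "cip b4 y = 0" "cip y v = 0" "cip b2 v = 0" "cip b3 v = 0"
    "cip b4 v = 0" "cip b2 b4 = 0" "cip b3 b4 = 0"
    using y b2 b3 b4 v vX b4Xo by (simp_all add: orth_def)
  moreover have "cip v y = 0" using calculation cip_commute_zero[OF c(1,5)] by simp
  ultimately show y0: "y = 0\<^sub>v n" and v0: "v = 0\<^sub>v n"
    using cip_sum5[OF c(1)] cip_sum5[OF c(5)] c cip_self_eq_0 by auto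
  then show b40: "b4 = 0\<^sub>v n"
    using cip_sum5[OF c(4)] c cip_self_eq_0[OF c(4)] \<open>cip b2 b4 = 0\<close> \<open>cip b3 b4 = 0\<close> by simp
  \<comment> \<open>Testing the vanishing sum against \<open>k\<close> relates \<open>b2\<close> to
    \<open>b3\<close>. Since \<open>b3\<close> is orthogonal to \<open>k\<close> and
    \<open>b2\<close> to \<open>w\<close>, the vector \<open>b2\<close> is orthogonal to
    \<open>k + w\<close>, that is, to itself.\<close>
  obtain k w where kw: "b2 = k + w" "k \<in> \<R>" "w \<in> \<W>" by (rule XoE) (use b2 in blast)
  have kwc: "k \<in> carrier_vec n" "w \<in> carrier_vec n"
    using subspace_vecD(3)[OF subspace_R kw(2)] subspace_vecD(3)[OF subspace_W kw(3)] by auto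
  have "cip b2 w = 0" "cip b3 k = 0" using b2 b3 kw by (simp_all add: orth_def)
  moreover have "cip b2 k + cip b3 k = 0" using cip_sum5[OF kwc(1)] kwc y0 v0 b40 by simp
  ultimately have "cip b2 b2 = 0"
    by (subst (2) kw(1)) (simp add: cip_add_right[OF kwc c(2)])
  then show b20: "b2 = 0\<^sub>v n" using cip_self_eq_0[OF c(2)] by simp
  show "b3 = 0\<^sub>v n"
    using cip_sum5[OF c(3)] c y0 v0 b40 b20 cip_self_eq_0[OF c(3)] by simp
qed

end

lemma vec_cancel:
  fixes p q :: "'a :: ring_1 vec"
  assumes "p \<in> carrier_vec n" "q \<in> carrier_vec n"
  shows "p + q - q = p" "p - q + q = p" "p + (q - p) = q"
  using assms by (auto intro!: eq_vecI)

section \<open>The product in coordinates\<close>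

definition normal_relation ::
  "nat \<Rightarrow> nat \<Rightarrow> nat \<Rightarrow> nat \<Rightarrow> nat \<Rightarrow> 'a :: comm_ring_1 mat \<Rightarrow> 'a mat \<Rightarrow> 'a mat \<Rightarrow> 'a mat \<Rightarrow> 'a vec rel" where
  "normal_relation n1 n2 n3 n4 r L11 D11 D21 L21 =
      {(L11 *\<^sub>v c @\<^sub>v a2 @\<^sub>v L21 *\<^sub>v c @\<^sub>v a4 @\<^sub>v 0\<^sub>v r,
        D11 *\<^sub>v c @\<^sub>v D21 *\<^sub>v c @\<^sub>v a3 @\<^sub>v b4 @\<^sub>v 0\<^sub>v r) | c a2 a3 a4 b4.
        c \<in> carrier_vec n1 \<and> a2 \<in> carrier_vec n2 \<and> a3 \<in> carrier_vec n3 \<and>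
        a4 \<in> carrier_vec n4 \<and> b4 \<in> carrier_vec n4}"

definition psd_mat :: "nat \<Rightarrow> 'k :: real_or_complex mat \<Rightarrow> bool" where
  "psd_mat k M \<longleftrightarrow> M \<in> carrier_mat k k \<and> (\<forall>c\<in>carrier_vec k. cip (M *\<^sub>v c) c \<ge> 0 \<and>
     (\<forall>d\<in>carrier_vec k. cip (M *\<^sub>v c) d = cip c (M *\<^sub>v d)))"

definition dissipative_mat :: "nat \<Rightarrow> 'k :: real_or_complex mat \<Rightarrow> bool" where
  "dissipative_mat k M \<longleftrightarrow> M \<in> carrier_mat k k \<and> (\<forall>c\<in>carrier_vec k. Re (cip (M *\<^sub>v c) c) \<le> 0)"

context dissipative_nonnegative
begin

text \<open>Each pair of the product is governed by a parameter \<open>c\<close> for its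
  intermediate vector, up to \<R> in the first and \<W> in the second component. In coordinates \<R>
  is free exactly in the second and fourth block and \<W> in the third and fourth, which produces
  the parameters \<open>a2\<close>, \<open>a4\<close>, \<open>a3\<close>, \<open>b4\<close>.
  Compressing with the same \<open>Y\<close> that parametrizes the intermediate vectors makes
  \<open>L11\<close> and \<open>D11\<close> represent the forms of \<open>L\<close> and
  \<open>D\<close>.\<close>

lemma relation_normal_form:
  obtains S n1 n2 n3 n4 r L11 D11 D21 L21 where
    "S \<in> carrier_mat n n" "invertible_mat S" "n = n1 + (n2 + (n3 + (n4 + r)))"
    "L11 \<in> carrier_mat n1 n1" "D11 \<in> carrier_mat n1 n1"
    "D21 \<in> carrier_mat n2 n1" "L21 \<in> carrier_mat n3 n1"
    "{(S *\<^sub>v x, S *\<^sub>v z) | x z. (x, z) \<in> L O D} =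
      normal_relation n1 n2 n3 n4 r L11 D11 D21 L21"
    "psd_mat n1 L11" "dissipative_mat n1 D11"
    "\<And>c. c \<in> carrier_vec n1 \<Longrightarrow> L11 *\<^sub>v c = D11 *\<^sub>v c \<Longrightarrow> c = 0\<^sub>v n1"
    "\<And>c. c \<in> carrier_vec n1 \<Longrightarrow> L11 *\<^sub>v c = 0\<^sub>v n1 \<Longrightarrow> L21 *\<^sub>v c = 0\<^sub>v n3"
proof -
  have sub1: "subspace_vec n (\<X> \<inter> orth n \<N>)"
    by (intro subspace_vec_Int subspace_X subspace_vec_orth subspace_vecD(1)[OF subspace_N])
  have sub2: "subspace_vec n (orth n \<X> \<inter> orth n \<W>)"
    by (intro subspace_vec_Int subspace_Xo subspace_vec_orth subspace_vecD(1)[OF subspace_W])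
  have sub3: "subspace_vec n (orth n \<X> \<inter> orth n \<R>)"
    by (intro subspace_vec_Int subspace_Xo subspace_vec_orth subspace_vecD(1)[OF subspace_R])
  have sub4: "subspace_vec n (\<R> \<inter> \<W>)"
    by (intro subspace_vec_Int subspace_R subspace_W)
  obtain n1 Y where Y: "Y \<in> carrier_mat n n1" "inj_mat Y"
    and YU: "\<X> \<inter> orth n \<N> = (\<lambda>c. Y *\<^sub>v c) ` carrier_vec n1" by (rule subspace_vec_basis[OF sub1])
  obtain n2 B2 where B2: "B2 \<in> carrier_mat n n2" "inj_mat B2"
    and B2U: "orth n \<X> \<inter> orth n \<W> = (\<lambda>c. B2 *\<^sub>v c) ` carrier_vec n2" by (rule subspace_vec_basis[OF sub2])
  obtain n3 B3 where B3: "B3 \<in> carrier_mat n n3" "inj_mat B3"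
    and B3U: "orth n \<X> \<inter> orth n \<R> = (\<lambda>c. B3 *\<^sub>v c) ` carrier_vec n3" by (rule subspace_vec_basis[OF sub3])
  obtain n4 B4 where B4: "B4 \<in> carrier_mat n n4" "inj_mat B4"
    and B4U: "\<R> \<inter> \<W> = (\<lambda>c. B4 *\<^sub>v c) ` carrier_vec n4" by (rule subspace_vec_basis[OF sub4])
  obtain r V where V: "V \<in> carrier_mat n r" "inj_mat V"
    and VU: "\<N> = (\<lambda>c. V *\<^sub>v c) ` carrier_vec r" by (rule subspace_vec_basis[OF subspace_N])
  note perp = adjoint_mult_eq_0_iff[OF Y(1), folded YU] adjoint_mult_eq_0_iff[OF B2(1), folded B2U]
    adjoint_mult_eq_0_iff[OF B3(1), folded B3U] adjoint_mult_eq_0_iff[OF B4(1), folded B4U]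
    adjoint_mult_eq_0_iff[OF V(1), folded VU]
  let ?p = "n1 + (n2 + (n3 + (n4 + r)))"
  note A = Y(1)[THEN adjoint_carrier] B2(1)[THEN adjoint_carrier] B3(1)[THEN adjoint_carrier]
    B4(1)[THEN adjoint_carrier] V(1)[THEN adjoint_carrier]
  define S where "S = mat_adjoint Y @\<^sub>r (mat_adjoint B2 @\<^sub>r (mat_adjoint B3 @\<^sub>r (mat_adjoint B4 @\<^sub>r mat_adjoint V)))"
  note S45 = carrier_append_rows[OF A(4,5)]
  note S345 = carrier_append_rows[OF A(3) S45]
  note S2345 = carrier_append_rows[OF A(2) S345]
  have Sp: "S \<in> carrier_mat ?p n" unfolding S_def by (rule carrier_append_rows[OF A(1) S2345])
  have S_mult: "S *\<^sub>v x = mat_adjoint Y *\<^sub>v x @\<^sub>v mat_adjoint B2 *\<^sub>v x @\<^sub>v mat_adjoint B3 *\<^sub>v x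
      @\<^sub>v mat_adjoint B4 *\<^sub>v x @\<^sub>v mat_adjoint V *\<^sub>v x" if x: "x \<in> carrier_vec n" for x
    unfolding S_def append_rows_mult_vec[OF A(1) S2345 x] append_rows_mult_vec[OF A(2) S345 x]
      append_rows_mult_vec[OF A(3) S45 x] append_rows_mult_vec[OF A(4,5) x] ..
  have comp: "mat_adjoint Y *\<^sub>v x \<in> carrier_vec n1" "mat_adjoint B2 *\<^sub>v x \<in> carrier_vec n2"
    "mat_adjoint B3 *\<^sub>v x \<in> carrier_vec n3" "mat_adjoint B4 *\<^sub>v x \<in> carrier_vec n4"
    "mat_adjoint V *\<^sub>v x \<in> carrier_vec r" if "x \<in> carrier_vec n" for x
    using A that by (auto intro: mult_mat_vec_carrier)
  have S_inj: "inj_mat S"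
  proof (rule inj_matI[OF Sp])
    fix x assume x: "x \<in> carrier_vec n" and "S *\<^sub>v x = 0\<^sub>v ?p"
    then have "mat_adjoint Y *\<^sub>v x = 0\<^sub>v n1" "mat_adjoint B2 *\<^sub>v x = 0\<^sub>v n2"
      "mat_adjoint B3 *\<^sub>v x = 0\<^sub>v n3" "mat_adjoint B4 *\<^sub>v x = 0\<^sub>v n4" "mat_adjoint V *\<^sub>v x = 0\<^sub>v r"
      unfolding S_mult[OF x] append_vec_eq_zero_iff[OF comp(1)[OF x]]
        append_vec_eq_zero_iff[OF comp(2)[OF x]] append_vec_eq_zero_iff[OF comp(3)[OF x]]
        append_vec_eq_zero_iff[OF comp(4)[OF x]] by blast+
    then show "x = 0\<^sub>v n" using orth_complements_zero orth_X_iff perp[OF x] by blast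
  qed
  \<comment> \<open>\<open>S\<close> is the adjoint of \<open>M\<close>. Injectivity of
    \<open>S\<close> bounds \<open>n\<close> by the total number of basis vectors, injectivity of
    \<open>M\<close> gives the converse bound, and so the five dimensions add up to
    \<open>n\<close>.\<close>
  define M where "M = hcat2 Y (hcat2 B2 (hcat2 B3 (hcat2 B4 V)))"
  note M45 = hcat2_carrier[OF B4(1) V(1)]
  note M345 = hcat2_carrier[OF B3(1) M45]
  note M2345 = hcat2_carrier[OF B2(1) M345]
  have M: "M \<in> carrier_mat n ?p" unfolding M_def by (rule hcat2_carrier[OF Y(1) M2345])
  have "inj_mat M"
  proof (rule inj_matI[OF M])
    fix d assume "d \<in> carrier_vec ?p" and eq: "M *\<^sub>v d = 0\<^sub>v n"
    then obtain d1 d' where d: "d = d1 @\<^sub>v d'" "d1 \<in> carrier_vec n1" "d' \<in> carrier_vec (n2 + (n3 + (n4 + r)))"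
      using carrier_vec_appendE by blast
    obtain d2 d'' where d': "d' = d2 @\<^sub>v d''" "d2 \<in> carrier_vec n2" "d'' \<in> carrier_vec (n3 + (n4 + r))"
      by (rule carrier_vec_appendE[OF d(3)])
    obtain d3 d''' where d'': "d'' = d3 @\<^sub>v d'''" "d3 \<in> carrier_vec n3" "d''' \<in> carrier_vec (n4 + r)"
      by (rule carrier_vec_appendE[OF d'(3)])
    obtain d4 d5 where d''': "d''' = d4 @\<^sub>v d5" "d4 \<in> carrier_vec n4" "d5 \<in> carrier_vec r"
      by (rule carrier_vec_appendE[OF d''(3)])
    have "M *\<^sub>v d = Y *\<^sub>v d1 + (B2 *\<^sub>v d2 + (B3 *\<^sub>v d3 + (B4 *\<^sub>v d4 + V *\<^sub>v d5)))"
      unfolding M_def d(1) hcat2_mult_vec[OF Y(1) M2345 d(2,3)]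
      unfolding d'(1) hcat2_mult_vec[OF B2(1) M345 d'(2,3)]
      unfolding d''(1) hcat2_mult_vec[OF B3(1) M45 d''(2,3)]
      unfolding d'''(1) hcat2_mult_vec[OF B4(1) V(1) d'''(2,3)] ..
    then have z: "Y *\<^sub>v d1 + (B2 *\<^sub>v d2 + (B3 *\<^sub>v d3 + (B4 *\<^sub>v d4 + V *\<^sub>v d5))) = 0\<^sub>v n" using eq by simp
    have "Y *\<^sub>v d1 = 0\<^sub>v n" "B2 *\<^sub>v d2 = 0\<^sub>v n" "B3 *\<^sub>v d3 = 0\<^sub>v n" "B4 *\<^sub>v d4 = 0\<^sub>v n" "V *\<^sub>v d5 = 0\<^sub>v n"
      by (rule pieces_independent[OF _ _ _ _ _ z]; use YU B2U B3U B4U VU d(2) d'(2) d''(2) d'''(2,3) in blast)+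
    then show "d = 0\<^sub>v ?p"
      using inj_matD[OF Y(2,1) d(2)] inj_matD[OF B2(2,1) d'(2)] inj_matD[OF B3(2,1) d''(2)]
        inj_matD[OF B4(2,1) d'''(2)] inj_matD[OF V(2,1) d'''(3)]
      unfolding d(1) d'(1) d''(1) d'''(1) by simp
  qed
  then have n_eq: "n = ?p" using inj_mat_le[OF M] inj_mat_le[OF Sp S_inj] by simp
  have S: "S \<in> carrier_mat n n" using Sp n_eq by simp
  obtain Q where Q: "Q \<in> carrier_mat n n" "S * Q = 1\<^sub>m n" "Q * S = 1\<^sub>m n" by (rule inj_square_invertible[OF S S_inj])
  have S_invertible: "invertible_mat S"
    unfolding invertible_mat_def inverts_mat_def using S Q by auto
  have S_surj: "\<exists>x\<in>carrier_vec n. mat_adjoint Y *\<^sub>v x = d1 \<and> mat_adjoint B2 *\<^sub>v x = d2 \<and>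
      mat_adjoint B3 *\<^sub>v x = d3 \<and> mat_adjoint B4 *\<^sub>v x = d4 \<and> mat_adjoint V *\<^sub>v x = d5"
    if d: "d1 \<in> carrier_vec n1" "d2 \<in> carrier_vec n2" "d3 \<in> carrier_vec n3" "d4 \<in> carrier_vec n4"
      "d5 \<in> carrier_vec r" for d1 d2 d3 d4 d5
  proof -
    let ?d = "d1 @\<^sub>v d2 @\<^sub>v d3 @\<^sub>v d4 @\<^sub>v d5"
    have dc: "?d \<in> carrier_vec n" unfolding n_eq using d by simp
    define x where "x = Q *\<^sub>v ?d"
    have x: "x \<in> carrier_vec n" using Q dc by (simp add: x_def)
    have "S *\<^sub>v x = (S * Q) *\<^sub>v ?d" unfolding x_def by (rule assoc_mult_mat_vec[OF S Q(1) dc, symmetric])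
    then have "S *\<^sub>v x = ?d" unfolding Q(2) using dc by simp
    then show ?thesis using x
      unfolding S_mult[OF x] append_vec_eq[OF comp(1)[OF x] d(1)] append_vec_eq[OF comp(2)[OF x] d(2)]
        append_vec_eq[OF comp(3)[OF x] d(3)] append_vec_eq[OF comp(4)[OF x] d(4)] by blast
  qed
  have Y_mem: "Y *\<^sub>v c \<in> \<X> \<inter> orth n \<N>" if "c \<in> carrier_vec n1" for c using YU that by blast
  \<comment> \<open>The intermediate vector \<open>Y c\<close> is given and its partner in
    \<open>L\<close> is the first component, so the selection is made in the converse
    relation.\<close>
  obtain Xm where Xm: "Xm \<in> carrier_mat n n1" and XmL: "\<And>c. c \<in> carrier_vec n1 \<Longrightarrow> (Xm *\<^sub>v c, Y *\<^sub>v c) \<in> L"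
  proof (rule linear_relation_selection[OF linear_relation_converse[OF linear_L] Y(1)])
    show "Y *\<^sub>v c \<in> Domain (L\<inverse>)" if "c \<in> carrier_vec n1" for c
      using Y_mem[OF that] by (auto simp: middle_space_def)
  qed blast
  obtain Zm where Zm: "Zm \<in> carrier_mat n n1" and ZmD: "\<And>c. c \<in> carrier_vec n1 \<Longrightarrow> (Y *\<^sub>v c, Zm *\<^sub>v c) \<in> D"
  proof (rule linear_relation_selection[OF linear_D Y(1)])
    show "Y *\<^sub>v c \<in> Domain D" if "c \<in> carrier_vec n1" for c
      using Y_mem[OF that] by (auto simp: middle_space_def)
  qed blast
  have car: "Xm *\<^sub>v c \<in> carrier_vec n" "Zm *\<^sub>v c \<in> carrier_vec n" "Y *\<^sub>v c \<in> carrier_vec n"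
    if "c \<in> carrier_vec n1" for c using Xm Zm Y(1) that by auto
  define L11 where "L11 = mat_adjoint Y * Xm"
  define D11 where "D11 = mat_adjoint Y * Zm"
  define D21 where "D21 = mat_adjoint B2 * Zm"
  define L21 where "L21 = mat_adjoint B3 * Xm"
  note defs = L11_def D11_def D21_def L21_def
  have dims: "L11 \<in> carrier_mat n1 n1" "D11 \<in> carrier_mat n1 n1" "D21 \<in> carrier_mat n2 n1" "L21 \<in> carrier_mat n3 n1"
    unfolding defs by (rule mult_carrier_mat[OF A(1) Xm] mult_carrier_mat[OF A(1) Zm]
      mult_carrier_mat[OF A(2) Zm] mult_carrier_mat[OF A(3) Xm])+
  have L11: "L11 *\<^sub>v c = mat_adjoint Y *\<^sub>v (Xm *\<^sub>v c)" and D11: "D11 *\<^sub>v c = mat_adjoint Y *\<^sub>v (Zm *\<^sub>v c)"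
    and D21: "D21 *\<^sub>v c = mat_adjoint B2 *\<^sub>v (Zm *\<^sub>v c)" and L21: "L21 *\<^sub>v c = mat_adjoint B3 *\<^sub>v (Xm *\<^sub>v c)"
    if "c \<in> carrier_vec n1" for c
    unfolding defs by (rule assoc_mult_mat_vec[OF _ _ that], (rule A Xm Zm)+)+
  have cL11: "cip (L11 *\<^sub>v c) d = cip (Xm *\<^sub>v c) (Y *\<^sub>v d)" and cD11: "cip (D11 *\<^sub>v c) d = cip (Zm *\<^sub>v c) (Y *\<^sub>v d)"
    if "c \<in> carrier_vec n1" "d \<in> carrier_vec n1" for c d
    unfolding L11[OF that(1)] D11[OF that(1)] using cip_adjoint[OF Y(1) _ that(2)] car[OF that(1)] by simp_all
  \<comment> \<open>The last block vanishes on both components. Here this is the symmetry of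
    \<open>L\<close> against \<open>(0, v)\<close>.\<close>
  have V_Xm: "mat_adjoint V *\<^sub>v (Xm *\<^sub>v c) = 0\<^sub>v r" if c: "c \<in> carrier_vec n1" for c
  proof -
    have "cip (Xm *\<^sub>v c) v = 0" if v: "v \<in> \<N>" for v
    proof -
      have "(0\<^sub>v n, v) \<in> L" using v by (simp add: singular_space_def)
      from L_symmetric[OF XmL[OF c] this] show ?thesis using car[OF c] by simp
    qed
    then show ?thesis using perp(5)[OF car(1)[OF c]] car[OF c] by (simp add: orth_def)
  qed
  \<comment> \<open>A vector \<open>v\<close> in \<N> has an image \<open>z\<close> under
    \<open>D\<close> that is orthogonal to \<X> and hence to \<open>v\<close>, so
    \<open>(v, z)\<close> is null for \<open>D\<close>; in the polarized identity the term with
    \<open>z\<close> drops out as well.\<close>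
  have V_Zm: "mat_adjoint V *\<^sub>v (Zm *\<^sub>v c) = 0\<^sub>v r" if c: "c \<in> carrier_vec n1" for c
  proof -
    have "cip (Zm *\<^sub>v c) v = 0" if v: "v \<in> \<N>" for v
    proof -
      obtain z where z: "z \<in> orth n \<X>" "(v, z) \<in> D" using v by (auto simp: singular_space_def)
      have vX: "v \<in> \<X>" using v N_subset_X by blast
      have cc: "v \<in> carrier_vec n" "z \<in> carrier_vec n" using DD(1,2)[OF z(2)] by auto
      have "cip z v = 0" "cip z (Y *\<^sub>v c) = 0" using z(1) vX Y_mem[OF c] by (simp_all add: orth_def)
      then have "Re (cip v z) = 0" using cip_commute_zero[OF cc] by simp
      from D_null[OF z(2) this ZmD[OF c]] have "cip v (Zm *\<^sub>v c) = 0" using \<open>cip z (Y *\<^sub>v c) = 0\<close> by simp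
      then show ?thesis using cip_commute_zero[OF cc(1) car(2)[OF c]] by simp
    qed
    then show ?thesis using perp(5)[OF car(2)[OF c]] car[OF c] by (simp add: orth_def)
  qed
  have R_perp: "k \<in> \<R> \<longleftrightarrow> mat_adjoint Y *\<^sub>v k = 0\<^sub>v n1 \<and> mat_adjoint B3 *\<^sub>v k = 0\<^sub>v n3 \<and> mat_adjoint V *\<^sub>v k = 0\<^sub>v r"
    if "k \<in> carrier_vec n" for k
    unfolding perp[OF that] R_iff[of k] orth_X_iff[of k] by blast
  have W_perp: "k \<in> \<W> \<longleftrightarrow> mat_adjoint Y *\<^sub>v k = 0\<^sub>v n1 \<and> mat_adjoint B2 *\<^sub>v k = 0\<^sub>v n2 \<and> mat_adjoint V *\<^sub>v k = 0\<^sub>v r"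
    if "k \<in> carrier_vec n" for k
    unfolding perp[OF that] W_iff[of k] orth_X_iff[of k] by blast
  have null: "Xm *\<^sub>v c \<in> \<R>" "(0\<^sub>v n, Y *\<^sub>v c) \<in> L" if c: "c \<in> carrier_vec n1" and z: "cip (Xm *\<^sub>v c) (Y *\<^sub>v c) = 0" for c
    using L_null[OF XmL[OF c] z] by (auto simp: ker_space_def)
  have sol: "L11 *\<^sub>v c = mat_adjoint Y *\<^sub>v (Xm *\<^sub>v c + k)" "L21 *\<^sub>v c = mat_adjoint B3 *\<^sub>v (Xm *\<^sub>v c + k)"
      "mat_adjoint V *\<^sub>v (Xm *\<^sub>v c + k) = 0\<^sub>v r"
    if c: "c \<in> carrier_vec n1" and k: "k \<in> \<R>" for c k
  proof -
    have kc: "k \<in> carrier_vec n" by (rule subspace_vecD(3)[OF subspace_R k])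
    note kk = R_perp[OF kc, THEN iffD1, OF k]
    show "L11 *\<^sub>v c = mat_adjoint Y *\<^sub>v (Xm *\<^sub>v c + k)" "L21 *\<^sub>v c = mat_adjoint B3 *\<^sub>v (Xm *\<^sub>v c + k)"
      "mat_adjoint V *\<^sub>v (Xm *\<^sub>v c + k) = 0\<^sub>v r"
      using kk V_Xm[OF c] comp[OF car(1)[OF c]] mult_add_distrib_mat_vec[OF A(1) car(1)[OF c] kc]
        mult_add_distrib_mat_vec[OF A(3) car(1)[OF c] kc] mult_add_distrib_mat_vec[OF A(5) car(1)[OF c] kc]
      by (simp_all add: L11[OF c] L21[OF c])
  qed
  have sol': "D11 *\<^sub>v c = mat_adjoint Y *\<^sub>v (Zm *\<^sub>v c + k)" "D21 *\<^sub>v c = mat_adjoint B2 *\<^sub>v (Zm *\<^sub>v c + k)"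
      "mat_adjoint V *\<^sub>v (Zm *\<^sub>v c + k) = 0\<^sub>v r"
    if c: "c \<in> carrier_vec n1" and k: "k \<in> \<W>" for c k
  proof -
    have kc: "k \<in> carrier_vec n" by (rule subspace_vecD(3)[OF subspace_W k])
    note kk = W_perp[OF kc, THEN iffD1, OF k]
    show "D11 *\<^sub>v c = mat_adjoint Y *\<^sub>v (Zm *\<^sub>v c + k)" "D21 *\<^sub>v c = mat_adjoint B2 *\<^sub>v (Zm *\<^sub>v c + k)"
      "mat_adjoint V *\<^sub>v (Zm *\<^sub>v c + k) = 0\<^sub>v r"
      using kk V_Zm[OF c] comp[OF car(2)[OF c]] mult_add_distrib_mat_vec[OF A(1) car(2)[OF c] kc]
        mult_add_distrib_mat_vec[OF A(2) car(2)[OF c] kc] mult_add_distrib_mat_vec[OF A(5) car(2)[OF c] kc]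
      by (simp_all add: D11[OF c] D21[OF c])
  qed
  \<comment> \<open>The part \<open>v\<close> of the intermediate vector in \<N> leaves no trace in
    the first component, as \<open>(0, v)\<close> can be subtracted in \<open>L\<close>. In the
    second component it contributes an element of the complement of \<X>, which \<W>
    absorbs.\<close>
  have LD_eq: "(x, z) \<in> L O D \<longleftrightarrow> (\<exists>c\<in>carrier_vec n1. \<exists>k\<in>\<R>. \<exists>w\<in>\<W>. x = Xm *\<^sub>v c + k \<and> z = Zm *\<^sub>v c + w)" for x z
  proof
    assume "(x, z) \<in> L O D"
    then obtain y where xy: "(x, y) \<in> L" and yz: "(y, z) \<in> D" by blast
    then have yX: "y \<in> \<X>" by (auto simp: middle_space_def)
    obtain v y1 where y: "y = v + y1" "v \<in> \<N>" "y1 \<in> \<X> \<inter> orth n \<N>" by (rule XE[OF yX])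
    obtain c where c: "c \<in> carrier_vec n1" "y1 = Y *\<^sub>v c" using y(3) YU by blast
    have vc: "v \<in> carrier_vec n" by (rule subspace_vecD(3)[OF subspace_N y(2)])
    have xc: "x \<in> carrier_vec n" and zc: "z \<in> carrier_vec n" using LD(1)[OF xy] DD(2)[OF yz] by auto
    have yv: "y - Y *\<^sub>v c = v" unfolding y(1) c(2) by (rule vec_cancel(1)[OF vc car(3)[OF c(1)]])
    have vL: "(0\<^sub>v n, v) \<in> L" using y(2) by (simp add: singular_space_def)
    have "(x - Xm *\<^sub>v c, v) \<in> L" using linear_relation_diff[OF linear_L xy XmL[OF c(1)]] yv by simp
    from linear_relation_diff[OF linear_L this vL]
    have "x - Xm *\<^sub>v c \<in> \<R>" using xc car[OF c(1)] vc by (simp add: ker_space_def)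
    moreover have "z - Zm *\<^sub>v c \<in> \<W>"
    proof -
      obtain zv where zv: "zv \<in> orth n \<X>" "(v, zv) \<in> D" using y(2) by (auto simp: singular_space_def)
      have zvc: "zv \<in> carrier_vec n" using DD(2)[OF zv(2)] .
      have vz: "(v, z - Zm *\<^sub>v c) \<in> D" using linear_relation_diff[OF linear_D yz ZmD[OF c(1)]] yv by simp
      from linear_relation_diff[OF linear_D this zv(2)]
      have "z - Zm *\<^sub>v c - zv \<in> orth n \<X>" using vc by (intro orth_Domain_subset_Xo) simp
      from Xo_D(4)[OF this zv(1)] have "z - Zm *\<^sub>v c - zv + zv \<in> orth n \<X>" .
      moreover have "z - Zm *\<^sub>v c - zv + zv = z - Zm *\<^sub>v c"
        by (rule vec_cancel(2)[OF _ zvc]) (use zc car(2)[OF c(1)] in simp)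
      ultimately show ?thesis using vz vL by (auto simp: mul_space_def)
    qed
    moreover have "x = Xm *\<^sub>v c + (x - Xm *\<^sub>v c)" "z = Zm *\<^sub>v c + (z - Zm *\<^sub>v c)"
      using vec_cancel(3)[OF car(1)[OF c(1)] xc] vec_cancel(3)[OF car(2)[OF c(1)] zc] by simp_all
    ultimately show "\<exists>c\<in>carrier_vec n1. \<exists>k\<in>\<R>. \<exists>w\<in>\<W>. x = Xm *\<^sub>v c + k \<and> z = Zm *\<^sub>v c + w" using c(1) by blast
  next
    assume "\<exists>c\<in>carrier_vec n1. \<exists>k\<in>\<R>. \<exists>w\<in>\<W>. x = Xm *\<^sub>v c + k \<and> z = Zm *\<^sub>v c + w"
    then obtain c k w where c: "c \<in> carrier_vec n1" and k: "(k, 0\<^sub>v n) \<in> L" and w: "w \<in> \<W>"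
      and x: "x = Xm *\<^sub>v c + k" and z: "z = Zm *\<^sub>v c + w" by (auto simp: ker_space_def)
    obtain v where v: "(0\<^sub>v n, v) \<in> L" "(v, w) \<in> D" using w by (auto simp: mul_space_def)
    have "(Xm *\<^sub>v c + k + 0\<^sub>v n, Y *\<^sub>v c + 0\<^sub>v n + v) \<in> L" by (intro LD(4) XmL c k v)
    moreover have "Xm *\<^sub>v c + k + 0\<^sub>v n = x" "Y *\<^sub>v c + 0\<^sub>v n = Y *\<^sub>v c"
      using car[OF c] LD(1)[OF k] by (auto simp: x)
    moreover have "(Y *\<^sub>v c + v, z) \<in> D" unfolding z by (intro DD(4) ZmD c v)
    ultimately show "(x, z) \<in> L O D" by auto
  qed
  show thesis
  proof (rule that[OF S S_invertible n_eq dims])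
    show "{(S *\<^sub>v x, S *\<^sub>v z) | x z. (x, z) \<in> L O D} =
      normal_relation n1 n2 n3 n4 r L11 D11 D21 L21" (is "?l = ?r")
    proof
      show "?l \<subseteq> ?r"
      proof (rule subrelI)
        fix u v assume "(u, v) \<in> ?l"
        then obtain x z where uv: "u = S *\<^sub>v x" "v = S *\<^sub>v z" and "(x, z) \<in> L O D" by blast
        then obtain c k w where c: "c \<in> carrier_vec n1" and k: "k \<in> \<R>" and w: "w \<in> \<W>"
          and x: "x = Xm *\<^sub>v c + k" and z: "z = Zm *\<^sub>v c + w" unfolding LD_eq by blast
        have xc: "x \<in> carrier_vec n" and zc: "z \<in> carrier_vec n"
          using car[OF c] subspace_vecD(3)[OF subspace_R k] subspace_vecD(3)[OF subspace_W w] by (auto simp: x z)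
        have "u = L11 *\<^sub>v c @\<^sub>v mat_adjoint B2 *\<^sub>v x @\<^sub>v L21 *\<^sub>v c @\<^sub>v mat_adjoint B4 *\<^sub>v x @\<^sub>v 0\<^sub>v r"
          unfolding uv S_mult[OF xc] sol[OF c k, folded x] ..
        moreover have "v = D11 *\<^sub>v c @\<^sub>v D21 *\<^sub>v c @\<^sub>v mat_adjoint B3 *\<^sub>v z @\<^sub>v mat_adjoint B4 *\<^sub>v z @\<^sub>v 0\<^sub>v r"
          unfolding uv S_mult[OF zc] sol'[OF c w, folded z] ..
        ultimately show "(u, v) \<in> ?r" using c comp[OF xc] comp[OF zc] unfolding normal_relation_def by blast
      qed
      show "?r \<subseteq> ?l"
      proof (rule subrelI)
        fix u v assume "(u, v) \<in> ?r"
        then obtain c a2 a3 a4 b4 where u: "u = L11 *\<^sub>v c @\<^sub>v a2 @\<^sub>v L21 *\<^sub>v c @\<^sub>v a4 @\<^sub>v 0\<^sub>v r"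
          and v: "v = D11 *\<^sub>v c @\<^sub>v D21 *\<^sub>v c @\<^sub>v a3 @\<^sub>v b4 @\<^sub>v 0\<^sub>v r"
          and c: "c \<in> carrier_vec n1" and a: "a2 \<in> carrier_vec n2" "a3 \<in> carrier_vec n3"
            "a4 \<in> carrier_vec n4" "b4 \<in> carrier_vec n4" unfolding normal_relation_def by blast
        note cx = comp[OF car(1)[OF c]] and cz = comp[OF car(2)[OF c]]
        have z: "0\<^sub>v n1 \<in> carrier_vec n1" "0\<^sub>v n2 \<in> carrier_vec n2" "0\<^sub>v n3 \<in> carrier_vec n3" "0\<^sub>v r \<in> carrier_vec r" by auto
        \<comment> \<open>\<open>k\<close> and then \<open>w\<close> correct \<open>Xm c\<close> and
          \<open>Zm c\<close> in the free blocks of \<R> and \<W> and have zero blocks elsewhere;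
          the zero blocks certify their membership.\<close>
        from S_surj[OF z(1) minus_carrier_vec[OF a(1) cx(2)] z(3) minus_carrier_vec[OF a(3) cx(4)] z(4)]
        obtain k where k: "k \<in> carrier_vec n" "mat_adjoint Y *\<^sub>v k = 0\<^sub>v n1"
          "mat_adjoint B2 *\<^sub>v k = a2 - mat_adjoint B2 *\<^sub>v (Xm *\<^sub>v c)" "mat_adjoint B3 *\<^sub>v k = 0\<^sub>v n3"
          "mat_adjoint B4 *\<^sub>v k = a4 - mat_adjoint B4 *\<^sub>v (Xm *\<^sub>v c)" "mat_adjoint V *\<^sub>v k = 0\<^sub>v r" by blast
        from S_surj[OF z(1,2) minus_carrier_vec[OF a(2) cz(3)] minus_carrier_vec[OF a(4) cz(4)] z(4)]
        obtain w where w: "w \<in> carrier_vec n" "mat_adjoint Y *\<^sub>v w = 0\<^sub>v n1" "mat_adjoint B2 *\<^sub>v w = 0\<^sub>v n2"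
          "mat_adjoint B3 *\<^sub>v w = a3 - mat_adjoint B3 *\<^sub>v (Zm *\<^sub>v c)"
          "mat_adjoint B4 *\<^sub>v w = b4 - mat_adjoint B4 *\<^sub>v (Zm *\<^sub>v c)" "mat_adjoint V *\<^sub>v w = 0\<^sub>v r" by blast
        have kR: "k \<in> \<R>" using R_perp[OF k(1)] k by blast
        have wW: "w \<in> \<W>" using W_perp[OF w(1)] w by blast
        define x where "x = Xm *\<^sub>v c + k"
        define z where "z = Zm *\<^sub>v c + w"
        have xc: "x \<in> carrier_vec n" and zc: "z \<in> carrier_vec n" using car[OF c] k(1) w(1) by (auto simp: x_def z_def)
        have "mat_adjoint B2 *\<^sub>v x = a2" "mat_adjoint B4 *\<^sub>v x = a4"
          unfolding x_def mult_add_distrib_mat_vec[OF A(2) car(1)[OF c] k(1)]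
            mult_add_distrib_mat_vec[OF A(4) car(1)[OF c] k(1)] k
          by (rule vec_cancel(3)[OF cx(2) a(1)] vec_cancel(3)[OF cx(4) a(3)])+
        then have "u = S *\<^sub>v x" unfolding S_mult[OF xc] u sol[OF c kR, folded x_def] by simp
        moreover have "mat_adjoint B3 *\<^sub>v z = a3" "mat_adjoint B4 *\<^sub>v z = b4"
          unfolding z_def mult_add_distrib_mat_vec[OF A(3) car(2)[OF c] w(1)]
            mult_add_distrib_mat_vec[OF A(4) car(2)[OF c] w(1)] w
          by (rule vec_cancel(3)[OF cz(3) a(2)] vec_cancel(3)[OF cz(4) a(4)])+
        then have "v = S *\<^sub>v z" unfolding S_mult[OF zc] v sol'[OF c wW, folded z_def] by simp
        moreover have "(x, z) \<in> L O D" unfolding LD_eq x_def z_def using c kR wW by blast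
        ultimately show "(u, v) \<in> ?l" by blast
      qed
    qed
  next
    have "cip (L11 *\<^sub>v c) c \<ge> 0" if c: "c \<in> carrier_vec n1" for c
      unfolding cL11[OF c c] by (rule L_nonneg[OF XmL[OF c]])
    moreover have "cip (L11 *\<^sub>v c) d = cip c (L11 *\<^sub>v d)"
      if c: "c \<in> carrier_vec n1" and d: "d \<in> carrier_vec n1" for c d
    proof -
      have "cip c (L11 *\<^sub>v d) = cnj (cip (L11 *\<^sub>v d) c)"
        using cip_cnj[of "L11 *\<^sub>v d" n1 c] dims(1) c d by simp
      also have "\<dots> = cnj (cip (Xm *\<^sub>v d) (Y *\<^sub>v c))" unfolding cL11[OF d c] ..
      also have "\<dots> = cip (Y *\<^sub>v c) (Xm *\<^sub>v d)" by (rule cip_cnj[OF car(1)[OF d] car(3)[OF c]])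
      also have "\<dots> = cip (Xm *\<^sub>v c) (Y *\<^sub>v d)" by (rule L_symmetric[OF XmL[OF c] XmL[OF d]])
      finally show ?thesis unfolding cL11[OF c d] ..
    qed
    ultimately show "psd_mat n1 L11" unfolding psd_mat_def using dims(1) by blast
    have "Re (cip (D11 *\<^sub>v c) c) \<le> 0" if c: "c \<in> carrier_vec n1" for c
      unfolding cD11[OF c c] using D_dissip[OF ZmD[OF c]] cip_cnj[OF car(3)[OF c] car(2)[OF c]]
      by (metis cnj.simps(1))
    then show "dissipative_mat n1 D11" unfolding dissipative_mat_def using dims(2) by blast
  next
    fix c :: "'k vec" assume c: "c \<in> carrier_vec n1"
    show "c = 0\<^sub>v n1" if eq: "L11 *\<^sub>v c = D11 *\<^sub>v c"
    proof -
      \<comment> \<open>The form of \<open>L\<close> is nonnegative and that of \<open>D\<close> has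
        nonpositive real part, so their common value is zero. It follows that \<open>Y c\<close>
        belongs to \<N> and to its complement.\<close>
      have "cip (Xm *\<^sub>v c) (Y *\<^sub>v c) = cip (Zm *\<^sub>v c) (Y *\<^sub>v c)"
        unfolding cL11[OF c c, symmetric] cD11[OF c c, symmetric] eq ..
      moreover have "Re (cip (Zm *\<^sub>v c) (Y *\<^sub>v c)) \<le> 0"
        using D_dissip[OF ZmD[OF c]] cip_cnj[OF car(3)[OF c] car(2)[OF c]] by (metis cnj.simps(1))
      ultimately have z: "cip (Xm *\<^sub>v c) (Y *\<^sub>v c) = 0"
        using L_nonneg_Re[OF XmL[OF c]] L_nonneg_Im[OF XmL[OF c]] by (simp add: complex_eq_iff)
      have "mat_adjoint Y *\<^sub>v (Xm *\<^sub>v c) = 0\<^sub>v n1" using R_perp[OF car(1)[OF c]] null(1)[OF c z] by blast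
      then have "mat_adjoint Y *\<^sub>v (Zm *\<^sub>v c) = 0\<^sub>v n1" using eq L11[OF c] D11[OF c] by simp
      then have "Zm *\<^sub>v c \<in> orth n \<X>"
        using V_Zm[OF c] unfolding perp[OF car(2)[OF c]] orth_X_iff[of "Zm *\<^sub>v c"] by blast
      then have "Y *\<^sub>v c \<in> \<N>" using null(2)[OF c z] ZmD[OF c] by (auto simp: singular_space_def)
      then have "cip (Y *\<^sub>v c) (Y *\<^sub>v c) = 0" using Y_mem[OF c] by (simp add: orth_def)
      then have "Y *\<^sub>v c = 0\<^sub>v n" by (rule cip_self_eq_0[OF car(3)[OF c]])
      then show "c = 0\<^sub>v n1" by (rule inj_matD[OF Y(2,1) c])
    qed
    show "L21 *\<^sub>v c = 0\<^sub>v n3" if eq: "L11 *\<^sub>v c = 0\<^sub>v n1"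
    proof -
      have z: "cip (Xm *\<^sub>v c) (Y *\<^sub>v c) = 0" unfolding cL11[OF c c, symmetric] eq using c by simp
      show ?thesis unfolding L21[OF c] using R_perp[OF car(1)[OF c]] null(1)[OF c z] by blast
    qed
  qed
qed

end

section \<open>Block pencils\<close>

interpretation const_poly: comm_ring_hom "\<lambda>c :: 'a :: comm_ring_1. [:c:]"
  by standard (auto simp: one_pCons)

lemma pencil_carrier [simp]:
  "E \<in> carrier_mat n m \<Longrightarrow> A \<in> carrier_mat n m \<Longrightarrow> pencil E A \<in> carrier_mat n m"
  by (rule carrier_matI) (auto simp: pencil_def)

lemma pencil_dim [simp]: "dim_row (pencil E A) = dim_row A" "dim_col (pencil E A) = dim_col A"
  by (auto simp: pencil_def)

lemma pencil_index [simp]: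
  "i < dim_row A \<Longrightarrow> j < dim_col A \<Longrightarrow> i < dim_row E \<Longrightarrow> j < dim_col E \<Longrightarrow>
    pencil E A $$ (i, j) = [:- A $$ (i, j), E $$ (i, j):]"
  by (simp add: pencil_def)

lemma pencil_mult:
  assumes E: "E \<in> carrier_mat n m" and A: "A \<in> carrier_mat n m"
    and S: "S \<in> carrier_mat p n" and T: "T \<in> carrier_mat m q"
  shows "const_mat S * pencil E A * const_mat T = pencil (S * E * T) (S * A * T)"
proof -
  have c: "const_mat S \<in> carrier_mat p n" "const_mat T \<in> carrier_mat m q"
    "const_mat E \<in> carrier_mat n m" "const_mat A \<in> carrier_mat n m" "s_times E \<in> carrier_mat n m"
    using assms by auto
  have m: "const_mat S * const_mat E \<in> carrier_mat p m" "const_mat S * const_mat A \<in> carrier_mat p m"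
    "S * E \<in> carrier_mat p m" "S * A \<in> carrier_mat p m" using c S E A by auto
  have "const_mat S * pencil E A = [:0, 1:] \<cdot>\<^sub>m (const_mat S * const_mat E) - const_mat S * const_mat A"
    unfolding pencil_def mult_minus_distrib_mat[OF c(1,5,4)] mult_smult_distrib[OF c(1,3)] ..
  also have "\<dots> * const_mat T = [:0, 1:] \<cdot>\<^sub>m (const_mat S * const_mat E * const_mat T) -
      const_mat S * const_mat A * const_mat T"
    unfolding minus_mult_distrib_mat[OF smult_carrier_mat[OF m(1)] m(2) c(2)]
      mult_smult_assoc_mat[OF m(1) c(2)] ..
  also have "\<dots> = pencil (S * E * T) (S * A * T)"
    by (simp only: pencil_def const_poly.mat_hom_mult[OF m(3) T] const_poly.mat_hom_mult[OF m(4) T]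
        const_poly.mat_hom_mult[OF S E] const_poly.mat_hom_mult[OF S A])
  finally show ?thesis .
qed

lemma pencil_inject:
  assumes "E \<in> carrier_mat n m" "A \<in> carrier_mat n m" "E' \<in> carrier_mat n m" "A' \<in> carrier_mat n m"
    and eq: "pencil E A = pencil E' A'"
  shows "E = E'" "A = A'"
proof -
  have "[:- A $$ (i, j), E $$ (i, j):] = [:- A' $$ (i, j), E' $$ (i, j):]" if "i < n" "j < m" for i j
  proof -
    have "pencil E A $$ (i, j) = pencil E' A' $$ (i, j)" by (simp only: eq)
    then show ?thesis using assms(1-4) that by simp
  qed
  then show "E = E'" "A = A'" using assms by (auto intro!: eq_matI)
qed

lemma pencil_four_block:
  assumes "dim_row E1 = dim_row A1" "dim_col E1 = dim_col A1" "dim_row E4 = dim_row A4" "dim_col E4 = dim_col A4"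
    "dim_row E2 = dim_row A1" "dim_col E2 = dim_col A4" "dim_row E3 = dim_row A4" "dim_col E3 = dim_col A1"
    "dim_row A2 = dim_row A1" "dim_col A2 = dim_col A4" "dim_row A3 = dim_row A4" "dim_col A3 = dim_col A1"
  shows "pencil (four_block_mat E1 E2 E3 E4) (four_block_mat A1 A2 A3 A4) =
    four_block_mat (pencil E1 A1) (pencil E2 A2) (pencil E3 A3) (pencil E4 A4)"
  using assms by (intro eq_matI) auto

lemma pencil_zero_zero [simp]: "pencil (0\<^sub>m p k) (0\<^sub>m p k) = 0\<^sub>m p k"
  by (intro eq_matI) auto

section \<open>Block matrices acting on vectors split in the same way\<close>

lemma hcat_Cons: "Bs \<noteq> [] \<Longrightarrow>
  hcat (A # Bs) = four_block_mat A (hcat Bs) (0\<^sub>m 0 (dim_col A)) (0\<^sub>m 0 (dim_col (hcat Bs)))"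
  by (cases Bs) (auto simp: Let_def)

lemma zero_mult_mat_vec: "a \<in> carrier_vec k \<Longrightarrow> 0\<^sub>m p k *\<^sub>v a = (0\<^sub>v p :: 'a :: comm_ring_1 vec)"
  by (intro eq_vecI) auto

lemma hcat_mult_vec:
  fixes A :: "'a :: comm_ring_1 mat"
  assumes "A \<in> carrier_mat p k" "hcat Bs \<in> carrier_mat p l" "Bs \<noteq> []" "a \<in> carrier_vec k" "b \<in> carrier_vec l"
  shows "hcat (A # Bs) *\<^sub>v (a @\<^sub>v b) = A *\<^sub>v a + hcat Bs *\<^sub>v b"
  using hcat2_mult_vec[OF assms(1,2,4,5)] assms(3) by (simp add: hcat_Cons hcat2_def)

text \<open>The right-nested splitting of the vector follows the recursion of \<open>hcat\<close>.
  Later calculations can then be made block by block, without matrix entries.\<close>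

lemma hcat6:
  fixes A1 :: "'a :: comm_ring_1 mat"
  assumes A: "A1 \<in> carrier_mat p k1" "A2 \<in> carrier_mat p k2" "A3 \<in> carrier_mat p k3"
    "A4 \<in> carrier_mat p k4" "A5 \<in> carrier_mat p k5" "A6 \<in> carrier_mat p k6"
  shows "hcat [A1, A2, A3, A4, A5, A6] \<in> carrier_mat p (k1 + (k2 + (k3 + (k4 + (k5 + k6)))))"
    and "a1 \<in> carrier_vec k1 \<Longrightarrow> a2 \<in> carrier_vec k2 \<Longrightarrow> a3 \<in> carrier_vec k3 \<Longrightarrow>
      a4 \<in> carrier_vec k4 \<Longrightarrow> a5 \<in> carrier_vec k5 \<Longrightarrow> a6 \<in> carrier_vec k6 \<Longrightarrow>
      hcat [A1, A2, A3, A4, A5, A6] *\<^sub>v (a1 @\<^sub>v a2 @\<^sub>v a3 @\<^sub>v a4 @\<^sub>v a5 @\<^sub>v a6) =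
      A1 *\<^sub>v a1 + (A2 *\<^sub>v a2 + (A3 *\<^sub>v a3 + (A4 *\<^sub>v a4 + (A5 *\<^sub>v a5 + A6 *\<^sub>v a6))))"
proof -
  note d = A[THEN carrier_matD(1)] A[THEN carrier_matD(2)]
  have h6: "hcat [A6] \<in> carrier_mat p k6" using A by simp
  have h5: "hcat [A5, A6] \<in> carrier_mat p (k5 + k6)" by (rule carrier_matI) (simp_all add: d Let_def)
  have h4: "hcat [A4, A5, A6] \<in> carrier_mat p (k4 + (k5 + k6))"
    by (rule carrier_matI) (simp_all add: d Let_def)
  have h3: "hcat [A3, A4, A5, A6] \<in> carrier_mat p (k3 + (k4 + (k5 + k6)))"
    by (rule carrier_matI) (simp_all add: d Let_def)
  have h2: "hcat [A2, A3, A4, A5, A6] \<in> carrier_mat p (k2 + (k3 + (k4 + (k5 + k6))))"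
    by (rule carrier_matI) (simp_all add: d Let_def)
  show "hcat [A1, A2, A3, A4, A5, A6] \<in> carrier_mat p (k1 + (k2 + (k3 + (k4 + (k5 + k6)))))"
    by (rule carrier_matI) (simp_all add: d Let_def)
  assume a: "a1 \<in> carrier_vec k1" "a2 \<in> carrier_vec k2" "a3 \<in> carrier_vec k3"
      "a4 \<in> carrier_vec k4" "a5 \<in> carrier_vec k5" "a6 \<in> carrier_vec k6"
  have c6: "a5 @\<^sub>v a6 \<in> carrier_vec (k5 + k6)" using a by simp
  have c5: "a4 @\<^sub>v a5 @\<^sub>v a6 \<in> carrier_vec (k4 + (k5 + k6))" using a by simp
  have c4: "a3 @\<^sub>v a4 @\<^sub>v a5 @\<^sub>v a6 \<in> carrier_vec (k3 + (k4 + (k5 + k6)))" using a by simp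
  have c3: "a2 @\<^sub>v a3 @\<^sub>v a4 @\<^sub>v a5 @\<^sub>v a6 \<in> carrier_vec (k2 + (k3 + (k4 + (k5 + k6))))" using a by simp
  have "hcat [A6] *\<^sub>v a6 = A6 *\<^sub>v a6" by simp
  then show "hcat [A1, A2, A3, A4, A5, A6] *\<^sub>v (a1 @\<^sub>v a2 @\<^sub>v a3 @\<^sub>v a4 @\<^sub>v a5 @\<^sub>v a6) =
      A1 *\<^sub>v a1 + (A2 *\<^sub>v a2 + (A3 *\<^sub>v a3 + (A4 *\<^sub>v a4 + (A5 *\<^sub>v a5 + A6 *\<^sub>v a6))))"
    using hcat_mult_vec[OF A(1) h2 _ a(1) c3] hcat_mult_vec[OF A(2) h3 _ a(2) c4]
      hcat_mult_vec[OF A(3) h4 _ a(3) c5] hcat_mult_vec[OF A(4) h5 _ a(4) c6]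
      hcat_mult_vec[OF A(5) h6 _ a(5,6)] by (simp del: hcat.simps)
qed

lemma vcat5_mult_vec:
  fixes B1 :: "'a :: comm_ring_1 mat"
  assumes B: "B1 \<in> carrier_mat p1 k" "B2 \<in> carrier_mat p2 k" "B3 \<in> carrier_mat p3 k"
    "B4 \<in> carrier_mat p4 k" "B5 \<in> carrier_mat p5 k" and v: "v \<in> carrier_vec k"
  shows "vcat [B1, B2, B3, B4, B5] *\<^sub>v v = B1 *\<^sub>v v @\<^sub>v B2 *\<^sub>v v @\<^sub>v B3 *\<^sub>v v @\<^sub>v B4 *\<^sub>v v @\<^sub>v B5 *\<^sub>v v"
proof -
  note h4 = carrier_append_rows[OF B(4,5)]
  note h3 = carrier_append_rows[OF B(3) h4]
  note h2 = carrier_append_rows[OF B(2) h3]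
  show ?thesis
    unfolding vcat.simps append_rows_mult_vec[OF B(1) h2 v] append_rows_mult_vec[OF B(2) h3 v]
      append_rows_mult_vec[OF B(3) h4 v] append_rows_mult_vec[OF B(4,5) v] ..
qed

text \<open>Evaluation at s = 1 commutes with the determinant, and \<open>L - D\<close> is
  injective.\<close>

lemma regular_pencilI:
  fixes L D :: "'k :: real_or_complex mat"
  assumes L: "L \<in> carrier_mat k k" and D: "D \<in> carrier_mat k k"
    and inj: "\<And>c. c \<in> carrier_vec k \<Longrightarrow> L *\<^sub>v c = D *\<^sub>v c \<Longrightarrow> c = 0\<^sub>v k"
  shows "regular_pencil L D"
proof -
  have eval: "comm_ring_hom (\<lambda>p :: 'k poly. poly p 1)" by standard auto
  have P: "pencil L D \<in> carrier_mat k k" using L D by simp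
  have LD: "L - D \<in> carrier_mat k k" using L D by auto
  have "map_mat (\<lambda>p. poly p 1) (pencil L D) = L - D"
    using L D by (intro eq_matI) auto
  then have "poly (det (pencil L D)) 1 = det (L - D)" using comm_ring_hom.hom_det[OF eval, of "pencil L D"] by simp
  moreover have "det (L - D) \<noteq> 0"
  proof
    assume "det (L - D) = 0"
    then obtain c where c: "c \<in> carrier_vec k" "c \<noteq> 0\<^sub>v k" "(L - D) *\<^sub>v c = 0\<^sub>v k"
      using det_0_iff_vec_prod_zero_field[OF LD] by blast
    have Lc: "L *\<^sub>v c \<in> carrier_vec k" and Dc: "D *\<^sub>v c \<in> carrier_vec k"
      using L D c(1) by auto
    have "L *\<^sub>v c - D *\<^sub>v c = 0\<^sub>v k" using minus_mult_distrib_mat_vec[OF L D c(1)] c(3) by simp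
    then have "L *\<^sub>v c = D *\<^sub>v c" by (rule minus_vec_eq_0[OF Lc Dc])
    then show False using inj c by blast
  qed
  ultimately have "det (pencil L D) \<noteq> 0" by auto
  moreover have "square_mat (pencil L D)" using D by simp
  ultimately show ?thesis by (simp add: regular_pencil_def)
qed

text \<open>The shape is kept generic in its entries so that it serves for the two coefficient
  matrices as well as for the pencil they form.\<close>

abbreviation block5x6 where
  "block5x6 n1 n2 n3 n4 r c X11 X21 X22 X31 X33 X44 X45 \<equiv> block_mat
    [[X11, 0\<^sub>m n1 n2, 0\<^sub>m n1 n3, 0\<^sub>m n1 n4, 0\<^sub>m n1 n4, 0\<^sub>m n1 c],
     [X21, X22, 0\<^sub>m n2 n3, 0\<^sub>m n2 n4, 0\<^sub>m n2 n4, 0\<^sub>m n2 c],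
     [X31, 0\<^sub>m n3 n2, X33, 0\<^sub>m n3 n4, 0\<^sub>m n3 n4, 0\<^sub>m n3 c],
     [0\<^sub>m n4 n1, 0\<^sub>m n4 n2, 0\<^sub>m n4 n3, X44, X45, 0\<^sub>m n4 c],
     [0\<^sub>m r n1, 0\<^sub>m r n2, 0\<^sub>m r n3, 0\<^sub>m r n4, 0\<^sub>m r n4, 0\<^sub>m r c]]"

lemma block5x6:
  fixes X11 :: "'a :: comm_ring_1 mat"
  assumes X: "X11 \<in> carrier_mat n1 n1" "X21 \<in> carrier_mat n2 n1" "X22 \<in> carrier_mat n2 n2"
    "X31 \<in> carrier_mat n3 n1" "X33 \<in> carrier_mat n3 n3" "X44 \<in> carrier_mat n4 n4" "X45 \<in> carrier_mat n4 n4"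
  shows "block5x6 n1 n2 n3 n4 r c X11 X21 X22 X31 X33 X44 X45 \<in>
      carrier_mat (n1 + (n2 + (n3 + (n4 + r)))) (n1 + (n2 + (n3 + (n4 + (n4 + c)))))"
    and "a1 \<in> carrier_vec n1 \<Longrightarrow> a2 \<in> carrier_vec n2 \<Longrightarrow> a3 \<in> carrier_vec n3 \<Longrightarrow>
      a4 \<in> carrier_vec n4 \<Longrightarrow> a5 \<in> carrier_vec n4 \<Longrightarrow> a6 \<in> carrier_vec c \<Longrightarrow>
      block5x6 n1 n2 n3 n4 r c X11 X21 X22 X31 X33 X44 X45 *\<^sub>v (a1 @\<^sub>v a2 @\<^sub>v a3 @\<^sub>v a4 @\<^sub>v a5 @\<^sub>v a6) =
      X11 *\<^sub>v a1 @\<^sub>v (X21 *\<^sub>v a1 + X22 *\<^sub>v a2) @\<^sub>v (X31 *\<^sub>v a1 + X33 *\<^sub>v a3) @\<^sub>v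
      (X44 *\<^sub>v a4 + X45 *\<^sub>v a5) @\<^sub>v 0\<^sub>v r"
proof -
  note Z = zero_carrier_mat
  note r1 = hcat6[OF X(1) Z[of n1 n2] Z[of n1 n3] Z[of n1 n4] Z[of n1 n4] Z[of n1 c]]
  note r2 = hcat6[OF X(2,3) Z[of n2 n3] Z[of n2 n4] Z[of n2 n4] Z[of n2 c]]
  note r3 = hcat6[OF X(4) Z[of n3 n2] X(5) Z[of n3 n4] Z[of n3 n4] Z[of n3 c]]
  note r4 = hcat6[OF Z[of n4 n1] Z[of n4 n2] Z[of n4 n3] X(6,7) Z[of n4 c]]
  note r5 = hcat6[OF Z[of r n1] Z[of r n2] Z[of r n3] Z[of r n4] Z[of r n4] Z[of r c]]
  show "block5x6 n1 n2 n3 n4 r c X11 X21 X22 X31 X33 X44 X45 \<in>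
      carrier_mat (n1 + (n2 + (n3 + (n4 + r)))) (n1 + (n2 + (n3 + (n4 + (n4 + c)))))"
    unfolding block_mat_def list.map vcat.simps
    by (intro carrier_append_rows r1(1) r2(1) r3(1) r4(1) r5(1))
  assume a: "a1 \<in> carrier_vec n1" "a2 \<in> carrier_vec n2" "a3 \<in> carrier_vec n3"
      "a4 \<in> carrier_vec n4" "a5 \<in> carrier_vec n4" "a6 \<in> carrier_vec c"
  have v: "a1 @\<^sub>v a2 @\<^sub>v a3 @\<^sub>v a4 @\<^sub>v a5 @\<^sub>v a6 \<in> carrier_vec (n1 + (n2 + (n3 + (n4 + (n4 + c)))))"
    by (intro append_carrier_vec a)
  have m: "X11 *\<^sub>v a1 \<in> carrier_vec n1" "X21 *\<^sub>v a1 \<in> carrier_vec n2" "X22 *\<^sub>v a2 \<in> carrier_vec n2"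
    "X31 *\<^sub>v a1 \<in> carrier_vec n3" "X33 *\<^sub>v a3 \<in> carrier_vec n3" "X44 *\<^sub>v a4 \<in> carrier_vec n4"
    "X45 *\<^sub>v a5 \<in> carrier_vec n4"
    using X a by (auto intro: mult_mat_vec_carrier)
  have z: "0\<^sub>v p + 0\<^sub>v p = (0\<^sub>v p :: 'a vec)" for p by (intro eq_vecI) auto
  note za = zero_mult_mat_vec[OF a(1)] zero_mult_mat_vec[OF a(2)] zero_mult_mat_vec[OF a(3)]
    zero_mult_mat_vec[OF a(4)] zero_mult_mat_vec[OF a(5)] zero_mult_mat_vec[OF a(6)]
  show "block5x6 n1 n2 n3 n4 r c X11 X21 X22 X31 X33 X44 X45 *\<^sub>v (a1 @\<^sub>v a2 @\<^sub>v a3 @\<^sub>v a4 @\<^sub>v a5 @\<^sub>v a6) =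
      X11 *\<^sub>v a1 @\<^sub>v (X21 *\<^sub>v a1 + X22 *\<^sub>v a2) @\<^sub>v (X31 *\<^sub>v a1 + X33 *\<^sub>v a3) @\<^sub>v
      (X44 *\<^sub>v a4 + X45 *\<^sub>v a5) @\<^sub>v 0\<^sub>v r"
    unfolding block_mat_def list.map vcat5_mult_vec[OF r1(1) r2(1) r3(1) r4(1) r5(1) v]
      r1(2)[OF a] r2(2)[OF a] r3(2)[OF a] r4(2)[OF a] r5(2)[OF a] za z
    using m by (simp del: append_vec_eq)
qed

lemma pencil_block5x6:
  fixes X11 :: "'k :: real_or_complex mat"
  assumes X: "X11 \<in> carrier_mat n1 n1" "X21 \<in> carrier_mat n2 n1" "X22 \<in> carrier_mat n2 n2"
    "X31 \<in> carrier_mat n3 n1" "X33 \<in> carrier_mat n3 n3" "X44 \<in> carrier_mat n4 n4" "X45 \<in> carrier_mat n4 n4"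
    and Y: "Y11 \<in> carrier_mat n1 n1" "Y21 \<in> carrier_mat n2 n1" "Y22 \<in> carrier_mat n2 n2"
    "Y31 \<in> carrier_mat n3 n1" "Y33 \<in> carrier_mat n3 n3" "Y44 \<in> carrier_mat n4 n4" "Y45 \<in> carrier_mat n4 n4"
  shows "pencil (block5x6 n1 n2 n3 n4 r c X11 X21 X22 X31 X33 X44 X45)
      (block5x6 n1 n2 n3 n4 r c Y11 Y21 Y22 Y31 Y33 Y44 Y45) =
    block5x6 n1 n2 n3 n4 r c (pencil X11 Y11) (pencil X21 Y21) (pencil X22 Y22) (pencil X31 Y31)
      (pencil X33 Y33) (pencil X44 Y44) (pencil X45 Y45)"
  using X[THEN carrier_matD(1)] X[THEN carrier_matD(2)] Y[THEN carrier_matD(1)] Y[THEN carrier_matD(2)]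
  by (simp add: block_mat_def Let_def append_rows_def pencil_four_block)
lemma one_block_pencils:
  "pencil (1\<^sub>m k) (0\<^sub>m k k) = s_times (1\<^sub>m k :: 'k :: real_or_complex mat)"
  "pencil (0\<^sub>m k k) (- 1\<^sub>m k :: 'k mat) = 1\<^sub>m k"
  "pencil (0\<^sub>m k k) (1\<^sub>m k :: 'k mat) = - 1\<^sub>m k"
  by (auto intro!: eq_matI simp: one_pCons simp del: const_poly.hom_one)

lemma pencil_zero_left: "A \<in> carrier_mat p k \<Longrightarrow> pencil (0\<^sub>m p k) (- A) = const_mat A"
  by (intro eq_matI) auto

lemma pencil_zero_right: "A \<in> carrier_mat p k \<Longrightarrow> pencil A (0\<^sub>m p k) = s_times A"
  by (intro eq_matI) auto

section \<open>From the relation back to the pencil: the column transformation\<close>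

context dissipative_nonnegative
begin

text \<open>The range of the stacked matrix determines it up to an invertible change of columns and
  zero columns. \<open>S\<close> comes from the relation; \<open>T\<close> is composed of
  \<open>T1\<close>, a lift of the non-zero block columns through \<open>S * E\<close> and
  \<open>S * A\<close>, and of \<open>T2\<close>, a basis of the common kernel, whose dimension is
  the width \<open>c\<close> of the zero block column.\<close>

lemma block_form:
  fixes E A :: "'k mat"
  assumes E: "E \<in> carrier_mat n m" and A: "A \<in> carrier_mat n m" and ran: "ran_stacked E A = L O D"
  obtains S T n1 n2 n3 n4 r c L11 D11 D21 L21 where
    "S \<in> carrier_mat n n" "invertible_mat S" "T \<in> carrier_mat m m" "invertible_mat T"
    "L11 \<in> carrier_mat n1 n1" "D11 \<in> carrier_mat n1 n1"
    "D21 \<in> carrier_mat n2 n1" "L21 \<in> carrier_mat n3 n1"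
    "const_mat S * pencil E A * const_mat T = block5x6 n1 n2 n3 n4 r c (pencil L11 D11) (const_mat D21)
      (s_times (1\<^sub>m n2)) (s_times L21) (1\<^sub>m n3) (s_times (1\<^sub>m n4)) (- 1\<^sub>m n4)"
    "psd_mat n1 L11" "dissipative_mat n1 D11"
    "regular_pencil L11 D11" "mat_kernel L11 \<subseteq> mat_kernel L21"
proof -
  obtain S n1 n2 n3 n4 r L11 D11 D21 L21 where S: "S \<in> carrier_mat n n" "invertible_mat S"
    and n_eq: "n = n1 + (n2 + (n3 + (n4 + r)))"
    and dims: "L11 \<in> carrier_mat n1 n1" "D11 \<in> carrier_mat n1 n1" "D21 \<in> carrier_mat n2 n1" "L21 \<in> carrier_mat n3 n1"
    and rel: "{(S *\<^sub>v x, S *\<^sub>v z) | x z. (x, z) \<in> L O D} =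
      normal_relation n1 n2 n3 n4 r L11 D11 D21 L21"
    and pos: "psd_mat n1 L11" "dissipative_mat n1 D11"
    and inj: "\<And>c. c \<in> carrier_vec n1 \<Longrightarrow> L11 *\<^sub>v c = D11 *\<^sub>v c \<Longrightarrow> c = 0\<^sub>v n1"
    and ker: "\<And>c. c \<in> carrier_vec n1 \<Longrightarrow> L11 *\<^sub>v c = 0\<^sub>v n1 \<Longrightarrow> L21 *\<^sub>v c = 0\<^sub>v n3"
    by (rule relation_normal_form) (rule that)
  define E1 where "E1 = S * E"
  define A1 where "A1 = S * A"
  have E1: "E1 \<in> carrier_mat n m" and A1: "A1 \<in> carrier_mat n m"
    using mult_carrier_mat[OF S(1) E] mult_carrier_mat[OF S(1) A] by (simp_all add: E1_def A1_def)
  have E1v: "E1 *\<^sub>v t = S *\<^sub>v (E *\<^sub>v t)" and A1v: "A1 *\<^sub>v t = S *\<^sub>v (A *\<^sub>v t)" if "t \<in> carrier_vec m" for t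
    using assoc_mult_mat_vec[OF S(1) E that] assoc_mult_mat_vec[OF S(1) A that]
    by (simp_all add: E1_def A1_def)
  let ?U = "{t \<in> carrier_vec m. E1 *\<^sub>v t = 0\<^sub>v n \<and> A1 *\<^sub>v t = 0\<^sub>v n}"
  have "subspace_vec m ?U"
  proof (rule subspace_vecI)
    show "0\<^sub>v m \<in> ?U" using mult_mat_zero_vec[OF E1] mult_mat_zero_vec[OF A1] by simp
    show "x + y \<in> ?U" if "x \<in> ?U" "y \<in> ?U" for x y
      using that mult_add_distrib_mat_vec[OF E1, of x y] mult_add_distrib_mat_vec[OF A1, of x y] by simp
    show "a \<cdot>\<^sub>v x \<in> ?U" if "x \<in> ?U" for a x
      using that mult_mat_vec[OF E1, of x a] mult_mat_vec[OF A1, of x a] by simp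
  qed blast
  then obtain c T2 where T2: "T2 \<in> carrier_mat m c" "inj_mat T2" and T2U: "?U = (\<lambda>v. T2 *\<^sub>v v) ` carrier_vec c"
    by (rule subspace_vec_basis)
  let ?q = "n1 + (n2 + (n3 + (n4 + n4)))"
  let ?m = "n1 + (n2 + (n3 + (n4 + (n4 + c))))"
  let ?O = "\<lambda>k l. 0\<^sub>m k l :: 'k mat" and ?I = "\<lambda>k. 1\<^sub>m k :: 'k mat"
  \<comment> \<open>Coefficients of the target pencil. As \<open>pencil\<close> subtracts its second
    argument, constant entries occur in \<open>AB\<close> with the opposite sign; the double
    negation is written because the block in the final form is \<open>- D21\<close>.\<close>
  define EB where "EB = block5x6 n1 n2 n3 n4 r c L11 (?O n2 n1) (?I n2) L21 (?O n3 n3) (?I n4) (?O n4 n4)"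
  define AB where "AB = block5x6 n1 n2 n3 n4 r c D11 (- (- D21)) (?O n2 n2) (?O n3 n1) (- ?I n3) (?O n4 n4) (?I n4)"
  have D21': "- (- D21) \<in> carrier_mat n2 n1" "- ?I n3 \<in> carrier_mat n3 n3" using dims by auto
  note eb = block5x6[OF dims(1) zero_carrier_mat[of n2 n1] one_carrier_mat[of n2] dims(4)
      zero_carrier_mat[of n3 n3] one_carrier_mat[of n4] zero_carrier_mat[of n4 n4], where r = r and c = c, folded EB_def n_eq]
  note ab = block5x6[OF dims(2) D21'(1) zero_carrier_mat[of n2 n2] zero_carrier_mat[of n3 n1] D21'(2)
      zero_carrier_mat[of n4 n4] one_carrier_mat[of n4], where r = r and c = c, folded AB_def n_eq]
  have EBv: "EB *\<^sub>v (a1 @\<^sub>v a2 @\<^sub>v a3 @\<^sub>v a4 @\<^sub>v a5 @\<^sub>v a6) = L11 *\<^sub>v a1 @\<^sub>v a2 @\<^sub>v L21 *\<^sub>v a1 @\<^sub>v a4 @\<^sub>v 0\<^sub>v r"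
    and ABv: "AB *\<^sub>v (a1 @\<^sub>v a2 @\<^sub>v a3 @\<^sub>v a4 @\<^sub>v a5 @\<^sub>v a6) = D11 *\<^sub>v a1 @\<^sub>v D21 *\<^sub>v a1 @\<^sub>v (- a3) @\<^sub>v a5 @\<^sub>v 0\<^sub>v r"
    if a: "a1 \<in> carrier_vec n1" "a2 \<in> carrier_vec n2" "a3 \<in> carrier_vec n3"
      "a4 \<in> carrier_vec n4" "a5 \<in> carrier_vec n4" "a6 \<in> carrier_vec c" for a1 a2 a3 a4 a5 a6
  proof -
    note za = zero_mult_mat_vec[OF a(1)] zero_mult_mat_vec[OF a(2)] zero_mult_mat_vec[OF a(3)]
      zero_mult_mat_vec[OF a(4)] zero_mult_mat_vec[OF a(5)] zero_mult_mat_vec[OF a(6)]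
    have m: "L11 *\<^sub>v a1 \<in> carrier_vec n1" "D11 *\<^sub>v a1 \<in> carrier_vec n1" "D21 *\<^sub>v a1 \<in> carrier_vec n2"
      "L21 *\<^sub>v a1 \<in> carrier_vec n3"
      using dims a by (auto intro: mult_mat_vec_carrier)
    have o: "?I k *\<^sub>v v = v" "- ?I k *\<^sub>v v = - v" if "v \<in> carrier_vec k" for v k
      using that by (auto intro!: eq_vecI)
    show "EB *\<^sub>v (a1 @\<^sub>v a2 @\<^sub>v a3 @\<^sub>v a4 @\<^sub>v a5 @\<^sub>v a6) = L11 *\<^sub>v a1 @\<^sub>v a2 @\<^sub>v L21 *\<^sub>v a1 @\<^sub>v a4 @\<^sub>v 0\<^sub>v r"
      unfolding eb(2)[OF a] za o[OF a(2)] o[OF a(4)] using m a by (simp del: append_vec_eq)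
    show "AB *\<^sub>v (a1 @\<^sub>v a2 @\<^sub>v a3 @\<^sub>v a4 @\<^sub>v a5 @\<^sub>v a6) = D11 *\<^sub>v a1 @\<^sub>v D21 *\<^sub>v a1 @\<^sub>v (- a3) @\<^sub>v a5 @\<^sub>v 0\<^sub>v r"
      unfolding ab(2)[OF a] za o[OF a(3)] o[OF a(5)] uminus_uminus_mat using m a by (simp del: append_vec_eq)
  qed
  have split: "\<exists>a1 a2 a3 a4 a5. v = a1 @\<^sub>v a2 @\<^sub>v a3 @\<^sub>v a4 @\<^sub>v a5 \<and> a1 \<in> carrier_vec n1 \<and> a2 \<in> carrier_vec n2 \<and>
      a3 \<in> carrier_vec n3 \<and> a4 \<in> carrier_vec n4 \<and> a5 \<in> carrier_vec n4"
    if v: "v \<in> carrier_vec ?q" for v :: "'k vec"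
    using v by (metis carrier_vec_appendE)
  have assoc5: "(a1 @\<^sub>v a2 @\<^sub>v a3 @\<^sub>v a4 @\<^sub>v a5) @\<^sub>v w = a1 @\<^sub>v a2 @\<^sub>v a3 @\<^sub>v a4 @\<^sub>v a5 @\<^sub>v w"
    for a1 a2 a3 a4 a5 w :: "'k vec" by (simp only: append_vec_assoc)
  have ran_eq: "{(E1 *\<^sub>v t, A1 *\<^sub>v t) | t. t \<in> carrier_vec m} =
      {(EB *\<^sub>v (v @\<^sub>v 0\<^sub>v c), AB *\<^sub>v (v @\<^sub>v 0\<^sub>v c)) | v. v \<in> carrier_vec ?q}" (is "?l = ?r")
  proof -
    have "?l = {(S *\<^sub>v x, S *\<^sub>v z) | x z. (x, z) \<in> L O D}"
    proof -
      have "?l = {(S *\<^sub>v (E *\<^sub>v t), S *\<^sub>v (A *\<^sub>v t)) | t. t \<in> carrier_vec m}"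
        using E1v A1v by (intro Collect_cong) (metis (no_types, lifting))
      also have "\<dots> = {(S *\<^sub>v x, S *\<^sub>v z) | x z. (x, z) \<in> ran_stacked E A}"
        using E by (auto simp: ran_stacked_def)
      finally show ?thesis unfolding ran .
    qed
    also have "\<dots> = ?r"
      unfolding rel
    proof (intro equalityI subrelI)
      fix x z assume "(x, z) \<in> normal_relation n1 n2 n3 n4 r L11 D11 D21 L21"
      then obtain a1 a2 a3 a4 b4 where a: "a1 \<in> carrier_vec n1" "a2 \<in> carrier_vec n2" "a3 \<in> carrier_vec n3"
          "a4 \<in> carrier_vec n4" "b4 \<in> carrier_vec n4"
        and x: "x = L11 *\<^sub>v a1 @\<^sub>v a2 @\<^sub>v L21 *\<^sub>v a1 @\<^sub>v a4 @\<^sub>v 0\<^sub>v r"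
        and z: "z = D11 *\<^sub>v a1 @\<^sub>v D21 *\<^sub>v a1 @\<^sub>v a3 @\<^sub>v b4 @\<^sub>v 0\<^sub>v r"
        unfolding normal_relation_def by blast
      have na: "- a3 \<in> carrier_vec n3" using a by simp
      let ?v = "a1 @\<^sub>v a2 @\<^sub>v (- a3) @\<^sub>v a4 @\<^sub>v b4"
      have v: "?v \<in> carrier_vec ?q" by (intro append_carrier_vec a na)
      moreover have "x = EB *\<^sub>v (?v @\<^sub>v 0\<^sub>v c)" unfolding assoc5 x
        by (rule EBv[OF a(1,2) na a(4,5) zero_carrier_vec, symmetric])
      moreover have "z = AB *\<^sub>v (?v @\<^sub>v 0\<^sub>v c)" unfolding assoc5 z
        using ABv[OF a(1,2) na a(4,5) zero_carrier_vec[of c]] by simp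
      ultimately show "(x, z) \<in> ?r" by blast
    next
      fix x z assume "(x, z) \<in> ?r"
      then obtain v where v: "v \<in> carrier_vec ?q" and x: "x = EB *\<^sub>v (v @\<^sub>v 0\<^sub>v c)" and z: "z = AB *\<^sub>v (v @\<^sub>v 0\<^sub>v c)"
        by blast
      obtain a1 a2 a3 a4 a5 where v_eq: "v = a1 @\<^sub>v a2 @\<^sub>v a3 @\<^sub>v a4 @\<^sub>v a5"
        and a: "a1 \<in> carrier_vec n1" "a2 \<in> carrier_vec n2" "a3 \<in> carrier_vec n3" "a4 \<in> carrier_vec n4"
          "a5 \<in> carrier_vec n4" using split[OF v] by blast
      have na: "- a3 \<in> carrier_vec n3" using a by simp
      show "(x, z) \<in> normal_relation n1 n2 n3 n4 r L11 D11 D21 L21"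
        unfolding x z v_eq assoc5 EBv[OF a zero_carrier_vec] ABv[OF a zero_carrier_vec]
        unfolding normal_relation_def using a(1,2,4,5) na by blast
    qed
    finally show ?thesis .
  qed
  have EB0: "EB *\<^sub>v (v @\<^sub>v w) = EB *\<^sub>v (v @\<^sub>v 0\<^sub>v c)" and AB0: "AB *\<^sub>v (v @\<^sub>v w) = AB *\<^sub>v (v @\<^sub>v 0\<^sub>v c)"
    if v: "v \<in> carrier_vec ?q" and w: "w \<in> carrier_vec c" for v w
  proof -
    obtain a1 a2 a3 a4 a5 where v_eq: "v = a1 @\<^sub>v a2 @\<^sub>v a3 @\<^sub>v a4 @\<^sub>v a5"
      and a: "a1 \<in> carrier_vec n1" "a2 \<in> carrier_vec n2" "a3 \<in> carrier_vec n3" "a4 \<in> carrier_vec n4"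
        "a5 \<in> carrier_vec n4" using split[OF v] by blast
    show "EB *\<^sub>v (v @\<^sub>v w) = EB *\<^sub>v (v @\<^sub>v 0\<^sub>v c)" "AB *\<^sub>v (v @\<^sub>v w) = AB *\<^sub>v (v @\<^sub>v 0\<^sub>v c)"
      unfolding v_eq assoc5 EBv[OF a w] EBv[OF a zero_carrier_vec] ABv[OF a w] ABv[OF a zero_carrier_vec]
      by (rule refl)+
  qed
  have m_assoc: "?m = ?q + c" by simp
  have EBc: "EB \<in> carrier_mat n (?q + c)" and ABc: "AB \<in> carrier_mat n (?q + c)"
    using eb(1) ab(1) unfolding m_assoc by blast+
  \<comment> \<open>All parameters except \<open>a1\<close> can be read off from the blocks; for
    \<open>a1\<close> both \<open>L11 *\<^sub>v a1\<close> and \<open>D11 *\<^sub>v a1\<close>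
    vanish, and the regularity condition \<open>inj\<close> applies.\<close>
  have EBinj: "v = 0\<^sub>v ?q" if v: "v \<in> carrier_vec ?q" and z: "EB *\<^sub>v (v @\<^sub>v 0\<^sub>v c) = 0\<^sub>v n" "AB *\<^sub>v (v @\<^sub>v 0\<^sub>v c) = 0\<^sub>v n" for v
  proof -
    obtain a1 a2 a3 a4 a5 where v_eq: "v = a1 @\<^sub>v a2 @\<^sub>v a3 @\<^sub>v a4 @\<^sub>v a5"
      and a: "a1 \<in> carrier_vec n1" "a2 \<in> carrier_vec n2" "a3 \<in> carrier_vec n3" "a4 \<in> carrier_vec n4"
        "a5 \<in> carrier_vec n4" using split[OF v] by blast
    have m: "L11 *\<^sub>v a1 \<in> carrier_vec n1" "D11 *\<^sub>v a1 \<in> carrier_vec n1" "D21 *\<^sub>v a1 \<in> carrier_vec n2"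
      "L21 *\<^sub>v a1 \<in> carrier_vec n3" "- a3 \<in> carrier_vec n3"
      using dims a by (auto intro: mult_mat_vec_carrier)
    have "L11 *\<^sub>v a1 = 0\<^sub>v n1 \<and> a2 = 0\<^sub>v n2 \<and> a4 = 0\<^sub>v n4"
      using z(1) unfolding v_eq assoc5 EBv[OF a zero_carrier_vec] n_eq append_vec_eq_zero_iff[OF m(1)]
        append_vec_eq_zero_iff[OF a(2)] append_vec_eq_zero_iff[OF m(4)] append_vec_eq_zero_iff[OF a(4)] by blast
    moreover have z2: "D11 *\<^sub>v a1 = 0\<^sub>v n1 \<and> - a3 = 0\<^sub>v n3 \<and> a5 = 0\<^sub>v n4"
      using z(2) unfolding v_eq assoc5 ABv[OF a zero_carrier_vec] n_eq append_vec_eq_zero_iff[OF m(2)]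
        append_vec_eq_zero_iff[OF m(3)] append_vec_eq_zero_iff[OF m(5)] append_vec_eq_zero_iff[OF a(5)] by blast
    moreover have "a3 = - (- a3)" by (intro eq_vecI) auto
    then have "a3 = 0\<^sub>v n3" using z2 by (metis uminus_zero_vec)
    moreover have "a1 = 0\<^sub>v n1" using inj[OF a(1)] calculation by simp
    ultimately show "v = 0\<^sub>v ?q" unfolding v_eq by simp
  qed
  \<comment> \<open>\<open>J\<close> appends \<open>c\<close> zero coordinates and thereby restricts
    \<open>EB\<close> and \<open>AB\<close> to their first five block columns.\<close>
  define J where "J = ?I ?q @\<^sub>r ?O c ?q"
  have J: "J \<in> carrier_mat (?q + c) ?q" unfolding J_def by (intro carrier_append_rows one_carrier_mat zero_carrier_mat)
  have Jv: "J *\<^sub>v v = v @\<^sub>v 0\<^sub>v c" if v: "v \<in> carrier_vec ?q" for v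
    unfolding J_def append_rows_mult_vec[OF one_carrier_mat zero_carrier_mat v] zero_mult_mat_vec[OF v] using v by simp
  note EBJ = mult_carrier_mat[OF EBc J] and ABJ = mult_carrier_mat[OF ABc J]
  \<comment> \<open>Stacking the two equations makes one factorization deliver a single
    \<open>T1\<close> that works for \<open>E1\<close> and \<open>A1\<close> simultaneously.\<close>
  obtain T1 where T1: "T1 \<in> carrier_mat m ?q" and T1_eq: "(EB * J) @\<^sub>r (AB * J) = (E1 @\<^sub>r A1) * T1"
  proof (rule mat_factorization[OF carrier_append_rows[OF EBJ ABJ] carrier_append_rows[OF E1 A1]])
    fix v :: "'k vec" assume v: "v \<in> carrier_vec ?q"
    have "(EB *\<^sub>v (v @\<^sub>v 0\<^sub>v c), AB *\<^sub>v (v @\<^sub>v 0\<^sub>v c)) \<in> {(E1 *\<^sub>v t, A1 *\<^sub>v t) | t. t \<in> carrier_vec m}"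
      unfolding ran_eq using v by blast
    then obtain t where t: "t \<in> carrier_vec m" "EB *\<^sub>v (v @\<^sub>v 0\<^sub>v c) = E1 *\<^sub>v t" "AB *\<^sub>v (v @\<^sub>v 0\<^sub>v c) = A1 *\<^sub>v t"
      by blast
    have "((EB * J) @\<^sub>r (AB * J)) *\<^sub>v v = (E1 @\<^sub>r A1) *\<^sub>v t"
      unfolding append_rows_mult_vec[OF EBJ ABJ v] append_rows_mult_vec[OF E1 A1 t(1)]
        assoc_mult_mat_vec[OF EBc J v] assoc_mult_mat_vec[OF ABc J v] Jv[OF v] t(2,3) ..
    then show "((EB * J) @\<^sub>r (AB * J)) *\<^sub>v v \<in> (\<lambda>w. (E1 @\<^sub>r A1) *\<^sub>v w) ` carrier_vec m"
      using t(1) by (rule image_eqI)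
  qed
  have T1v: "E1 *\<^sub>v (T1 *\<^sub>v v) = EB *\<^sub>v (v @\<^sub>v 0\<^sub>v c) \<and> A1 *\<^sub>v (T1 *\<^sub>v v) = AB *\<^sub>v (v @\<^sub>v 0\<^sub>v c)"
    if v: "v \<in> carrier_vec ?q" for v
  proof -
    have T1c: "T1 *\<^sub>v v \<in> carrier_vec m" by (rule mult_mat_vec_carrier[OF T1 v])
    have c: "E1 *\<^sub>v (T1 *\<^sub>v v) \<in> carrier_vec n" "EB *\<^sub>v (v @\<^sub>v 0\<^sub>v c) \<in> carrier_vec n"
      using mult_mat_vec_carrier[OF E1 T1c] mult_mat_vec_carrier[OF EBc mult_mat_vec_carrier[OF J v]] Jv[OF v] by auto
    have "((EB * J) @\<^sub>r (AB * J)) *\<^sub>v v = (E1 @\<^sub>r A1) *\<^sub>v (T1 *\<^sub>v v)"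
      unfolding T1_eq by (rule assoc_mult_mat_vec[OF carrier_append_rows[OF E1 A1] T1 v])
    then show ?thesis
      unfolding append_rows_mult_vec[OF EBJ ABJ v] append_rows_mult_vec[OF E1 A1 T1c]
        assoc_mult_mat_vec[OF EBc J v] assoc_mult_mat_vec[OF ABc J v] append_vec_eq[OF c(2,1)] Jv[OF v] by simp
  qed
  define T where "T = hcat2 T1 T2"
  have T: "T \<in> carrier_mat m (?q + c)" unfolding T_def by (rule hcat2_carrier[OF T1 T2(1)])
  have Tv: "T *\<^sub>v (v @\<^sub>v w) = T1 *\<^sub>v v + T2 *\<^sub>v w" if "v \<in> carrier_vec ?q" "w \<in> carrier_vec c" for v w
    unfolding T_def by (rule hcat2_mult_vec[OF T1 T2(1) that])
  have T12: "T1 *\<^sub>v v \<in> carrier_vec m" "T2 *\<^sub>v w \<in> carrier_vec m" if "v \<in> carrier_vec ?q" "w \<in> carrier_vec c" for v w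
    using mult_mat_vec_carrier[OF T1 that(1)] mult_mat_vec_carrier[OF T2(1) that(2)] by auto
  have T2z: "E1 *\<^sub>v (T2 *\<^sub>v w) = 0\<^sub>v n \<and> A1 *\<^sub>v (T2 *\<^sub>v w) = 0\<^sub>v n" if "w \<in> carrier_vec c" for w
    using T2U that by blast
  have ET: "E1 *\<^sub>v (T *\<^sub>v (v @\<^sub>v w)) = EB *\<^sub>v (v @\<^sub>v w)" "A1 *\<^sub>v (T *\<^sub>v (v @\<^sub>v w)) = AB *\<^sub>v (v @\<^sub>v w)"
    if v: "v \<in> carrier_vec ?q" and w: "w \<in> carrier_vec c" for v w
  proof -
    have "v @\<^sub>v 0\<^sub>v c \<in> carrier_vec (?q + c)" by (intro append_carrier_vec v zero_carrier_vec)
    then have c: "EB *\<^sub>v (v @\<^sub>v 0\<^sub>v c) \<in> carrier_vec n" "AB *\<^sub>v (v @\<^sub>v 0\<^sub>v c) \<in> carrier_vec n"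
      using mult_mat_vec_carrier[OF EBc] mult_mat_vec_carrier[OF ABc] by blast+
    show "E1 *\<^sub>v (T *\<^sub>v (v @\<^sub>v w)) = EB *\<^sub>v (v @\<^sub>v w)" "A1 *\<^sub>v (T *\<^sub>v (v @\<^sub>v w)) = AB *\<^sub>v (v @\<^sub>v w)"
      unfolding Tv[OF v w] mult_add_distrib_mat_vec[OF E1 T12[OF v w]] mult_add_distrib_mat_vec[OF A1 T12[OF v w]]
        EB0[OF v w] AB0[OF v w]
      using T1v[OF v] T2z[OF w] c by simp_all
  qed
  have T_inj: "inj_mat T"
  proof (rule inj_matI[OF T])
    fix u assume "u \<in> carrier_vec (?q + c)" and eq: "T *\<^sub>v u = 0\<^sub>v m"
    then obtain v w where u: "u = v @\<^sub>v w" and v: "v \<in> carrier_vec ?q" and w: "w \<in> carrier_vec c"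
      using carrier_vec_appendE by blast
    have "EB *\<^sub>v (v @\<^sub>v 0\<^sub>v c) = 0\<^sub>v n" "AB *\<^sub>v (v @\<^sub>v 0\<^sub>v c) = 0\<^sub>v n"
      using ET[OF v w] EB0[OF v w] AB0[OF v w] eq mult_mat_zero_vec[OF E1] mult_mat_zero_vec[OF A1]
      unfolding u by simp_all
    then have v0: "v = 0\<^sub>v ?q" by (rule EBinj[OF v])
    have "T1 *\<^sub>v v = 0\<^sub>v m" unfolding v0 by (rule mult_mat_zero_vec[OF T1])
    then have "T2 *\<^sub>v w = 0\<^sub>v m" using eq Tv[OF v w] T12(2)[OF v w] unfolding u by simp
    then have "w = 0\<^sub>v c" by (rule inj_matD[OF T2(2,1) w])
    then show "u = 0\<^sub>v (?q + c)" unfolding u v0 by simp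
  qed
  \<comment> \<open>\<open>T1\<close> reproduces the images of \<open>t\<close> under
    \<open>E1\<close> and \<open>A1\<close>; the difference lies in the common kernel, which is the
    image of \<open>T2\<close>.\<close>
  have T_surj: "\<exists>u\<in>carrier_vec (?q + c). T *\<^sub>v u = t" if t: "t \<in> carrier_vec m" for t
  proof -
    have "(E1 *\<^sub>v t, A1 *\<^sub>v t) \<in> {(EB *\<^sub>v (v @\<^sub>v 0\<^sub>v c), AB *\<^sub>v (v @\<^sub>v 0\<^sub>v c)) | v. v \<in> carrier_vec ?q}"
      unfolding ran_eq[symmetric] using t by blast
    then obtain v where v: "v \<in> carrier_vec ?q" and eqs: "E1 *\<^sub>v t = EB *\<^sub>v (v @\<^sub>v 0\<^sub>v c)" "A1 *\<^sub>v t = AB *\<^sub>v (v @\<^sub>v 0\<^sub>v c)" by blast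
    have T1c: "T1 *\<^sub>v v \<in> carrier_vec m" by (rule mult_mat_vec_carrier[OF T1 v])
    have ec: "E1 *\<^sub>v t \<in> carrier_vec n" "A1 *\<^sub>v t \<in> carrier_vec n"
      using mult_mat_vec_carrier[OF E1 t] mult_mat_vec_carrier[OF A1 t] by auto
    have "t - T1 *\<^sub>v v \<in> ?U"
      using mult_minus_distrib_mat_vec[OF E1 t T1c] mult_minus_distrib_mat_vec[OF A1 t T1c] T1v[OF v] eqs ec t T1c
      by simp
    then obtain w where w: "w \<in> carrier_vec c" "t - T1 *\<^sub>v v = T2 *\<^sub>v w" unfolding T2U by blast
    have "T *\<^sub>v (v @\<^sub>v w) = t" unfolding Tv[OF v w(1)] w(2)[symmetric] by (rule vec_cancel(3)[OF T1c t])
    moreover have "v @\<^sub>v w \<in> carrier_vec (?q + c)" by (intro append_carrier_vec v w(1))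
    ultimately show ?thesis by blast
  qed
  have m_eq: "m = ?q + c" and T_invertible: "invertible_mat T"
    using bij_mat_square[OF T T_inj T_surj] by blast+
  have Tm: "T \<in> carrier_mat m m" using T unfolding m_eq[symmetric] .
  have eqs: "E1 * T = EB" "A1 * T = AB"
  proof -
    have "E1 *\<^sub>v (T *\<^sub>v u) = EB *\<^sub>v u \<and> A1 *\<^sub>v (T *\<^sub>v u) = AB *\<^sub>v u" if "u \<in> carrier_vec (?q + c)" for u
      using that ET by (metis carrier_vec_appendE)
    then show "E1 * T = EB" "A1 * T = AB"
      using assoc_mult_mat_vec[OF E1 T] assoc_mult_mat_vec[OF A1 T]
      by (intro eq_mat_mult_vecI[OF mult_carrier_mat[OF E1 T] EBc] eq_mat_mult_vecI[OF mult_carrier_mat[OF A1 T] ABc];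
          simp)+
  qed
  have ndims: "- D21 \<in> carrier_mat n2 n1" using dims by simp
  have "const_mat S * pencil E A * const_mat T = pencil EB AB"
    unfolding pencil_mult[OF E A S(1) Tm] E1_def[symmetric] A1_def[symmetric] eqs ..
  also have "\<dots> = block5x6 n1 n2 n3 n4 r c (pencil L11 D11) (const_mat (- D21))
      (s_times (1\<^sub>m n2)) (s_times L21) (1\<^sub>m n3) (s_times (1\<^sub>m n4)) (- 1\<^sub>m n4)"
    unfolding EB_def AB_def
      pencil_block5x6[OF dims(1) zero_carrier_mat[of n2 n1] one_carrier_mat[of n2] dims(4)
        zero_carrier_mat[of n3 n3] one_carrier_mat[of n4] zero_carrier_mat[of n4 n4]
        dims(2) D21'(1) zero_carrier_mat[of n2 n2] zero_carrier_mat[of n3 n1] D21'(2)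
        zero_carrier_mat[of n4 n4] one_carrier_mat[of n4]]
      pencil_zero_left[OF ndims] pencil_zero_right[OF dims(4)] one_block_pencils ..
  finally have eq: "const_mat S * pencil E A * const_mat T = \<dots>" .
  have "mat_kernel L11 \<subseteq> mat_kernel L21"
    using ker dims by (auto simp: mat_kernel_def)
  then show thesis
    using that[OF S Tm T_invertible dims(1,2) ndims dims(4) eq pos regular_pencilI[OF dims(1,2) inj]] by blast
qed

end

section \<open>Complexification and positive real pencils\<close>

interpretation map_poly_to_complex: map_poly_comm_ring_hom "to_complex :: 'k :: real_or_complex \<Rightarrow> complex" ..

text \<open>Also meaningful when the scalars are already complex. The representation is then not
  unique, which explains the side conditions on the range of \<open>to_complex\<close> in what
  follows.\<close>

definition cvec :: "'k :: real_or_complex vec \<Rightarrow> 'k vec \<Rightarrow> complex vec" where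
  "cvec a b = map_vec to_complex a + \<i> \<cdot>\<^sub>v map_vec to_complex b"

abbreviation cmat :: "'k :: real_or_complex mat \<Rightarrow> complex mat" where
  "cmat \<equiv> map_mat to_complex"

lemma cvec_carrier [simp]: "a \<in> carrier_vec k \<Longrightarrow> b \<in> carrier_vec k \<Longrightarrow> cvec a b \<in> carrier_vec k"
  by (simp add: cvec_def)

lemma cvec_index [simp]: "i < dim_vec a \<Longrightarrow> i < dim_vec b \<Longrightarrow> cvec a b $ i = to_complex (a $ i) + \<i> * to_complex (b $ i)"
  by (simp add: cvec_def)

lemma cvec_dim [simp]: "dim_vec (cvec a b) = dim_vec b"
  by (simp add: cvec_def)

lemma to_complex_id [simp]: "to_complex (z :: complex) = z"
  by (simp add: to_complex_complex_def)

text \<open>For complex scalars the whole vector is put into the first part; the final alternative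
  hands this normalization on to the users of the lemma.\<close>

lemma cvec_exists:
  fixes v :: "complex vec"
  assumes "v \<in> carrier_vec k"
  obtains a b :: "'k :: real_or_complex vec" where "a \<in> carrier_vec k" "b \<in> carrier_vec k" "v = cvec a b"
    "b = 0\<^sub>v k \<or> range (to_complex :: 'k \<Rightarrow> complex) = \<real>"
proof (cases "range (to_complex :: 'k \<Rightarrow> complex) = \<real>")
  case True
  have "\<exists>t :: 'k. to_complex t = complex_of_real r" for r by (rule real_in_range_to_complex)
  then obtain f :: "real \<Rightarrow> 'k" where f: "\<And>r. to_complex (f r) = complex_of_real r" by metis
  let ?a = "vec k (\<lambda>i. f (Re (v $ i)))" and ?b = "vec k (\<lambda>i. f (Im (v $ i)))"
  have "v = cvec ?a ?b" using assms by (intro eq_vecI) (auto simp: f complex_eq_iff)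
  then show ?thesis using that[of ?a ?b] True by simp
next
  case False
  then have "surj (to_complex :: 'k \<Rightarrow> complex)" using range_to_complex by blast
  then obtain f :: "complex \<Rightarrow> 'k" where f: "\<And>z. to_complex (f z) = z" by (metis surjD)
  let ?a = "vec k (\<lambda>i. f (v $ i))"
  have "v = cvec ?a (0\<^sub>v k)" using assms by (intro eq_vecI) (auto simp: f)
  then show ?thesis using that[of ?a "0\<^sub>v k"] by simp
qed

lemma real_cip:
  assumes "range (to_complex :: 'k :: real_or_complex \<Rightarrow> complex) = \<real>"
  shows "Im (cip (x :: 'k vec) y) = 0"
proof -
  have "cip x y \<in> \<real>" unfolding cip_def using assms by blast
  then show ?thesis by (simp add: complex_is_Real_iff)
qed

text \<open>The factor of \<i> collects the mixed terms. Sign conditions pass to the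
  complexification once this factor, or at least its contribution to the real part, is seen to
  vanish.\<close>

lemma cip_cvec:
  assumes "a \<in> carrier_vec k" "b \<in> carrier_vec k" "c \<in> carrier_vec k" "d \<in> carrier_vec k"
  shows "cip (cvec a b) (cvec c d) = cip a c + cip b d + \<i> * (cip b c - cip a d)"
proof -
  have "cip (cvec a b) (cvec c d) = (\<Sum>i<k. (to_complex (a $ i) + \<i> * to_complex (b $ i)) *
      (cnj (to_complex (c $ i)) - \<i> * cnj (to_complex (d $ i))))"
    using assms by (simp add: cip_sum[of _ k])
  also have "\<dots> = cip a c + cip b d + \<i> * (cip b c - cip a d)"
    using assms
    by (simp add: cip_sum[of _ k] algebra_simps sum.distrib sum_subtractf sum_distrib_left flip: power2_eq_square)
  finally show ?thesis .
qed

lemma cmat_cvec: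
  assumes "M \<in> carrier_mat p k" "a \<in> carrier_vec k" "b \<in> carrier_vec k"
  shows "cmat M *\<^sub>v cvec a b = cvec (M *\<^sub>v a) (M *\<^sub>v b)"
  using assms
  by (intro eq_vecI) (auto simp: scalar_prod_def to_complex.hom_sum to_complex_mult sum_distrib_left
      algebra_simps sum.distrib)

lemma cvec_add:
  assumes "a \<in> carrier_vec k" "b \<in> carrier_vec k" "c \<in> carrier_vec k" "d \<in> carrier_vec k"
  shows "cvec a b + cvec c d = cvec (a + c) (b + d)"
  using assms by (intro eq_vecI) (auto simp: to_complex_add algebra_simps)

lemma cvec_smult:
  assumes "a \<in> carrier_vec k" "b \<in> carrier_vec k"
  shows "(to_complex s + \<i> * to_complex t) \<cdot>\<^sub>v cvec a b = cvec (s \<cdot>\<^sub>v a - t \<cdot>\<^sub>v b) (s \<cdot>\<^sub>v b + t \<cdot>\<^sub>v a)"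
  using assms by (intro eq_vecI) (auto simp: to_complex_add to_complex_mult to_complex.hom_minus algebra_simps)

lemma cvec_zero [simp]: "cvec (0\<^sub>v k) (0\<^sub>v k) = 0\<^sub>v k"
  by (intro eq_vecI) auto

lemma cvec_inject:
  fixes a b :: "'k :: real_or_complex vec"
  assumes c: "a \<in> carrier_vec k" "b \<in> carrier_vec k" "c \<in> carrier_vec k" "d \<in> carrier_vec k"
    and eq: "cvec a b = cvec c d"
    and r: "range (to_complex :: 'k \<Rightarrow> complex) = \<real> \<or> b = 0\<^sub>v k \<and> d = 0\<^sub>v k"
  shows "a = c" "b = d"
proof -
  have "a $ i = c $ i \<and> b $ i = d $ i" if i: "i < k" for i
  proof -
    have e: "to_complex (a $ i) + \<i> * to_complex (b $ i) = to_complex (c $ i) + \<i> * to_complex (d $ i)"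
      using arg_cong[OF eq, of "\<lambda>v. v $ i"] c i by simp
    show ?thesis
    proof (cases "range (to_complex :: 'k \<Rightarrow> complex) = \<real>")
      case True
      have im: "Im (to_complex (x :: 'k)) = 0" for x
      proof -
        have "to_complex x \<in> \<real>" using True by blast
        then show ?thesis by (simp add: complex_is_Real_iff)
      qed
      have "to_complex (a $ i) = to_complex (c $ i)" "to_complex (b $ i) = to_complex (d $ i)"
        using e im by (simp_all add: complex_eq_iff)
      then show ?thesis by simp
    next
      case False
      then show ?thesis using e r i by simp
    qed
  qed
  then show "a = c" "b = d" using c by (auto intro!: eq_vecI)
qed

section \<open>Evaluation of rational functions and positive realness\<close>

lemma poly_at_mult: "poly_at (p * q) z = poly_at p z * poly_at q z"
  by (simp add: poly_at_def map_poly_to_complex.hom_mult)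

lemma poly_at_one [simp]: "poly_at 1 z = 1"
  by (simp add: poly_at_def)

lemma poly_at_linear: "poly_at [:a, b:] z = to_complex a + z * to_complex b"
  by (simp add: poly_at_def to_complex.map_poly_pCons_hom)

lemma to_fract_no_pole: "\<not> has_pole (to_fract p) z"
  unfolding has_pole_def to_fract_def using poly_at_one by (metis one_neq_zero)

text \<open>\<open>fract_at\<close> is a definite description, so the value must be independent of
  the fraction: one that equals \<open>p\<close> and has denominator \<open>q\<close> has numerator
  \<open>p * q\<close>.\<close>

lemma fract_at_to_fract: "fract_at (to_fract p) z = poly_at p z"
  unfolding fract_at_def
proof (rule the_equality)
  show "\<exists>p' q. to_fract p = Fract p' q \<and> poly_at q z \<noteq> 0 \<and> poly_at p z = poly_at p' z / poly_at q z"
    by (intro exI[of _ p] exI[of _ 1]) (simp add: to_fract_def)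
next
  fix v assume "\<exists>p' q. to_fract p = Fract p' q \<and> poly_at q z \<noteq> 0 \<and> v = poly_at p' z / poly_at q z"
  then obtain p' q where pq: "to_fract p = Fract p' q" "poly_at q z \<noteq> 0" "v = poly_at p' z / poly_at q z" by blast
  then have "q \<noteq> 0" by (auto simp: poly_at_def)
  then have "p' = p * q" using pq(1) by (simp add: to_fract_def eq_fract)
  then show "v = poly_at p z" using pq by (simp add: poly_at_mult)
qed

text \<open>Polynomial entries have no poles. On a complex vector the forms reduce to those on its
  two parts: for real scalars the mixed terms of \<open>L\<close> cancel by symmetry and those of
  \<open>D\<close> are imaginary, while for complex scalars the second part is zero.\<close>

lemma positive_realI:
  fixes L D :: "'k :: real_or_complex mat"
  assumes psd: "psd_mat k L" and dissip: "dissipative_mat k D"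
  shows "positive_real (map_mat to_fract (pencil L D))"
proof -
  have L: "L \<in> carrier_mat k k" and D: "D \<in> carrier_mat k k"
    and L_nonneg: "\<And>c. c \<in> carrier_vec k \<Longrightarrow> cip (L *\<^sub>v c) c \<ge> 0"
    and L_sym: "\<And>c d. c \<in> carrier_vec k \<Longrightarrow> d \<in> carrier_vec k \<Longrightarrow> cip (L *\<^sub>v c) d = cip c (L *\<^sub>v d)"
    and D_dissip: "\<And>c. c \<in> carrier_vec k \<Longrightarrow> Re (cip (D *\<^sub>v c) c) \<le> 0"
    using psd dissip by (auto simp: psd_mat_def dissipative_mat_def)
  have car: "L *\<^sub>v c \<in> carrier_vec k" "D *\<^sub>v c \<in> carrier_vec k" if "c \<in> carrier_vec k" for c
    using L D that by auto
  have form: "cip (cmat L *\<^sub>v v) v \<ge> 0 \<and> Re (cip (cmat D *\<^sub>v v) v) \<le> 0" if v: "v \<in> carrier_vec k" for v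
  proof -
    obtain a b :: "'k vec" where ab: "a \<in> carrier_vec k" "b \<in> carrier_vec k" "v = cvec a b"
      and r: "b = 0\<^sub>v k \<or> range (to_complex :: 'k \<Rightarrow> complex) = \<real>" by (rule cvec_exists[OF v])
    have eL: "cip (cmat L *\<^sub>v v) v = cip (L *\<^sub>v a) a + cip (L *\<^sub>v b) b + \<i> * (cip (L *\<^sub>v b) a - cip (L *\<^sub>v a) b)"
      unfolding ab(3) cmat_cvec[OF L ab(1,2)] by (rule cip_cvec[OF car(1)[OF ab(1)] car(1)[OF ab(2)] ab(1,2)])
    have eD: "cip (cmat D *\<^sub>v v) v = cip (D *\<^sub>v a) a + cip (D *\<^sub>v b) b + \<i> * (cip (D *\<^sub>v b) a - cip (D *\<^sub>v a) b)"
      unfolding ab(3) cmat_cvec[OF D ab(1,2)] by (rule cip_cvec[OF car(2)[OF ab(1)] car(2)[OF ab(2)] ab(1,2)])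
    have "cip (L *\<^sub>v b) a - cip (L *\<^sub>v a) b = 0 \<and> Re (\<i> * (cip (D *\<^sub>v b) a - cip (D *\<^sub>v a) b)) = 0"
      using r
    proof
      assume b: "b = 0\<^sub>v k"
      show ?thesis using ab(1) car[OF ab(1)] by (simp add: b mult_mat_zero_vec[OF L] mult_mat_zero_vec[OF D])
    next
      assume real: "range (to_complex :: 'k \<Rightarrow> complex) = \<real>"
      have "cip (L *\<^sub>v b) a = cnj (cip (L *\<^sub>v a) b)"
        using L_sym[OF ab(2,1)] cip_cnj[OF car(1)[OF ab(1)] ab(2)] by simp
      then show ?thesis using real_cip[OF real] by (simp add: complex_eq_iff)
    qed
    then show ?thesis
      unfolding eL eD using L_nonneg[OF ab(1)] L_nonneg[OF ab(2)] D_dissip[OF ab(1)] D_dissip[OF ab(2)]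
      by (simp del: times_complex.sel)
  qed
  have "positive_semidefinite (Gz + mat_adjoint Gz)"
    if z: "Re z > 0" and Gz: "Gz = map_mat (\<lambda>r. fract_at r z) (map_mat to_fract (pencil L D))" for z Gz
  proof -
    have G: "Gz \<in> carrier_mat k k" unfolding Gz using L D by simp
    have GA: "mat_adjoint Gz \<in> carrier_mat k k" using G by simp
    have Gz_eq: "Gz = z \<cdot>\<^sub>m cmat L - cmat D"
      unfolding Gz using L D
      by (intro eq_matI) (auto simp: fract_at_to_fract poly_at_linear to_complex.hom_uminus)
    have "((Gz + mat_adjoint Gz) *\<^sub>v v) \<bullet>c v \<ge> 0" if v: "v \<in> carrier_vec k" for v
    proof -
      have cL: "cmat L \<in> carrier_mat k k" and cD: "cmat D \<in> carrier_mat k k" using L D by auto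
      have zL: "z \<cdot>\<^sub>m cmat L \<in> carrier_mat k k" using cL by simp
      have Lv: "cmat L *\<^sub>v v \<in> carrier_vec k" and Dv: "cmat D *\<^sub>v v \<in> carrier_vec k"
        using cL cD v by auto
      have zLv: "(z \<cdot>\<^sub>m cmat L) *\<^sub>v v = z \<cdot>\<^sub>v (cmat L *\<^sub>v v)"
        using cL v by (intro eq_vecI) (auto simp: scalar_prod_def sum_distrib_left mult_ac)
      have Gv: "Gz *\<^sub>v v = z \<cdot>\<^sub>v (cmat L *\<^sub>v v) - cmat D *\<^sub>v v"
        unfolding Gz_eq minus_mult_distrib_mat_vec[OF zL cD v] zLv ..
      have GAv: "Gz *\<^sub>v v \<in> carrier_vec k" "mat_adjoint Gz *\<^sub>v v \<in> carrier_vec k"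
        by (rule mult_mat_vec_carrier[OF G v] mult_mat_vec_carrier[OF GA v])+
      have "cip ((Gz + mat_adjoint Gz) *\<^sub>v v) v = cip (Gz *\<^sub>v v) v + cip v (Gz *\<^sub>v v)"
        unfolding add_mult_distrib_mat_vec[OF G GA v] cip_add_left[OF GAv v] cip_adjoint[OF G v v] ..
      also have "cip v (Gz *\<^sub>v v) = cnj (cip (Gz *\<^sub>v v) v)" using cip_cnj[OF GAv(1) v] by simp
      also have "cip (Gz *\<^sub>v v) v = z * cip (cmat L *\<^sub>v v) v - cip (cmat D *\<^sub>v v) v"
        unfolding Gv cip_minus_left[OF smult_carrier_vec[THEN iffD2, OF Lv] Dv v] cip_smult_left[OF Lv v] by simp
      finally have eq: "((Gz + mat_adjoint Gz) *\<^sub>v v) \<bullet>c v =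
          (z * cip (cmat L *\<^sub>v v) v - cip (cmat D *\<^sub>v v) v) + cnj (z * cip (cmat L *\<^sub>v v) v - cip (cmat D *\<^sub>v v) v)"
        by (simp add: cip_def)
      \<comment> \<open>The form of \<open>L\<close> is real and nonnegative, so only
        \<open>Re z\<close> enters. The expression to be estimated is a number plus its conjugate,
        that is, twice a real part.\<close>
      have "Re (z * cip (cmat L *\<^sub>v v) v) \<ge> 0"
        using form[OF v] z by (simp add: less_eq_complex_def)
      then show ?thesis unfolding eq complex_add_cnj using form[OF v] by (simp add: less_eq_complex_def)
    qed
    then show ?thesis unfolding positive_semidefinite_def using G GA by auto
  qed
  moreover have "\<not> has_pole r z" if "r \<in> elements_mat (map_mat to_fract (pencil L D))" for r z
    using that to_fract_no_pole by (auto simp: elements_mat_def)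
  ultimately show ?thesis
    unfolding positive_real_def using L D by (auto simp: Let_def)
qed

section \<open>Complexification of linear relations\<close>

definition complexification :: "('k :: real_or_complex vec) rel \<Rightarrow> complex vec rel" where
  "complexification M = {(cvec x1 x2, cvec y1 y2) | x1 x2 y1 y2. (x1, y1) \<in> M \<and> (x2, y2) \<in> M}"

lemma complexificationI: "(x1, y1) \<in> M \<Longrightarrow> (x2, y2) \<in> M \<Longrightarrow> (cvec x1 x2, cvec y1 y2) \<in> complexification M"
  by (auto simp: complexification_def)

text \<open>When the field is a copy of the complex numbers, the imaginary part is absorbed by the real part.\<close>

lemma complexificationE:
  fixes M :: "('k :: real_or_complex vec) rel"
  assumes M: "linear_relation n M" and xy: "(x, y) \<in> complexification M"
  obtains x1 x2 y1 y2 where "x = cvec x1 x2" "y = cvec y1 y2" "(x1, y1) \<in> M" "(x2, y2) \<in> M"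
    "range (to_complex :: 'k \<Rightarrow> complex) = \<real> \<or> x2 = 0\<^sub>v n \<and> y2 = 0\<^sub>v n"
proof -
  note MD = linear_relationD[OF M]
  obtain x1 x2 y1 y2 where e: "x = cvec x1 x2" "y = cvec y1 y2" "(x1, y1) \<in> M" "(x2, y2) \<in> M"
    using xy by (auto simp: complexification_def)
  show ?thesis
  proof (cases "range (to_complex :: 'k \<Rightarrow> complex) = \<real>")
    case True
    then show ?thesis using that e by blast
  next
    case False
    then have "surj (to_complex :: 'k \<Rightarrow> complex)" using range_to_complex by blast
    then obtain t :: 'k where t: "to_complex t = \<i>" by (metis surjD)
    have c: "x1 \<in> carrier_vec n" "y1 \<in> carrier_vec n" "x2 \<in> carrier_vec n" "y2 \<in> carrier_vec n"
      using MD(1,2)[OF e(3)] MD(1,2)[OF e(4)] by auto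
    have "x = cvec (x1 + t \<cdot>\<^sub>v x2) (0\<^sub>v n)" "y = cvec (y1 + t \<cdot>\<^sub>v y2) (0\<^sub>v n)"
      unfolding e(1,2) using c by (auto intro!: eq_vecI simp: to_complex_add to_complex_mult t)
    moreover have "(x1 + t \<cdot>\<^sub>v x2, y1 + t \<cdot>\<^sub>v y2) \<in> M" by (intro MD e)
    ultimately show ?thesis using that MD(3) by blast
  qed
qed

lemma linear_relation_complexification:
  fixes M :: "('k :: real_or_complex vec) rel"
  assumes M: "linear_relation n M" shows "linear_relation n (complexification M)"
proof (rule linear_relationI)
  note MD = linear_relationD[OF M]
  show "x \<in> carrier_vec n \<and> y \<in> carrier_vec n" if "(x, y) \<in> complexification M" for x y
    using that MD(1,2) by (auto simp: complexification_def)
  show "(0\<^sub>v n, 0\<^sub>v n) \<in> complexification M"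
    using complexificationI[OF MD(3) MD(3)] by simp
  show "(x + x', y + y') \<in> complexification M"
    if xy: "(x, y) \<in> complexification M" and xy': "(x', y') \<in> complexification M" for x y x' y'
  proof -
    obtain x1 x2 y1 y2 where e: "x = cvec x1 x2" "y = cvec y1 y2" "(x1, y1) \<in> M" "(x2, y2) \<in> M"
      by (rule complexificationE[OF M xy])
    obtain x1' x2' y1' y2' where e': "x' = cvec x1' x2'" "y' = cvec y1' y2'" "(x1', y1') \<in> M" "(x2', y2') \<in> M"
      by (rule complexificationE[OF M xy'])
    note c = MD(1,2)[OF e(3)] MD(1,2)[OF e(4)] MD(1,2)[OF e'(3)] MD(1,2)[OF e'(4)]
    show ?thesis
      unfolding e(1,2) e'(1,2) cvec_add[OF c(1,3,5,7)] cvec_add[OF c(2,4,6,8)]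
      by (intro complexificationI MD(4) e e')
  qed
  show "(z \<cdot>\<^sub>v x, z \<cdot>\<^sub>v y) \<in> complexification M" if xy: "(x, y) \<in> complexification M" for z x y
  proof -
    obtain x1 x2 y1 y2 where e: "x = cvec x1 x2" "y = cvec y1 y2" "(x1, y1) \<in> M" "(x2, y2) \<in> M"
      by (rule complexificationE[OF M xy])
    note c = MD(1,2)[OF e(3)] MD(1,2)[OF e(4)]
    obtain s t :: 'k where st: "to_complex s = complex_of_real (Re z)" "to_complex t = complex_of_real (Im z)"
      using real_in_range_to_complex by metis
    then have z: "z = to_complex s + \<i> * to_complex t" by (simp add: complex_eq mult.commute)
    show ?thesis
      unfolding e(1,2) z cvec_smult[OF c(1,3)] cvec_smult[OF c(2,4)]
      by (intro complexificationI linear_relation_diff[OF M] MD(4,5) e)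
  qed
qed

text \<open>The point is that the intermediate vectors match part by part. For real scalars a
  complex vector determines its two parts; for complex scalars both representations can be
  normalized to have second part zero.\<close>

lemma complexification_relcomp:
  fixes L D :: "('k :: real_or_complex vec) rel"
  assumes L: "linear_relation n L" and D: "linear_relation n D"
  shows "complexification (L O D) = complexification L O complexification D"
proof (intro equalityI subrelI)
  fix x z assume "(x, z) \<in> complexification (L O D)"
  then show "(x, z) \<in> complexification L O complexification D"
    unfolding complexification_def by blast
next
  fix x z assume "(x, z) \<in> complexification L O complexification D"
  then obtain y where xy: "(x, y) \<in> complexification L" and yz: "(y, z) \<in> complexification D" by blast
  obtain x1 x2 y1 y2 where e: "x = cvec x1 x2" "y = cvec y1 y2" "(x1, y1) \<in> L" "(x2, y2) \<in> L"
    "range (to_complex :: 'k \<Rightarrow> complex) = \<real> \<or> x2 = 0\<^sub>v n \<and> y2 = 0\<^sub>v n"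
    by (rule complexificationE[OF L xy])
  obtain v1 v2 z1 z2 where e': "y = cvec v1 v2" "z = cvec z1 z2" "(v1, z1) \<in> D" "(v2, z2) \<in> D"
    "range (to_complex :: 'k \<Rightarrow> complex) = \<real> \<or> v2 = 0\<^sub>v n \<and> z2 = 0\<^sub>v n"
    by (rule complexificationE[OF D yz])
  have "y1 = v1" "y2 = v2"
    using cvec_inject[of y1 n y2 v1 v2] e e' linear_relationD(2)[OF L] linear_relationD(1)[OF D] by blast+
  then show "(x, z) \<in> complexification (L O D)"
    unfolding e(1) e'(2) using e(3,4) e'(3,4) by (intro complexificationI) blast+
qed

lemma complexification_ran_stacked:
  fixes E A :: "'k :: real_or_complex mat"
  assumes E: "E \<in> carrier_mat n m" and A: "A \<in> carrier_mat n m"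
  shows "ran_stacked (cmat E) (cmat A) = complexification (ran_stacked E A)"
proof (intro equalityI subrelI)
  fix x z assume "(x, z) \<in> ran_stacked (cmat E) (cmat A)"
  then obtain t where t: "t \<in> carrier_vec m" "x = cmat E *\<^sub>v t" "z = cmat A *\<^sub>v t"
    using E by (auto simp: ran_stacked_def)
  obtain a b :: "'k vec" where ab: "a \<in> carrier_vec m" "b \<in> carrier_vec m" "t = cvec a b"
    by (rule cvec_exists[OF t(1)])
  show "(x, z) \<in> complexification (ran_stacked E A)"
    unfolding t(2,3) ab(3) cmat_cvec[OF E ab(1,2)] cmat_cvec[OF A ab(1,2)]
    using ab E by (intro complexificationI) (auto simp: ran_stacked_def)
next
  fix x z assume "(x, z) \<in> complexification (ran_stacked E A)"
  then obtain a b where ab: "a \<in> carrier_vec m" "b \<in> carrier_vec m"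
    and xz: "x = cvec (E *\<^sub>v a) (E *\<^sub>v b)" "z = cvec (A *\<^sub>v a) (A *\<^sub>v b)"
    using E by (auto simp: ran_stacked_def complexification_def)
  have "cvec a b \<in> carrier_vec (dim_col (cmat E))" using ab E by simp
  then show "(x, z) \<in> ran_stacked (cmat E) (cmat A)"
    unfolding ran_stacked_def xz cmat_cvec[OF E ab, symmetric] cmat_cvec[OF A ab, symmetric] by blast
qed

lemma to_complex_nonneg_iff: "0 \<le> x \<bullet>c y \<longleftrightarrow> 0 \<le> cip x y"
  using to_complex_le_iff[of 0 "x \<bullet>c y"] by (simp add: cip_def)

text \<open>For real scalars the two inner products are the real and the imaginary part of a single
  complex number, so tests against vectors with zero second part suffice for both.\<close>

lemma orth_cvec:
  fixes a b :: "'k :: real_or_complex vec"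
  assumes U: "U \<subseteq> carrier_vec n" and ab: "a \<in> carrier_vec n" "b \<in> carrier_vec n"
    and r: "b = 0\<^sub>v n \<or> range (to_complex :: 'k \<Rightarrow> complex) = \<real>"
    and z: "\<And>u. u \<in> U \<Longrightarrow> cip (cvec a b) (cvec u (0\<^sub>v n)) = 0"
  shows "a \<in> orth n U" "b \<in> orth n U"
proof -
  have "cip a u = 0 \<and> cip b u = 0" if u: "u \<in> U" for u
  proof -
    have uc: "u \<in> carrier_vec n" using u U by blast
    have eq: "cip a u + \<i> * cip b u = 0"
      using z[OF u] ab uc by (simp add: cip_cvec[OF ab uc zero_carrier_vec])
    from r show ?thesis
    proof
      assume "b = 0\<^sub>v n"
      then show ?thesis using eq uc by simp
    next
      assume real: "range (to_complex :: 'k \<Rightarrow> complex) = \<real>"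
      show ?thesis using eq real_cip[OF real, of a u] real_cip[OF real, of b u] by (simp add: complex_eq_iff)
    qed
  qed
  then show "a \<in> orth n U" "b \<in> orth n U" using ab by (simp_all add: orth_def)
qed

context dissipative_nonnegative
begin

text \<open>The mixed terms in the forms are harmless for the same reasons as for positive real
  pencils. The two orthogonality conditions transfer because both parts of an orthogonal vector are
  orthogonal over the given field; maximality of the complexified relations is never
  asserted.\<close>

lemma dissipative_nonnegative_complexification:
  "dissipative_nonnegative n (complexification L) (complexification D)"
proof
  note lL = linear_relation_complexification[OF linear_L] and lD = linear_relation_complexification[OF linear_D]
  have sym: "cip w x = cip v y" if vw: "(v, w) \<in> complexification L" and xy: "(x, y) \<in> complexification L" for v w x y
  proof -
    obtain v1 v2 w1 w2 where e: "v = cvec v1 v2" "w = cvec w1 w2" "(v1, w1) \<in> L" "(v2, w2) \<in> L"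
      by (rule complexificationE[OF linear_L vw])
    obtain x1 x2 y1 y2 where e': "x = cvec x1 x2" "y = cvec y1 y2" "(x1, y1) \<in> L" "(x2, y2) \<in> L"
      by (rule complexificationE[OF linear_L xy])
    note c = LD(1,2)[OF e(3)] LD(1,2)[OF e(4)] LD(1,2)[OF e'(3)] LD(1,2)[OF e'(4)]
    show ?thesis
      unfolding e(1,2) e'(1,2) cip_cvec[OF c(2,4,5,7)] cip_cvec[OF c(1,3,6,8)]
      using L_symmetric[OF e(3) e'(3)] L_symmetric[OF e(3) e'(4)] L_symmetric[OF e(4) e'(3)]
        L_symmetric[OF e(4) e'(4)] by simp
  qed
  have nonneg: "cip x y \<ge> 0" if xy: "(x, y) \<in> complexification L" for x y
  proof -
    obtain x1 x2 y1 y2 where e: "x = cvec x1 x2" "y = cvec y1 y2" "(x1, y1) \<in> L" "(x2, y2) \<in> L"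
      and r: "range (to_complex :: 'k \<Rightarrow> complex) = \<real> \<or> x2 = 0\<^sub>v n \<and> y2 = 0\<^sub>v n"
      by (rule complexificationE[OF linear_L xy])
    note c = LD(1,2)[OF e(3)] LD(1,2)[OF e(4)]
    have "cip x2 y1 = cip x1 y2"
      using r
    proof
      assume real: "range (to_complex :: 'k \<Rightarrow> complex) = \<real>"
      have "cip x2 y1 = cnj (cip y1 x2)" using cip_cnj[OF c(2,3)] by simp
      also have "\<dots> = cnj (cip x1 y2)" using L_symmetric[OF e(3,4)] by simp
      also have "\<dots> = cip x1 y2" using real_cip[OF real] by (simp add: complex_eq_iff)
      finally show ?thesis .
    qed (use c in auto)
    then show ?thesis
      unfolding e(1,2) cip_cvec[OF c(1,3,2,4)] using L_nonneg[OF e(3)] L_nonneg[OF e(4)] by simp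
  qed
  have "complexification L \<subseteq> adjoint_relation n (complexification L)"
  proof (rule subrelI)
    fix x y assume xy: "(x, y) \<in> complexification L"
    then show "(x, y) \<in> adjoint_relation n (complexification L)"
      using sym[OF _ xy] linear_relationD(1,2)[OF lL xy] unfolding adjoint_relation_def cip_def by auto
  qed
  then show "nonnegative n (complexification L)"
    unfolding nonnegative_def symmetric_relation_def to_complex_nonneg_iff using lL nonneg by blast
  have "Re (cip x y) \<le> 0" if xy: "(x, y) \<in> complexification D" for x y
  proof -
    obtain x1 x2 y1 y2 where e: "x = cvec x1 x2" "y = cvec y1 y2" "(x1, y1) \<in> D" "(x2, y2) \<in> D"
      and r: "range (to_complex :: 'k \<Rightarrow> complex) = \<real> \<or> x2 = 0\<^sub>v n \<and> y2 = 0\<^sub>v n"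
      by (rule complexificationE[OF linear_D xy])
    note c = DD(1,2)[OF e(3)] DD(1,2)[OF e(4)]
    have "Re (\<i> * (cip x2 y1 - cip x1 y2)) = 0"
      using r
    proof
      assume real: "range (to_complex :: 'k \<Rightarrow> complex) = \<real>"
      show ?thesis using real_cip[OF real, of x2 y1] real_cip[OF real, of x1 y2] by simp
    qed (use c in auto)
    then show ?thesis
      unfolding e(1,2) cip_cvec[OF c(1,3,2,4)] using D_dissip[OF e(3)] D_dissip[OF e(4)]
      by (simp del: times_complex.sel)
  qed
  then show "dissipative n (complexification D)"
    unfolding dissipative_def cip_def[symmetric] using lD by blast
  fix x assume x: "x \<in> orth n (Range (complexification L))"
  then have xc: "x \<in> carrier_vec n" by (simp add: orth_def)
  obtain a b :: "'k vec" where ab: "a \<in> carrier_vec n" "b \<in> carrier_vec n" "x = cvec a b"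
    "b = 0\<^sub>v n \<or> range (to_complex :: 'k \<Rightarrow> complex) = \<real>" by (rule cvec_exists[OF xc])
  have "cip (cvec a b) (cvec u (0\<^sub>v n)) = 0" if u: "u \<in> Range L" for u
  proof -
    obtain v where "(v, u) \<in> L" using u by blast
    then have "cvec u (0\<^sub>v n) \<in> Range (complexification L)"
      using complexificationI[OF _ LD(3)] by blast
    then show ?thesis using x ab(3) by (simp add: orth_def)
  qed
  then have "a \<in> orth n (Range L)" "b \<in> orth n (Range L)"
    using orth_cvec[OF subspace_vecD(1)[OF linear_relation_Range[OF linear_L]] ab(1,2,4)] by blast+
  then show "(x, 0\<^sub>v n) \<in> complexification L"
    using complexificationI[OF orth_Range_L orth_Range_L, of a b] ab(3) by simp
next
  fix x assume x: "x \<in> orth n (Domain (complexification D))"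
  then have xc: "x \<in> carrier_vec n" by (simp add: orth_def)
  obtain a b :: "'k vec" where ab: "a \<in> carrier_vec n" "b \<in> carrier_vec n" "x = cvec a b"
    "b = 0\<^sub>v n \<or> range (to_complex :: 'k \<Rightarrow> complex) = \<real>" by (rule cvec_exists[OF xc])
  have "cip (cvec a b) (cvec u (0\<^sub>v n)) = 0" if u: "u \<in> Domain D" for u
  proof -
    obtain v where "(u, v) \<in> D" using u by blast
    then have "cvec u (0\<^sub>v n) \<in> Domain (complexification D)"
      using complexificationI[OF _ DD(3)] by blast
    then show ?thesis using x ab(3) by (simp add: orth_def)
  qed
  then have "a \<in> orth n (Domain D)" "b \<in> orth n (Domain D)"
    using orth_cvec[OF subspace_vecD(1)[OF linear_relation_Domain[OF linear_D]] ab(1,2,4)] by blast+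
  then show "(0\<^sub>v n, x) \<in> complexification D"
    using complexificationI[OF orth_Domain_D orth_Domain_D, of a b] ab(3) by simp
qed

end

section \<open>Direct summands of pencils\<close>

text \<open>A direct summand, given by inclusions \<open>I\<close>, \<open>I'\<close> and
  projections \<open>P\<close>, \<open>P'\<close> that intertwine the two pencils. In this form the
  notion is transitive, survives complexification and the exchange of \<open>E\<close> and
  \<open>A\<close>, and spares any reordering of blocks. The dimensions are quantified inside, which
  leaves a relation between matrices alone.\<close>

definition pencil_summand :: "'a :: field mat \<Rightarrow> 'a mat \<Rightarrow> 'a mat \<Rightarrow> 'a mat \<Rightarrow> bool" where
  "pencil_summand E A E' A' \<longleftrightarrow> (\<exists>n m p q I I' P P'.
     E \<in> carrier_mat n m \<and> A \<in> carrier_mat n m \<and> E' \<in> carrier_mat p q \<and> A' \<in> carrier_mat p q \<and>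
     I \<in> carrier_mat n p \<and> P \<in> carrier_mat p n \<and> I' \<in> carrier_mat m q \<and> P' \<in> carrier_mat q m \<and>
     E * I' = I * E' \<and> A * I' = I * A' \<and> P * E = E' * P' \<and> P * A = A' * P' \<and>
     P * I = 1\<^sub>m p \<and> P' * I' = 1\<^sub>m q)"

lemma pencil_summandI:
  assumes "E \<in> carrier_mat n m" "A \<in> carrier_mat n m" "E' \<in> carrier_mat p q" "A' \<in> carrier_mat p q"
    "I \<in> carrier_mat n p" "P \<in> carrier_mat p n" "I' \<in> carrier_mat m q" "P' \<in> carrier_mat q m"
    "E * I' = I * E'" "A * I' = I * A'" "P * E = E' * P'" "P * A = A' * P'"
    "P * I = 1\<^sub>m p" "P' * I' = 1\<^sub>m q"
  shows "pencil_summand E A E' A'"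
  unfolding pencil_summand_def
  by (rule exI[of _ n], rule exI[of _ m], rule exI[of _ p], rule exI[of _ q], rule exI[of _ I],
      rule exI[of _ I'], rule exI[of _ P], rule exI[of _ P'], intro conjI assms)

lemma mult_mat_vec_eqI:
  assumes "A * B = C * D" "A \<in> carrier_mat n m" "B \<in> carrier_mat m q" "C \<in> carrier_mat n p"
    "D \<in> carrier_mat p q" "v \<in> carrier_vec q"
  shows "A *\<^sub>v (B *\<^sub>v v) = C *\<^sub>v (D *\<^sub>v v)"
  using assoc_mult_mat_vec[OF assms(2,3,6)] assoc_mult_mat_vec[OF assms(4,5,6)] assms(1) by simp

lemma pencil_summandE:
  assumes sum: "pencil_summand E A E' A'" and E: "E \<in> carrier_mat n m" and E': "E' \<in> carrier_mat p q"
  obtains I I' P P' where "A \<in> carrier_mat n m" "A' \<in> carrier_mat p q"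
     "I \<in> carrier_mat n p" "P \<in> carrier_mat p n" "I' \<in> carrier_mat m q" "P' \<in> carrier_mat q m"
     "E * I' = I * E'" "A * I' = I * A'" "P * E = E' * P'" "P * A = A' * P'"
     "P * I = 1\<^sub>m p" "P' * I' = 1\<^sub>m q"
proof -
  obtain n2 m2 p2 q2 I I' P P' where *: "E \<in> carrier_mat n2 m2" "A \<in> carrier_mat n2 m2" "E' \<in> carrier_mat p2 q2"
     "A' \<in> carrier_mat p2 q2"
     "I \<in> carrier_mat n2 p2" "P \<in> carrier_mat p2 n2" "I' \<in> carrier_mat m2 q2" "P' \<in> carrier_mat q2 m2"
     "E * I' = I * E'" "A * I' = I * A'" "P * E = E' * P'" "P * A = A' * P'"
     "P * I = 1\<^sub>m p2" "P' * I' = 1\<^sub>m q2"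
    using sum unfolding pencil_summand_def by (elim exE conjE) (rule that)
  have "n2 = n" "m2 = m" "p2 = p" "q2 = q" using *(1,3) E E' by auto
  then show ?thesis using *(2,4-) by (intro that) simp_all
qed

lemma pencil_summand_vec:
  assumes sum: "pencil_summand E A E' A'" and E: "E \<in> carrier_mat n m" and E': "E' \<in> carrier_mat p q"
  obtains I P where "I \<in> carrier_mat n p" "P \<in> carrier_mat p n"
    "\<And>a. a \<in> carrier_vec p \<Longrightarrow> P *\<^sub>v (I *\<^sub>v a) = a"
    "\<And>v. v \<in> carrier_vec q \<Longrightarrow> \<exists>t\<in>carrier_vec m. E *\<^sub>v t = I *\<^sub>v (E' *\<^sub>v v) \<and> A *\<^sub>v t = I *\<^sub>v (A' *\<^sub>v v)"
    "\<And>t. t \<in> carrier_vec m \<Longrightarrow> \<exists>v\<in>carrier_vec q. P *\<^sub>v (E *\<^sub>v t) = E' *\<^sub>v v \<and> P *\<^sub>v (A *\<^sub>v t) = A' *\<^sub>v v"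
proof -
  obtain I I' P P' where A: "A \<in> carrier_mat n m" "A' \<in> carrier_mat p q"
    and IP: "I \<in> carrier_mat n p" "P \<in> carrier_mat p n" "I' \<in> carrier_mat m q" "P' \<in> carrier_mat q m"
    and eqs: "E * I' = I * E'" "A * I' = I * A'" "P * E = E' * P'" "P * A = A' * P'" "P * I = 1\<^sub>m p"
    by (rule pencil_summandE[OF sum E E'])
  show ?thesis
  proof (rule that[OF IP(1,2)])
    show "P *\<^sub>v (I *\<^sub>v a) = a" if "a \<in> carrier_vec p" for a
      using assoc_mult_mat_vec[OF IP(2,1) that] that by (simp add: eqs(5))
    show "\<exists>t\<in>carrier_vec m. E *\<^sub>v t = I *\<^sub>v (E' *\<^sub>v v) \<and> A *\<^sub>v t = I *\<^sub>v (A' *\<^sub>v v)" if v: "v \<in> carrier_vec q" for v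
      using mult_mat_vec_eqI[OF eqs(1) E IP(3,1) E' v] mult_mat_vec_eqI[OF eqs(2) A(1) IP(3,1) A(2) v]
        mult_mat_vec_carrier[OF IP(3) v] by blast
    show "\<exists>v\<in>carrier_vec q. P *\<^sub>v (E *\<^sub>v t) = E' *\<^sub>v v \<and> P *\<^sub>v (A *\<^sub>v t) = A' *\<^sub>v v" if t: "t \<in> carrier_vec m" for t
      using mult_mat_vec_eqI[OF eqs(3) IP(2) E E' IP(4) t] mult_mat_vec_eqI[OF eqs(4) IP(2) A(1) A(2) IP(4) t]
        mult_mat_vec_carrier[OF IP(4) t] by blast
  qed
qed

lemma pencil_summand_trans:
  assumes s1: "pencil_summand E A E' A'" and s2: "pencil_summand E' A' E'' A''"
  shows "pencil_summand E A E'' A''"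
proof -
  obtain n m p q k l where E: "E \<in> carrier_mat n m" and E': "E' \<in> carrier_mat p q"
    and E'': "E'' \<in> carrier_mat k l" using carrier_matI[OF refl refl] by metis
  obtain I I' P P' where A: "A \<in> carrier_mat n m" and A': "A' \<in> carrier_mat p q"
    and c: "I \<in> carrier_mat n p" "P \<in> carrier_mat p n" "I' \<in> carrier_mat m q" "P' \<in> carrier_mat q m"
    and eqs: "E * I' = I * E'" "A * I' = I * A'" "P * E = E' * P'" "P * A = A' * P'" "P * I = 1\<^sub>m p" "P' * I' = 1\<^sub>m q"
    by (rule pencil_summandE[OF s1 E E'])
  obtain K K' Q Q' where A'': "A'' \<in> carrier_mat k l"
    and d: "K \<in> carrier_mat p k" "Q \<in> carrier_mat k p" "K' \<in> carrier_mat q l" "Q' \<in> carrier_mat l q"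
    and eqs': "E' * K' = K * E''" "A' * K' = K * A''" "Q * E' = E'' * Q'" "Q * A' = A'' * Q'" "Q * K = 1\<^sub>m k" "Q' * K' = 1\<^sub>m l"
    by (rule pencil_summandE[OF s2 E' E''])
  have right: "X * (I' * K') = I * K * X''"
    if "X \<in> carrier_mat n m" "X' \<in> carrier_mat p q" "X'' \<in> carrier_mat k l" "X * I' = I * X'" "X' * K' = K * X''" for X X' X''
    using assoc_mult_mat[OF that(1) c(3) d(3)] assoc_mult_mat[OF c(1) that(2) d(3)]
      assoc_mult_mat[OF c(1) d(1) that(3)] that(4,5) by simp
  have left: "Q * P * X = X'' * (Q' * P')"
    if "X \<in> carrier_mat n m" "X' \<in> carrier_mat p q" "X'' \<in> carrier_mat k l" "P * X = X' * P'" "Q * X' = X'' * Q'" for X X' X''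
    using assoc_mult_mat[OF d(2) c(2) that(1)] assoc_mult_mat[OF d(2) that(2) c(4)]
      assoc_mult_mat[OF that(3) d(4) c(4)] that(4,5) by simp
  have id: "Y * X * (V * W) = 1\<^sub>m b" if "X \<in> carrier_mat a e" "V \<in> carrier_mat e a" "Y \<in> carrier_mat b a"
    "W \<in> carrier_mat a b" "X * V = 1\<^sub>m a" "Y * W = 1\<^sub>m b" for X Y V W :: "'a mat" and a b e
  proof -
    have "Y * X * (V * W) = Y * (X * (V * W))"
      by (rule assoc_mult_mat[OF that(3,1) mult_carrier_mat[OF that(2,4)]])
    also have "X * (V * W) = X * V * W" by (rule assoc_mult_mat[OF that(1,2,4), symmetric])
    finally show ?thesis using that(4-6) by simp
  qed
  show ?thesis
    by (rule pencil_summandI[OF E A E'' A'' mult_carrier_mat[OF c(1) d(1)] mult_carrier_mat[OF d(2) c(2)]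
          mult_carrier_mat[OF c(3) d(3)] mult_carrier_mat[OF d(4) c(4)]
          right[OF E E' E'' eqs(1) eqs'(1)] right[OF A A' A'' eqs(2) eqs'(2)]
          left[OF E E' E'' eqs(3) eqs'(3)] left[OF A A' A'' eqs(4) eqs'(4)]
          id[OF c(2,1) d(2,1) eqs(5) eqs'(5)] id[OF c(4,3) d(4,3) eqs(6) eqs'(6)]])
qed

text \<open>The inclusions are the inverse of \<open>S\<close> and \<open>T\<close>, the projections
  are \<open>S\<close> and the inverse of \<open>T\<close>.\<close>

lemma pencil_summand_equivalent:
  assumes E: "E \<in> carrier_mat n m" and A: "A \<in> carrier_mat n m"
    and S: "S \<in> carrier_mat n n" "invertible_mat S" and T: "T \<in> carrier_mat m m" "invertible_mat T"
  shows "pencil_summand E A (S * E * T) (S * A * T)"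
proof -
  obtain S' where S': "S' \<in> carrier_mat n n" "S * S' = 1\<^sub>m n" "S' * S = 1\<^sub>m n" by (rule invertible_matE[OF S])
  obtain T' where T': "T' \<in> carrier_mat m m" "T * T' = 1\<^sub>m m" "T' * T = 1\<^sub>m m" by (rule invertible_matE[OF T])
  have right: "X * T = S' * (S * X * T)" if X: "X \<in> carrier_mat n m" for X
  proof -
    have SX: "S * X \<in> carrier_mat n m" using S X by simp
    have "S' * (S * X * T) = S' * (S * X) * T" by (rule assoc_mult_mat[OF S'(1) SX T(1), symmetric])
    also have "S' * (S * X) = X" using assoc_mult_mat[OF S'(1) S(1) X] S'(3) X by simp
    finally show ?thesis by simp
  qed
  have left: "S * X = S * X * T * T'" if X: "X \<in> carrier_mat n m" for X
  proof -
    have SX: "S * X \<in> carrier_mat n m" using S X by simp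
    show ?thesis using assoc_mult_mat[OF SX T(1) T'(1)] T'(2) right_mult_one_mat[OF SX] by simp
  qed
  have c: "S * E * T \<in> carrier_mat n m" "S * A * T \<in> carrier_mat n m" using E A S T by auto
  show ?thesis
    by (rule pencil_summandI[OF E A c S'(1) S(1) T(1) T'(1) right[OF E] right[OF A] left[OF E] left[OF A] S'(2) T'(3)])
qed

lemma pencil_summand_four_block:
  fixes E1 :: "'a :: field mat"
  assumes E1: "E1 \<in> carrier_mat p q" and A1: "A1 \<in> carrier_mat p q"
    and E2: "E2 \<in> carrier_mat k l" and A2: "A2 \<in> carrier_mat k l"
  shows "pencil_summand (four_block_mat E1 (0\<^sub>m p l) (0\<^sub>m k q) E2) (four_block_mat A1 (0\<^sub>m p l) (0\<^sub>m k q) A2) E1 A1"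
    and "pencil_summand (four_block_mat E1 (0\<^sub>m p l) (0\<^sub>m k q) E2) (four_block_mat A1 (0\<^sub>m p l) (0\<^sub>m k q) A2) E2 A2"
proof -
  let ?O = "0\<^sub>m :: nat \<Rightarrow> nat \<Rightarrow> 'a mat" and ?J = "1\<^sub>m :: nat \<Rightarrow> 'a mat"
  define I1 where "I1 a b = ?J a @\<^sub>r ?O b a" for a b
  define I2 where "I2 a b = ?O a b @\<^sub>r ?J b" for a b
  define P1 where "P1 a b = hcat2 (?J a) (?O a b)" for a b
  define P2 where "P2 a b = hcat2 (?O b a) (?J b)" for a b
  have carrier: "I1 a b \<in> carrier_mat (a + b) a" "I2 a b \<in> carrier_mat (a + b) b"
    "P1 a b \<in> carrier_mat a (a + b)" "P2 a b \<in> carrier_mat b (a + b)" for a b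
    unfolding I1_def I2_def P1_def P2_def by (intro carrier_append_rows hcat2_carrier one_carrier_mat zero_carrier_mat)+
  have I1: "I1 a b *\<^sub>v v = v @\<^sub>v 0\<^sub>v b" if "v \<in> carrier_vec a" for a b v
    unfolding I1_def append_rows_mult_vec[OF one_carrier_mat zero_carrier_mat that]
    using zero_mult_mat_vec[OF that] that by simp
  have I2: "I2 a b *\<^sub>v v = 0\<^sub>v a @\<^sub>v v" if "v \<in> carrier_vec b" for a b v
    unfolding I2_def append_rows_mult_vec[OF zero_carrier_mat one_carrier_mat that]
    using zero_mult_mat_vec[OF that] that by simp
  have P1: "P1 a b *\<^sub>v (v @\<^sub>v w) = v" and P2: "P2 a b *\<^sub>v (v @\<^sub>v w) = w"
    if "v \<in> carrier_vec a" "w \<in> carrier_vec b" for a b v w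
    unfolding P1_def P2_def hcat2_mult_vec[OF one_carrier_mat zero_carrier_mat that]
      hcat2_mult_vec[OF zero_carrier_mat one_carrier_mat that]
    using zero_mult_mat_vec[OF that(1)] zero_mult_mat_vec[OF that(2)] that by simp_all
  have block: "four_block_mat X (?O p l) (?O k q) Y \<in> carrier_mat (p + k) (q + l)"
    "\<And>v w. v \<in> carrier_vec q \<Longrightarrow> w \<in> carrier_vec l \<Longrightarrow>
      four_block_mat X (?O p l) (?O k q) Y *\<^sub>v (v @\<^sub>v w) = (X *\<^sub>v v) @\<^sub>v (Y *\<^sub>v w)"
    if X: "X \<in> carrier_mat p q" and Y: "Y \<in> carrier_mat k l" for X Y
  proof -
    show "four_block_mat X (?O p l) (?O k q) Y \<in> carrier_mat (p + k) (q + l)" using X Y by simp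
    fix v w :: "'a vec" assume v: "v \<in> carrier_vec q" and w: "w \<in> carrier_vec l"
    show "four_block_mat X (?O p l) (?O k q) Y *\<^sub>v (v @\<^sub>v w) = (X *\<^sub>v v) @\<^sub>v (Y *\<^sub>v w)"
      unfolding four_block_mat_mult_vec[OF X zero_carrier_mat zero_carrier_mat Y v w]
        zero_mult_mat_vec[OF v] zero_mult_mat_vec[OF w]
      using mult_mat_vec_carrier[OF X v] mult_mat_vec_carrier[OF Y w] by simp
  qed
  have zero: "X *\<^sub>v 0\<^sub>v b = 0\<^sub>v a" if "X \<in> carrier_mat a b" for X :: "'a mat" and a b
    using that by (intro eq_vecI) auto
  have mult: "X * Y = Z * W"
    if "X \<in> carrier_mat a b" "Y \<in> carrier_mat b c" "Z \<in> carrier_mat a d" "W \<in> carrier_mat d c"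
      "\<And>v. v \<in> carrier_vec c \<Longrightarrow> X *\<^sub>v (Y *\<^sub>v v) = Z *\<^sub>v (W *\<^sub>v v)" for X Y Z W :: "'a mat" and a b c d
    using that assoc_mult_mat_vec[OF that(1,2)] assoc_mult_mat_vec[OF that(3,4)]
    by (intro eq_mat_mult_vecI[OF mult_carrier_mat[OF that(1,2)] mult_carrier_mat[OF that(3,4)]]) simp
  have one: "X * Y = ?J a"
    if "X \<in> carrier_mat a b" "Y \<in> carrier_mat b a" "\<And>v. v \<in> carrier_vec a \<Longrightarrow> X *\<^sub>v (Y *\<^sub>v v) = v" for X Y and a b
    using that assoc_mult_mat_vec[OF that(1,2)]
    by (intro eq_mat_mult_vecI[OF mult_carrier_mat[OF that(1,2)] one_carrier_mat]) simp
  have r1: "four_block_mat X (?O p l) (?O k q) Y * I1 q l = I1 p k * X"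
    and r2: "four_block_mat X (?O p l) (?O k q) Y * I2 q l = I2 p k * Y"
    and l1: "P1 p k * four_block_mat X (?O p l) (?O k q) Y = X * P1 q l"
    and l2: "P2 p k * four_block_mat X (?O p l) (?O k q) Y = Y * P2 q l"
    if X: "X \<in> carrier_mat p q" and Y: "Y \<in> carrier_mat k l" for X Y
  proof -
    note B = block[OF X Y]
    note zX = zero[OF X] and zY = zero[OF Y]
    show "four_block_mat X (?O p l) (?O k q) Y * I1 q l = I1 p k * X"
    proof (rule mult[OF B(1) carrier(1) carrier(1) X])
      fix v :: "'a vec" assume v: "v \<in> carrier_vec q"
      show "four_block_mat X (?O p l) (?O k q) Y *\<^sub>v (I1 q l *\<^sub>v v) = I1 p k *\<^sub>v (X *\<^sub>v v)"
        unfolding I1[OF v] I1[OF mult_mat_vec_carrier[OF X v]] B(2)[OF v zero_carrier_vec] zY ..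
    qed
    show "four_block_mat X (?O p l) (?O k q) Y * I2 q l = I2 p k * Y"
    proof (rule mult[OF B(1) carrier(2) carrier(2) Y])
      fix v :: "'a vec" assume v: "v \<in> carrier_vec l"
      show "four_block_mat X (?O p l) (?O k q) Y *\<^sub>v (I2 q l *\<^sub>v v) = I2 p k *\<^sub>v (Y *\<^sub>v v)"
        unfolding I2[OF v] I2[OF mult_mat_vec_carrier[OF Y v]] B(2)[OF zero_carrier_vec v] zX ..
    qed
    have split: "\<exists>a b. v = a @\<^sub>v b \<and> a \<in> carrier_vec q \<and> b \<in> carrier_vec l" if v: "v \<in> carrier_vec (q + l)" for v :: "'a vec"
      by (rule carrier_vec_appendE[OF v]) blast
    show "P1 p k * four_block_mat X (?O p l) (?O k q) Y = X * P1 q l"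
    proof (rule mult[OF carrier(3) B(1) X carrier(3)])
      fix v :: "'a vec" assume "v \<in> carrier_vec (q + l)"
      then obtain a b where v: "v = a @\<^sub>v b" and ab: "a \<in> carrier_vec q" "b \<in> carrier_vec l" using split by blast
      show "P1 p k *\<^sub>v (four_block_mat X (?O p l) (?O k q) Y *\<^sub>v v) = X *\<^sub>v (P1 q l *\<^sub>v v)"
        unfolding v B(2)[OF ab] P1[OF ab] P1[OF mult_mat_vec_carrier[OF X ab(1)] mult_mat_vec_carrier[OF Y ab(2)]] ..
    qed
    show "P2 p k * four_block_mat X (?O p l) (?O k q) Y = Y * P2 q l"
    proof (rule mult[OF carrier(4) B(1) Y carrier(4)])
      fix v :: "'a vec" assume "v \<in> carrier_vec (q + l)"
      then obtain a b where v: "v = a @\<^sub>v b" and ab: "a \<in> carrier_vec q" "b \<in> carrier_vec l" using split by blast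
      show "P2 p k *\<^sub>v (four_block_mat X (?O p l) (?O k q) Y *\<^sub>v v) = Y *\<^sub>v (P2 q l *\<^sub>v v)"
        unfolding v B(2)[OF ab] P2[OF ab] P2[OF mult_mat_vec_carrier[OF X ab(1)] mult_mat_vec_carrier[OF Y ab(2)]] ..
    qed
  qed
  have PI: "P1 a b * I1 a b = ?J a" "P2 a b * I2 a b = ?J b" for a b
    by (rule one[OF carrier(3,1)], simp add: I1 P1) (rule one[OF carrier(4,2)], simp add: I2 P2)
  show "pencil_summand (four_block_mat E1 (0\<^sub>m p l) (0\<^sub>m k q) E2) (four_block_mat A1 (0\<^sub>m p l) (0\<^sub>m k q) A2) E1 A1"
    by (rule pencil_summandI[OF block(1)[OF E1 E2] block(1)[OF A1 A2] E1 A1 carrier(1,3) carrier(1,3)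
          r1[OF E1 E2] r1[OF A1 A2] l1[OF E1 E2] l1[OF A1 A2] PI(1) PI(1)])
  show "pencil_summand (four_block_mat E1 (0\<^sub>m p l) (0\<^sub>m k q) E2) (four_block_mat A1 (0\<^sub>m p l) (0\<^sub>m k q) A2) E2 A2"
    by (rule pencil_summandI[OF block(1)[OF E1 E2] block(1)[OF A1 A2] E2 A2 carrier(2,4) carrier(2,4)
          r2[OF E1 E2] r2[OF A1 A2] l2[OF E1 E2] l2[OF A1 A2] PI(2) PI(2)])
qed

lemma diag_block_mat_same_dims:
  assumes "\<And>x. x \<in> set ps \<Longrightarrow> dim_row (fst x) = dim_row (snd x) \<and> dim_col (fst x) = dim_col (snd x)"
  shows "dim_row (diag_block_mat (map fst ps)) = dim_row (diag_block_mat (map snd ps))"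
    "dim_col (diag_block_mat (map fst ps)) = dim_col (diag_block_mat (map snd ps))"
  using assms by (induction ps) (simp_all add: Let_def)

lemma pencil_summand_diag_block:
  fixes ps :: "('a :: field mat \<times> 'a mat) list"
  assumes "\<And>x. x \<in> set ps \<Longrightarrow> dim_row (fst x) = dim_row (snd x) \<and> dim_col (fst x) = dim_col (snd x)"
    and "(E, A) \<in> set ps"
  shows "pencil_summand (diag_block_mat (map fst ps)) (diag_block_mat (map snd ps)) E A"
  using assms
proof (induction ps)
  case (Cons x ps)
  obtain E1 A1 where x: "x = (E1, A1)" by (cases x)
  let ?E = "diag_block_mat (map fst ps)" and ?A = "diag_block_mat (map snd ps)"
  have dims: "dim_row ?E = dim_row ?A" "dim_col ?E = dim_col ?A"
    using diag_block_mat_same_dims[of ps] Cons.prems(1) by auto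
  have x_dims: "dim_row E1 = dim_row A1" "dim_col E1 = dim_col A1"
    using Cons.prems(1)[of x] by (auto simp: x)
  have c: "E1 \<in> carrier_mat (dim_row A1) (dim_col A1)" "A1 \<in> carrier_mat (dim_row A1) (dim_col A1)"
    "?E \<in> carrier_mat (dim_row ?A) (dim_col ?A)" "?A \<in> carrier_mat (dim_row ?A) (dim_col ?A)"
    by (rule carrier_matI; simp only: dims x_dims)+
  note four = pencil_summand_four_block[OF c]
  have eq: "diag_block_mat (map fst (x # ps)) = four_block_mat E1 (0\<^sub>m (dim_row A1) (dim_col ?A)) (0\<^sub>m (dim_row ?A) (dim_col A1)) ?E"
    "diag_block_mat (map snd (x # ps)) = four_block_mat A1 (0\<^sub>m (dim_row A1) (dim_col ?A)) (0\<^sub>m (dim_row ?A) (dim_col A1)) ?A"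
    unfolding x list.map fst_conv snd_conv diag_block_mat.simps Let_def dims x_dims by (rule refl)+
  show ?case
  proof (cases "(E, A) = x")
    case True
    then show ?thesis unfolding eq using four(1) x by simp
  next
    case False
    then have "pencil_summand ?E ?A E A" using Cons.IH Cons.prems by simp
    then show ?thesis unfolding eq using four(2) pencil_summand_trans by blast
  qed
qed simp

lemma pencil_summand_cmat:
  fixes E :: "'k :: real_or_complex mat"
  assumes "pencil_summand E A E' A'"
  shows "pencil_summand (cmat E) (cmat A) (cmat E') (cmat A')"
proof -
  obtain n m p q where E: "E \<in> carrier_mat n m" and E': "E' \<in> carrier_mat p q"
    using carrier_matI[OF refl refl] by metis
  obtain I I' P P' where A: "A \<in> carrier_mat n m" and A': "A' \<in> carrier_mat p q"
    and c: "I \<in> carrier_mat n p" "P \<in> carrier_mat p n" "I' \<in> carrier_mat m q" "P' \<in> carrier_mat q m"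
    and eqs: "E * I' = I * E'" "A * I' = I * A'" "P * E = E' * P'" "P * A = A' * P'" "P * I = 1\<^sub>m p" "P' * I' = 1\<^sub>m q"
    by (rule pencil_summandE[OF assms E E'])
  have hom: "cmat (X * Y) = cmat X * cmat Y" if "X \<in> carrier_mat a b" "Y \<in> carrier_mat b d" for X Y :: "'k mat" and a b d
    by (rule to_complex.mat_hom_mult[OF that])
  have one: "cmat (1\<^sub>m a :: 'k mat) = 1\<^sub>m a" for a by (rule to_complex.mat_hom_one)
  show ?thesis
  proof (rule pencil_summandI[where I = "cmat I" and P = "cmat P" and I' = "cmat I'" and P' = "cmat P'"])
    show "cmat E * cmat I' = cmat I * cmat E'" using eqs(1) hom[OF E c(3)] hom[OF c(1) E'] by simp
    show "cmat A * cmat I' = cmat I * cmat A'" using eqs(2) hom[OF A c(3)] hom[OF c(1) A'] by simp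
    show "cmat P * cmat E = cmat E' * cmat P'" using eqs(3) hom[OF c(2) E] hom[OF E' c(4)] by simp
    show "cmat P * cmat A = cmat A' * cmat P'" using eqs(4) hom[OF c(2) A] hom[OF A' c(4)] by simp
    show "cmat P * cmat I = 1\<^sub>m p" using eqs(5) hom[OF c(2,1)] one by simp
    show "cmat P' * cmat I' = 1\<^sub>m q" using eqs(6) hom[OF c(4,3)] one by simp
  qed (use E A E' A' c in auto)
qed

section \<open>Kronecker blocks as chains in the range relation\<close>

lemma jordan_block_unit_vec:
  fixes z :: "'a :: comm_ring_1"
  assumes "i < k"
  shows "jordan_block k z *\<^sub>v unit_vec k i = z \<cdot>\<^sub>v unit_vec k i + (if i = 0 then 0\<^sub>v k else unit_vec k (i - 1))"
  unfolding mult_mat_vec_unit[OF jordan_block_carrier assms]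
  using assms by (intro eq_vecI) (auto simp: jordan_block_index)

lemma diag_block_one: "diag_block_mat (map (\<lambda>k. 1\<^sub>m k) ks) = (1\<^sub>m (sum_list ks) :: 'a :: {zero, one} mat)"
proof (induction ks)
  case (Cons k ks)
  then show ?case by (auto simp: Let_def intro!: eq_matI)
qed (auto intro!: eq_matI)

lemma ran_stackedI:
  "E \<in> carrier_mat n m \<Longrightarrow> t \<in> carrier_vec m \<Longrightarrow> (E *\<^sub>v t, A *\<^sub>v t) \<in> ran_stacked E A"
  by (auto simp: ran_stacked_def)

lemma ran_stackedE:
  assumes "(x, z) \<in> ran_stacked E A" "E \<in> carrier_mat n m"
  obtains t where "t \<in> carrier_vec m" "x = E *\<^sub>v t" "z = A *\<^sub>v t"
  using assms by (auto simp: ran_stacked_def)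

text \<open>Both directions are used against a block that is too large: the pairs of the block embed
  into the range relation and supply a chain there, and every pair of the relation projects to the
  block, which refutes the pair that the chain produces.\<close>

lemma pencil_summand_ran_stacked:
  assumes sum: "pencil_summand E A E' A'" and E: "E \<in> carrier_mat n m" and E': "E' \<in> carrier_mat p q"
  obtains I P where "I \<in> carrier_mat n p" "P \<in> carrier_mat p n"
    "\<And>a. a \<in> carrier_vec p \<Longrightarrow> P *\<^sub>v (I *\<^sub>v a) = a"
    "\<And>v. v \<in> carrier_vec q \<Longrightarrow> (I *\<^sub>v (E' *\<^sub>v v), I *\<^sub>v (A' *\<^sub>v v)) \<in> ran_stacked E A"
    "\<And>x z. (x, z) \<in> ran_stacked E A \<Longrightarrow> \<exists>v\<in>carrier_vec q. P *\<^sub>v x = E' *\<^sub>v v \<and> P *\<^sub>v z = A' *\<^sub>v v"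
proof -
  obtain I P where IP: "I \<in> carrier_mat n p" "P \<in> carrier_mat p n"
    and eqs: "\<And>a. a \<in> carrier_vec p \<Longrightarrow> P *\<^sub>v (I *\<^sub>v a) = a"
    "\<And>v. v \<in> carrier_vec q \<Longrightarrow> \<exists>t\<in>carrier_vec m. E *\<^sub>v t = I *\<^sub>v (E' *\<^sub>v v) \<and> A *\<^sub>v t = I *\<^sub>v (A' *\<^sub>v v)"
    "\<And>t. t \<in> carrier_vec m \<Longrightarrow> \<exists>v\<in>carrier_vec q. P *\<^sub>v (E *\<^sub>v t) = E' *\<^sub>v v \<and> P *\<^sub>v (A *\<^sub>v t) = A' *\<^sub>v v"
    by (rule pencil_summand_vec[OF sum E E']) (rule that)
  show ?thesis
  proof (rule that[OF IP eqs(1)])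
    show "(I *\<^sub>v (E' *\<^sub>v v), I *\<^sub>v (A' *\<^sub>v v)) \<in> ran_stacked E A" if "v \<in> carrier_vec q" for v
      using eqs(2)[OF that] ran_stackedI[OF E] by metis
    show "\<exists>v\<in>carrier_vec q. P *\<^sub>v x = E' *\<^sub>v v \<and> P *\<^sub>v z = A' *\<^sub>v v" if xz: "(x, z) \<in> ran_stacked E A" for x z
      by (rule ran_stackedE[OF xz E]) (simp add: eqs(3))
  qed
qed

text \<open>Exchanging \<open>E\<close> and \<open>A\<close> turns a Jordan block at infinity into
  one at zero and the range relation into its converse, so that one chain lemma covers both.\<close>

lemma pencil_summand_swap: "pencil_summand E A E' A' \<Longrightarrow> pencil_summand A E A' E'"
  unfolding pencil_summand_def by (elim exE conjE) (intro exI conjI)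

lemma ran_stacked_swap:
  assumes "E \<in> carrier_mat n m" "A \<in> carrier_mat n m" shows "ran_stacked A E = (ran_stacked E A)\<inverse>"
  using assms by (auto simp: ran_stacked_def)

text \<open>The chain consists of the unit vectors, transported by \<open>I\<close>. A pair
  \<open>(0, e i)\<close> would project to a pair of the block with first component zero; as the
  leading coefficient is the identity, the second component would be zero as well.\<close>

lemma pencil_summand_jordan_chain:
  fixes E A :: "'k :: real_or_complex mat"
  assumes E: "E \<in> carrier_mat n m" and sum: "pencil_summand E A (1\<^sub>m k) (jordan_block k z)"
  obtains e :: "nat \<Rightarrow> 'k vec" where "\<And>i. e i \<in> carrier_vec n"
    "0 < k \<Longrightarrow> (e 0, z \<cdot>\<^sub>v e 0) \<in> ran_stacked E A"
    "\<And>i. Suc i < k \<Longrightarrow> (e (Suc i), z \<cdot>\<^sub>v e (Suc i) + e i) \<in> ran_stacked E A"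
    "\<And>i. i < k \<Longrightarrow> (0\<^sub>v n, e i) \<notin> ran_stacked E A"
proof -
  obtain I P where I: "I \<in> carrier_mat n k" and P: "P \<in> carrier_mat k n"
    and PI: "\<And>a. a \<in> carrier_vec k \<Longrightarrow> P *\<^sub>v (I *\<^sub>v a) = a"
    and fwd: "\<And>v. v \<in> carrier_vec k \<Longrightarrow> (I *\<^sub>v (1\<^sub>m k *\<^sub>v v), I *\<^sub>v (jordan_block k z *\<^sub>v v)) \<in> ran_stacked E A"
    and bwd: "\<And>x y. (x, y) \<in> ran_stacked E A \<Longrightarrow> \<exists>v\<in>carrier_vec k. P *\<^sub>v x = 1\<^sub>m k *\<^sub>v v \<and> P *\<^sub>v y = jordan_block k z *\<^sub>v v"
    by (rule pencil_summand_ran_stacked[OF sum E one_carrier_mat]) (rule that)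
  let ?e = "unit_vec k :: nat \<Rightarrow> 'k vec"
  show thesis
  proof (rule that[of "\<lambda>i. I *\<^sub>v ?e i"])
    show "I *\<^sub>v ?e i \<in> carrier_vec n" for i by (rule mult_mat_vec_carrier[OF I]) simp
    show "(I *\<^sub>v ?e 0, z \<cdot>\<^sub>v (I *\<^sub>v ?e 0)) \<in> ran_stacked E A" if "0 < k"
      using fwd[of "?e 0"] mult_mat_vec[OF I, of "?e 0" z] jordan_block_unit_vec[OF that, of z] by simp
    show "(I *\<^sub>v ?e (Suc i), z \<cdot>\<^sub>v (I *\<^sub>v ?e (Suc i)) + I *\<^sub>v ?e i) \<in> ran_stacked E A" if "Suc i < k" for i
      using fwd[of "?e (Suc i)"] mult_mat_vec[OF I, of "?e (Suc i)" z] jordan_block_unit_vec[OF that, of z]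
        mult_add_distrib_mat_vec[OF I, of "z \<cdot>\<^sub>v ?e (Suc i)" "?e i"] by simp
    show "(0\<^sub>v n, I *\<^sub>v ?e i) \<notin> ran_stacked E A" if i: "i < k" for i
    proof
      assume "(0\<^sub>v n, I *\<^sub>v ?e i) \<in> ran_stacked E A"
      then obtain v where v: "v \<in> carrier_vec k" "P *\<^sub>v 0\<^sub>v n = 1\<^sub>m k *\<^sub>v v" "P *\<^sub>v (I *\<^sub>v ?e i) = jordan_block k z *\<^sub>v v"
        using bwd by blast
      have "v = 0\<^sub>v k" using v(1,2) mult_mat_zero_vec[OF P] by simp
      then have "?e i = 0\<^sub>v k"
        using v(3) unfolding PI[OF unit_vec_carrier] by (simp only: mult_mat_zero_vec[OF jordan_block_carrier])
      then show False using i by simp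
    qed
  qed
qed

lemma zero_smult_add_vec: "x \<in> carrier_vec n \<Longrightarrow> y \<in> carrier_vec n \<Longrightarrow> 0 \<cdot>\<^sub>v x + y = (y :: 'a :: comm_ring_1 vec)"
  by (intro eq_vecI) auto

context dissipative_nonnegative
begin

lemma jordan_block_imaginary:
  assumes E: "E \<in> carrier_mat n m" and ran: "ran_stacked E A = L O D"
    and sum: "pencil_summand E A (1\<^sub>m k) (jordan_block k z)"
    and im: "Re (to_complex z) = 0" "z \<noteq> 0"
  shows "k \<le> 1"
proof (rule ccontr)
  assume k: "\<not> k \<le> 1"
  obtain e where "0 < k \<Longrightarrow> (e 0, z \<cdot>\<^sub>v e 0) \<in> L O D"
    "\<And>i. Suc i < k \<Longrightarrow> (e (Suc i), z \<cdot>\<^sub>v e (Suc i) + e i) \<in> L O D"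
    "\<And>i. i < k \<Longrightarrow> (0\<^sub>v n, e i) \<notin> L O D"
    by (rule pencil_summand_jordan_chain[OF E sum, unfolded ran]) (rule that)
  from this(1) this(2)[of 0] this(3)[of 0] show False
    using relcomp_imaginary_chain[of "e 0" z "e 1"] im k by simp
qed

lemma jordan_block_zero:
  assumes E: "E \<in> carrier_mat n m" and ran: "ran_stacked E A = L O D"
    and sum: "pencil_summand E A (1\<^sub>m k) (jordan_block k 0)"
  shows "k \<le> 2"
proof (rule ccontr)
  assume k: "\<not> k \<le> 2"
  obtain e where e: "\<And>i. e i \<in> carrier_vec n"
    and chain: "0 < k \<Longrightarrow> (e 0, 0 \<cdot>\<^sub>v e 0) \<in> L O D"
      "\<And>i. Suc i < k \<Longrightarrow> (e (Suc i), 0 \<cdot>\<^sub>v e (Suc i) + e i) \<in> L O D"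
      "\<And>i. i < k \<Longrightarrow> (0\<^sub>v n, e i) \<notin> L O D"
    by (rule pencil_summand_jordan_chain[OF E sum, unfolded ran]) (rule that)
  have "0 \<cdot>\<^sub>v e 0 = 0\<^sub>v n" using e[of 0] by (intro eq_vecI) auto
  with chain(1) chain(2)[of 0] chain(2)[of 1] chain(3)[of 0] show False
    using relcomp_zero_chain[of "e 0" "e 1" "e 2"] k
    by (simp add: zero_smult_add_vec[OF e e] numeral_2_eq_2)
qed

lemma jordan_block_infinity:
  assumes E: "E \<in> carrier_mat n m" and A: "A \<in> carrier_mat n m" and ran: "ran_stacked E A = L O D"
    and sum: "pencil_summand E A (jordan_block k 0) (1\<^sub>m k)"
  shows "k \<le> 2"
proof (rule ccontr)
  assume k: "\<not> k \<le> 2"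
  obtain e where e: "\<And>i. e i \<in> carrier_vec n"
    and chain: "0 < k \<Longrightarrow> (0 \<cdot>\<^sub>v e 0, e 0) \<in> L O D"
      "\<And>i. Suc i < k \<Longrightarrow> (0 \<cdot>\<^sub>v e (Suc i) + e i, e (Suc i)) \<in> L O D"
      "\<And>i. i < k \<Longrightarrow> (e i, 0\<^sub>v n) \<notin> L O D"
    by (rule pencil_summand_jordan_chain[OF A pencil_summand_swap[OF sum],
          unfolded ran_stacked_swap[OF E A] ran converse_iff]) (rule that)
  have "0 \<cdot>\<^sub>v e 0 = 0\<^sub>v n" using e[of 0] by (intro eq_vecI) auto
  with chain(1) chain(2)[of 0] chain(2)[of 1] chain(3)[of 0] show False
    using relcomp_infinity_chain[of "e 0" "e 1" "e 2"] k
    by (simp add: zero_smult_add_vec[OF e e] numeral_2_eq_2)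
qed

text \<open>The all-ones vector \<open>?u\<close> is a null vector of the block at s = 1, which
  gives a pair \<open>(x, x)\<close> in the product and hence \<open>(x, 0)\<close>. Projected to
  the block, the latter asks for \<open>v\<close> with all entries of \<open>K *\<^sub>v v\<close>
  equal to 1 and \<open>K' *\<^sub>v v = 0\<close>; for \<open>k\<close> at least 3 the entry
  \<open>v $ 1\<close> occurs in both.\<close>

lemma column_minimal_index:
  fixes k :: nat
  defines "K \<equiv> mat (k - 1) k (\<lambda>(i, j). if j = i then 1 else 0) :: 'k mat"
    and "K' \<equiv> mat (k - 1) k (\<lambda>(i, j). if j = i + 1 then 1 else 0) :: 'k mat"
  assumes E: "E \<in> carrier_mat n m" and ran: "ran_stacked E A = L O D"
    and sum: "pencil_summand E A K K'"
  shows "k \<le> 2"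
proof (rule ccontr)
  assume k: "\<not> k \<le> 2"
  have Kc: "K \<in> carrier_mat (k - 1) k" by (simp add: K_def)
  obtain I P where I: "I \<in> carrier_mat n (k - 1)" and P: "P \<in> carrier_mat (k - 1) n"
    and PI: "\<And>a. a \<in> carrier_vec (k - 1) \<Longrightarrow> P *\<^sub>v (I *\<^sub>v a) = a"
    and fwd: "\<And>v. v \<in> carrier_vec k \<Longrightarrow> (I *\<^sub>v (K *\<^sub>v v), I *\<^sub>v (K' *\<^sub>v v)) \<in> ran_stacked E A"
    and bwd: "\<And>x y. (x, y) \<in> ran_stacked E A \<Longrightarrow> \<exists>v\<in>carrier_vec k. P *\<^sub>v x = K *\<^sub>v v \<and> P *\<^sub>v y = K' *\<^sub>v v"
    by (rule pencil_summand_ran_stacked[OF sum E Kc]) (rule that)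
  have Kv: "(K *\<^sub>v v) $ i = v $ i" "(K' *\<^sub>v v) $ i = v $ (i + 1)" if "v \<in> carrier_vec k" "i < k - 1" for v i
    using that by (auto simp: K_def K'_def scalar_prod_def if_distrib[of "\<lambda>x. x * _"] cong: if_cong)
  let ?u = "vec k (\<lambda>_. 1) :: 'k vec" and ?f = "vec (k - 1) (\<lambda>_. 1) :: 'k vec"
  have "K *\<^sub>v ?u = ?f" "K' *\<^sub>v ?u = ?f"
    using Kv[of ?u] by (auto intro!: eq_vecI simp: K_def K'_def)
  then have "(I *\<^sub>v ?f, I *\<^sub>v ?f) \<in> L O D" using fwd[of ?u] unfolding ran by simp
  then have "(I *\<^sub>v ?f, 0\<^sub>v n) \<in> L O D" by (rule relcomp_diagonal)
  then obtain v where v: "v \<in> carrier_vec k" "P *\<^sub>v (I *\<^sub>v ?f) = K *\<^sub>v v" "P *\<^sub>v 0\<^sub>v n = K' *\<^sub>v v"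
    using bwd unfolding ran by blast
  have "v $ 1 = 0" using mult_mat_zero_vec[OF P] Kv(2)[OF v(1), of 0] v(3) k by simp
  moreover have "v $ 1 = 1" using Kv(1)[OF v(1), of 1] v(2) PI[of ?f] k by simp
  ultimately show False by simp
qed

text \<open>Dual argument: the all-ones vector is a left null vector of the block at s = 1. Pulled
  back by the adjoint of \<open>P\<close> it becomes \<open>?w\<close>, to which the left kernel
  argument applies with \<mu> = 1. The first components of all pairs would be orthogonal to
  \<open>?w\<close>, but for the embedded first unit vector the inner product is 1.\<close>

lemma row_minimal_index:
  fixes k :: nat
  defines "K \<equiv> mat (k - 1) k (\<lambda>(i, j). if j = i then 1 else 0) :: 'k mat"
    and "K' \<equiv> mat (k - 1) k (\<lambda>(i, j). if j = i + 1 then 1 else 0) :: 'k mat"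
  assumes E: "E \<in> carrier_mat n m" and ran: "ran_stacked E A = L O D"
    and sum: "pencil_summand E A (transpose_mat K) (transpose_mat K')"
  shows "k \<le> 1"
proof (rule ccontr)
  assume k: "\<not> k \<le> 1"
  have Kc: "transpose_mat K \<in> carrier_mat k (k - 1)" by (simp add: K_def)
  obtain I P where I: "I \<in> carrier_mat n k" and P: "P \<in> carrier_mat k n"
    and PI: "\<And>a. a \<in> carrier_vec k \<Longrightarrow> P *\<^sub>v (I *\<^sub>v a) = a"
    and fwd: "\<And>v. v \<in> carrier_vec (k - 1) \<Longrightarrow> (I *\<^sub>v (transpose_mat K *\<^sub>v v), I *\<^sub>v (transpose_mat K' *\<^sub>v v)) \<in> ran_stacked E A"
    and bwd: "\<And>x y. (x, y) \<in> ran_stacked E A \<Longrightarrow> \<exists>v\<in>carrier_vec (k - 1). P *\<^sub>v x = transpose_mat K *\<^sub>v v \<and> P *\<^sub>v y = transpose_mat K' *\<^sub>v v"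
    by (rule pencil_summand_ran_stacked[OF sum E Kc]) (rule that)
  let ?u = "vec k (\<lambda>_. 1) :: 'k vec"
  have Kv: "(transpose_mat K *\<^sub>v v) $ i = (if i < k - 1 then v $ i else 0)"
    "(transpose_mat K' *\<^sub>v v) $ i = (if i = 0 then 0 else v $ (i - 1))" if "v \<in> carrier_vec (k - 1)" "i < k" for v i
    using that by (auto simp: K_def K'_def scalar_prod_def if_distrib[of "\<lambda>x. x * _"] cong: if_cong)
      (cases i; simp)+
  \<comment> \<open>One transposed block appends a zero to \<open>v\<close>, the other prepends one;
    the sums of the entries coincide.\<close>
  have eq: "cip (transpose_mat K *\<^sub>v v) ?u = cip (transpose_mat K' *\<^sub>v v) ?u" if v: "v \<in> carrier_vec (k - 1)" for v
  proof -
    obtain l where l: "k = Suc l" using k by (cases k) auto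
    have c1: "cip x ?u = (\<Sum>i<k. to_complex (x $ i))" for x
      by (simp add: cip_sum[of ?u k])
    have "cip (transpose_mat K *\<^sub>v v) ?u = (\<Sum>i<k. to_complex (if i < k - 1 then v $ i else 0))"
      unfolding c1 by (rule sum.cong) (simp_all only: Kv(1)[OF v] lessThan_iff)
    also have "\<dots> = (\<Sum>i<l. to_complex (v $ i))" unfolding l by simp
    also have "\<dots> = (\<Sum>i<k. to_complex (if i = 0 then 0 else v $ (i - 1)))"
      unfolding l sum.lessThan_Suc_shift by simp
    also have "\<dots> = cip (transpose_mat K' *\<^sub>v v) ?u"
      unfolding c1 by (rule sum.cong) (simp_all only: Kv(2)[OF v] lessThan_iff)
    finally show ?thesis .
  qed
  let ?w = "mat_adjoint P *\<^sub>v ?u"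
  have PA: "mat_adjoint P \<in> carrier_mat n k" using P by simp
  have w: "?w \<in> carrier_vec n" by (rule mult_mat_vec_carrier[OF PA]) simp
  have cip_w: "cip x ?w = cip (P *\<^sub>v x) ?u" if x: "x \<in> carrier_vec n" for x
  proof -
    have u: "?u \<in> carrier_vec k" by simp
    have Px: "P *\<^sub>v x \<in> carrier_vec k" by (rule mult_mat_vec_carrier[OF P x])
    have "cip ?w x = cip ?u (P *\<^sub>v x)" by (rule cip_adjoint[OF P u x])
    then show ?thesis using cip_cnj[OF w x] cip_cnj[OF u Px] by simp
  qed
  have left: "to_complex 1 * cip x ?w = cip z ?w" if xz: "(x, z) \<in> L O D" for x z
  proof -
    have "x \<in> carrier_vec n" "z \<in> carrier_vec n" using xz LD(1) DD(2) by auto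
    moreover obtain v where "v \<in> carrier_vec (k - 1)" "P *\<^sub>v x = transpose_mat K *\<^sub>v v" "P *\<^sub>v z = transpose_mat K' *\<^sub>v v"
      using bwd xz unfolding ran by blast
    ultimately show ?thesis using eq by (simp add: cip_w)
  qed
  let ?e = "unit_vec (k - 1) 0 :: 'k vec"
  have Ke: "transpose_mat K *\<^sub>v ?e = unit_vec k 0"
    using k Kv(1)[of ?e] by (intro eq_vecI) (auto simp: K_def)
  have "(I *\<^sub>v (transpose_mat K *\<^sub>v ?e), I *\<^sub>v (transpose_mat K' *\<^sub>v ?e)) \<in> L O D"
    using fwd[of ?e] unfolding ran by simp
  then have xz: "(I *\<^sub>v unit_vec k 0, I *\<^sub>v (transpose_mat K' *\<^sub>v ?e)) \<in> L O D" unfolding Ke .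
  have "cip (I *\<^sub>v unit_vec k 0) ?w = 0"
    by (rule relcomp_left_kernel(1)[OF w _ left xz]) (simp_all add: to_complex_one)
  then have "cip (unit_vec k 0) ?u = 0"
    using cip_w[of "I *\<^sub>v unit_vec k 0"] PI[of "unit_vec k 0"] I by simp
  moreover have "cip (unit_vec k 0) ?u = 1"
  proof -
    have "cip (unit_vec k 0) ?u = (\<Sum>i<k. if i = 0 then 1 else 0)"
      unfolding cip_sum[OF vec_carrier] using k by (intro sum.cong) auto
    then show ?thesis using k by simp
  qed
  ultimately show False by simp
qed

end

section \<open>The Kronecker form\<close>

lemma rank_mult_le:
  fixes U M :: "'a :: field mat"
  assumes U: "U \<in> carrier_mat n p" and M: "M \<in> carrier_mat p m"
  shows "vec_space.rank n (U * M) \<le> p"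
proof -
  have "vec_space.rank n (U * M) \<le> vec_space.rank n U"
  proof (rule rank_mono[OF mult_carrier_mat[OF U M] U])
    show "\<exists>w\<in>carrier_vec p. (U * M) *\<^sub>v v = U *\<^sub>v w" if v: "v \<in> carrier_vec m" for v
      using assoc_mult_mat_vec[OF U M v] mult_mat_vec_carrier[OF M v] by blast
  qed
  also have "\<dots> \<le> p" by (rule vec_space.rank_le_nc[OF U])
  finally show ?thesis .
qed

lemma inj_mat_cmat:
  fixes U :: "'k :: real_or_complex mat"
  assumes U: "U \<in> carrier_mat n p" and inj: "inj_mat U"
  shows "inj_mat (cmat U)"
proof (rule inj_matI)
  show "cmat U \<in> carrier_mat n p" using U by simp
  fix v assume v: "v \<in> carrier_vec p" and eq: "cmat U *\<^sub>v v = 0\<^sub>v n"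
  obtain a b :: "'k vec" where ab: "a \<in> carrier_vec p" "b \<in> carrier_vec p" "v = cvec a b"
    and r: "b = 0\<^sub>v p \<or> range (to_complex :: 'k \<Rightarrow> complex) = \<real>" by (rule cvec_exists[OF v])
  have c: "U *\<^sub>v a \<in> carrier_vec n" "U *\<^sub>v b \<in> carrier_vec n"
    by (rule mult_mat_vec_carrier[OF U ab(1)] mult_mat_vec_carrier[OF U ab(2)])+
  have r': "range (to_complex :: 'k \<Rightarrow> complex) = \<real> \<or> U *\<^sub>v b = 0\<^sub>v n \<and> 0\<^sub>v n = (0\<^sub>v n :: 'k vec)"
    using r mult_mat_zero_vec[OF U] by auto
  have "cvec (U *\<^sub>v a) (U *\<^sub>v b) = cvec (0\<^sub>v n) (0\<^sub>v n)"
    using eq unfolding ab(3) cmat_cvec[OF U ab(1,2)] by simp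
  from cvec_inject[OF c zero_carrier_vec zero_carrier_vec this r']
  have "a = 0\<^sub>v p" "b = 0\<^sub>v p" using inj_matD[OF inj U ab(1)] inj_matD[OF inj U ab(2)] by auto
  then show "v = 0\<^sub>v p" using ab(3) by simp
qed

lemma pencil_mult_left:
  assumes "E \<in> carrier_mat n m" "A \<in> carrier_mat n m" "S \<in> carrier_mat p n"
  shows "const_mat S * pencil E A = pencil (S * E) (S * A)"
proof -
  have c: "const_mat S * pencil E A \<in> carrier_mat p m"
    by (rule mult_carrier_mat) (use assms in auto)
  have "const_mat S * pencil E A = const_mat S * pencil E A * const_mat (1\<^sub>m m)"
    using right_mult_one_mat[OF c] by (simp add: const_poly.mat_hom_one)
  also have "\<dots> = pencil (S * E * 1\<^sub>m m) (S * A * 1\<^sub>m m)"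
    by (rule pencil_mult[OF assms one_carrier_mat])
  finally show ?thesis
    unfolding right_mult_one_mat[OF mult_carrier_mat[OF assms(3,1)]]
      right_mult_one_mat[OF mult_carrier_mat[OF assms(3,2)]] .
qed

context dissipative_nonnegative
begin

text \<open>In the open right half-plane the left kernel of \<open>zE - A\<close> is the joint left kernel
  of \<open>E\<close> and \<open>A\<close>, so its column space contains \<open>ran E + ran A\<close>.\<close>

lemma pencil_spectrum_left_half_plane:
  fixes E A :: "'k mat"
  assumes E: "E \<in> carrier_mat n m" and A: "A \<in> carrier_mat n m" and ran: "ran_stacked E A = L O D"
  shows "pencil_spectrum E A \<subseteq> {z. Re z \<le> 0}"
proof -
  \<comment> \<open>The number \<open>p\<close> below is the dimension of the sum of the ranges of
    \<open>E\<close> and \<open>A\<close>. It bounds the rank over the rational functions from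
    above, since \<open>U\<close> factors out of the pencil, and the rank at \<open>z\<close> from
    below.\<close>
  define H where "H = hcat2 E A"
  have H: "H \<in> carrier_mat n (m + m)" unfolding H_def by (rule hcat2_carrier[OF E A])
  have Hv: "H *\<^sub>v (a @\<^sub>v b) = E *\<^sub>v a + A *\<^sub>v b" if "a \<in> carrier_vec m" "b \<in> carrier_vec m" for a b
    unfolding H_def by (rule hcat2_mult_vec[OF E A that])
  obtain p U where U: "U \<in> carrier_mat n p" "inj_mat U"
    and UH: "(\<lambda>v. H *\<^sub>v v) ` carrier_vec (m + m) = (\<lambda>v. U *\<^sub>v v) ` carrier_vec p" 
    by (rule subspace_vec_basis[OF subspace_vec_image[OF H]])
  have "E *\<^sub>v v \<in> (\<lambda>v. H *\<^sub>v v) ` carrier_vec (m + m)" if v: "v \<in> carrier_vec m" for v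
  proof (rule image_eqI)
    show "E *\<^sub>v v = H *\<^sub>v (v @\<^sub>v 0\<^sub>v m)" unfolding Hv[OF v zero_carrier_vec] mult_mat_zero_vec[OF A]
      using mult_mat_vec_carrier[OF E v] by simp
  qed (use v in simp)
  then obtain E' where E': "E' \<in> carrier_mat p m" "E = U * E'" unfolding UH by (rule mat_factorization[OF E U(1)])
  have "A *\<^sub>v v \<in> (\<lambda>v. H *\<^sub>v v) ` carrier_vec (m + m)" if v: "v \<in> carrier_vec m" for v
  proof (rule image_eqI)
    show "A *\<^sub>v v = H *\<^sub>v (0\<^sub>v m @\<^sub>v v)" unfolding Hv[OF zero_carrier_vec v] mult_mat_zero_vec[OF E]
      using mult_mat_vec_carrier[OF A v] by simp
  qed (use v in simp)
  then obtain A' where A': "A' \<in> carrier_mat p m" "A = U * A'" unfolding UH by (rule mat_factorization[OF A U(1)])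
  have "vec_space.rank n (map_mat to_fract (pencil E A)) \<le> p"
  proof -
    interpret to_fract: inj_comm_ring_hom "to_fract :: 'k poly \<Rightarrow> 'k poly fract" by (unfold_locales, auto)
    have P: "pencil E' A' \<in> carrier_mat p m" using E' A' by simp
    have cU: "const_mat U \<in> carrier_mat n p" using U by simp
    have "pencil E A = const_mat U * pencil E' A'"
      using pencil_mult_left[OF E'(1) A'(1) U(1)] E'(2) A'(2) by simp
    then have "map_mat to_fract (pencil E A) = map_mat to_fract (const_mat U) * map_mat to_fract (pencil E' A')"
      using to_fract.mat_hom_mult[OF cU P] by simp
    then show ?thesis
      using rank_mult_le[of "map_mat to_fract (const_mat U)" n p "map_mat to_fract (pencil E' A')" m] U(1) P by simp
  qed
  moreover have "p \<le> vec_space.rank n (z \<cdot>\<^sub>m cmat E - cmat A)" if z: "Re z > 0" for z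
  proof -
    interpret C: dissipative_nonnegative n "complexification L" "complexification D"
      by (rule dissipative_nonnegative_complexification)
    have ranC: "ran_stacked (cmat E) (cmat A) = complexification L O complexification D"
      unfolding complexification_ran_stacked[OF E A] ran complexification_relcomp[OF linear_L linear_D] ..
    let ?F = "z \<cdot>\<^sub>m cmat E - cmat A"
    have cE: "cmat E \<in> carrier_mat n m" and cA: "cmat A \<in> carrier_mat n m" using E A by auto
    have zE: "z \<cdot>\<^sub>m cmat E \<in> carrier_mat n m" using cE by simp
    have F: "?F \<in> carrier_mat n m" by (rule minus_carrier_mat[OF cA])
    have cU: "cmat U \<in> carrier_mat n p" using U by simp
    have Fv: "?F *\<^sub>v t = z \<cdot>\<^sub>v (cmat E *\<^sub>v t) - cmat A *\<^sub>v t" if t: "t \<in> carrier_vec m" for t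
    proof -
      have "(z \<cdot>\<^sub>m cmat E) *\<^sub>v t = z \<cdot>\<^sub>v (cmat E *\<^sub>v t)"
        using cE t by (intro eq_vecI) (auto simp: scalar_prod_def sum_distrib_left mult_ac)
      then show ?thesis unfolding minus_mult_distrib_mat_vec[OF zE cA t] by simp
    qed
    let ?R = "(\<lambda>t. ?F *\<^sub>v t) ` carrier_vec m"
    have R: "subspace_vec n ?R" by (rule subspace_vec_image[OF F])
    have "cmat U *\<^sub>v v \<in> ?R" if v: "v \<in> carrier_vec p" for v
    proof -
      obtain a b :: "'k vec" where ab: "a \<in> carrier_vec p" "b \<in> carrier_vec p" "v = cvec a b"
        by (rule cvec_exists[OF v])
      have UH_mem: "\<exists>s t. s \<in> carrier_vec m \<and> t \<in> carrier_vec m \<and> U *\<^sub>v c = E *\<^sub>v s + A *\<^sub>v t" if c: "c \<in> carrier_vec p" for c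
      proof -
        obtain u where u: "u \<in> carrier_vec (m + m)" "U *\<^sub>v c = H *\<^sub>v u" using UH c by blast
        obtain s t where st: "u = s @\<^sub>v t" "s \<in> carrier_vec m" "t \<in> carrier_vec m" by (rule carrier_vec_appendE[OF u(1)])
        show ?thesis by (intro exI[of _ s] exI[of _ t]) (simp only: u(2) st Hv[OF st(2,3)])
      qed
      obtain s t where st: "s \<in> carrier_vec m" "t \<in> carrier_vec m" "U *\<^sub>v a = E *\<^sub>v s + A *\<^sub>v t" using UH_mem[OF ab(1)] by blast
      obtain s' t' where st': "s' \<in> carrier_vec m" "t' \<in> carrier_vec m" "U *\<^sub>v b = E *\<^sub>v s' + A *\<^sub>v t'" using UH_mem[OF ab(2)] by blast
      have sc: "cvec s s' \<in> carrier_vec m" "cvec t t' \<in> carrier_vec m" using st st' by auto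
      have Uv: "cmat U *\<^sub>v v = cmat E *\<^sub>v cvec s s' + cmat A *\<^sub>v cvec t t'"
        unfolding ab(3) cmat_cvec[OF U(1) ab(1,2)] st(3) st'(3) cmat_cvec[OF E st(1) st'(1)] cmat_cvec[OF A st(2) st'(2)]
        using mult_mat_vec_carrier[OF E st(1)] mult_mat_vec_carrier[OF E st'(1)]
          mult_mat_vec_carrier[OF A st(2)] mult_mat_vec_carrier[OF A st'(2)] by (simp add: cvec_add)
      have c2: "cmat E *\<^sub>v cvec s s' \<in> carrier_vec n" "cmat A *\<^sub>v cvec t t' \<in> carrier_vec n"
        by (rule mult_mat_vec_carrier[OF cE sc(1)] mult_mat_vec_carrier[OF cA sc(2)])+
      \<comment> \<open>By the double complement it suffices to test with vectors orthogonal to the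
        column space of \<open>?F\<close>. Such a \<open>w\<close> satisfies the hypothesis of the
        left kernel argument in the complexified locale with \<mu> = \<open>z\<close>.\<close>
      have "cip (cmat U *\<^sub>v v) w = 0" if w: "w \<in> orth n ?R" for w
      proof -
        have wc: "w \<in> carrier_vec n" using w by (simp add: orth_def)
        have left: "to_complex z * cip x w = cip y w" if "(x, y) \<in> complexification L O complexification D" for x y
        proof -
          have "(x, y) \<in> ran_stacked (cmat E) (cmat A)" using that ranC by simp
          then obtain t where t: "t \<in> carrier_vec m" "x = cmat E *\<^sub>v t" "y = cmat A *\<^sub>v t" by (rule ran_stackedE[OF _ cE])
          have xy: "x \<in> carrier_vec n" "y \<in> carrier_vec n"
            unfolding t(2,3) by (rule mult_mat_vec_carrier[OF cE t(1)] mult_mat_vec_carrier[OF cA t(1)])+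
          have zx: "z \<cdot>\<^sub>v x \<in> carrier_vec n" using xy by simp
          have Fc: "?F *\<^sub>v t \<in> carrier_vec n" by (rule mult_mat_vec_carrier[OF F t(1)])
          have "cip w (?F *\<^sub>v t) = 0" using w t(1) by (simp add: orth_def)
          then have "cip (z \<cdot>\<^sub>v x - y) w = 0"
            using cip_commute_zero[OF wc Fc] unfolding Fv[OF t(1)] t(2,3)[symmetric] by simp
          then show ?thesis unfolding cip_minus_left[OF zx xy(2) wc] cip_smult_left[OF xy(1) wc] by simp
        qed
        have pos: "0 < Re (to_complex z)" using z by simp
        have "cip (cmat E *\<^sub>v cvec s s') w = 0"
          by (rule C.relcomp_left_kernel(1)[OF wc pos left]) (use ran_stackedI[OF cE sc(1)] ranC in blast)+
        moreover have "cip (cmat A *\<^sub>v cvec t t') w = 0"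
          by (rule C.relcomp_left_kernel(2)[OF wc pos left]) (use ran_stackedI[OF cE sc(2)] ranC in blast)+
        ultimately show ?thesis unfolding Uv cip_add_left[OF c2 wc] by simp
      qed
      then have "cmat U *\<^sub>v v \<in> orth n (orth n ?R)"
        using mult_mat_vec_carrier[OF cU v] by (simp add: orth_def)
      then show ?thesis unfolding orth_orth[OF R] .
    qed
    then have "vec_space.rank n (cmat U) \<le> vec_space.rank n ?F"
      by (intro rank_mono[OF cU F]) blast
    then show ?thesis unfolding rank_inj_mat[OF cU inj_mat_cmat[OF U]] .
  qed
  ultimately have "\<not> vec_space.rank n (z \<cdot>\<^sub>m cmat E - cmat A) < vec_space.rank n (map_mat to_fract (pencil E A))"
    if "Re z > 0" for z
    using that by (meson le_less_trans not_less)
  then show ?thesis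
    unfolding pencil_spectrum_def carrier_matD(1)[OF E] by (intro subsetI CollectI leI) blast
qed

end

section \<open>Splitting the Kronecker form into its blocks\<close>

lemma pencil_diag_block:
  assumes "\<And>x. x \<in> set ps \<Longrightarrow> dim_row (fst x) = dim_row (snd x) \<and> dim_col (fst x) = dim_col (snd x)"
  shows "diag_block_mat (map (\<lambda>(E, A). pencil E A) ps) = pencil (diag_block_mat (map fst ps)) (diag_block_mat (map snd ps))"
  using assms
proof (induction ps)
  case (Cons x ps)
  obtain E1 A1 where x: "x = (E1, A1)" by (cases x)
  let ?E = "diag_block_mat (map fst ps)" and ?A = "diag_block_mat (map snd ps)"
  have dims: "dim_row ?E = dim_row ?A" "dim_col ?E = dim_col ?A"
    using diag_block_mat_same_dims[of ps] Cons.prems by auto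
  have x_dims: "dim_row E1 = dim_row A1" "dim_col E1 = dim_col A1"
    using Cons.prems[of x] by (auto simp: x)
  have IH: "diag_block_mat (map (\<lambda>(E, A). pencil E A) ps) = pencil ?E ?A"
    using Cons.IH Cons.prems by simp
  show ?case using dims x_dims by (simp add: x Let_def IH pencil_four_block)
qed simp

lemma transpose_diag_block: "transpose_mat (diag_block_mat As) = diag_block_mat (map transpose_mat As)"
proof (induction As)
  case (Cons A As)
  have "transpose_mat (four_block_mat A (0\<^sub>m (dim_row A) (dim_col (diag_block_mat As)))
      (0\<^sub>m (dim_row (diag_block_mat As)) (dim_col A)) (diag_block_mat As)) =
    four_block_mat (transpose_mat A) (0\<^sub>m (dim_col A) (dim_row (diag_block_mat As)))
      (0\<^sub>m (dim_col (diag_block_mat As)) (dim_row A)) (transpose_mat (diag_block_mat As))"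
    by (intro eq_matI) auto
  then show ?case by (simp add: Let_def flip: Cons.IH)
qed simp

lemma jordan_canonical_square:
  assumes "jordan_canonical J" shows "dim_row J = dim_col J"
proof -
  obtain Bs where Bs: "\<And>B. B \<in> set Bs \<Longrightarrow> jordan_cell B" "J = diag_block_mat Bs"
    using assms by (auto simp: jordan_canonical_def)
  have "dim_row B = dim_col B" if "B \<in> set Bs" for B
    using Bs(1)[OF that] by (auto simp: jordan_cell_def real_jordan_block_def)
  then show ?thesis unfolding Bs(2) dim_diag_block_mat by (metis (no_types, lifting) map_eq_conv)
qed

lemma kronecker_form_summands:
  fixes E A :: "'k :: real_or_complex mat"
  assumes E: "E \<in> carrier_mat n m" and A: "A \<in> carrier_mat n m"
    and kron: "kronecker_form E A S T J \<alpha> \<beta> \<gamma>"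
  shows "pencil_summand E A (1\<^sub>m (dim_row J)) J"
    and "k \<in> set \<alpha> \<Longrightarrow> pencil_summand E A (jordan_block k 0) (1\<^sub>m k)"
    and "k \<in> set \<beta> \<Longrightarrow> pencil_summand E A (mat (k - 1) k (\<lambda>(i, j). if j = i then 1 else 0))
      (mat (k - 1) k (\<lambda>(i, j). if j = i + 1 then 1 else 0))"
    and "k \<in> set \<gamma> \<Longrightarrow> pencil_summand E A (transpose_mat (mat (k - 1) k (\<lambda>(i, j). if j = i then 1 else 0)))
      (transpose_mat (mat (k - 1) k (\<lambda>(i, j). if j = i + 1 then 1 else 0)))"
proof -
  let ?K = "\<lambda>k. mat (k - 1) k (\<lambda>(i, j). if j = i then 1 else 0) :: 'k mat"
  let ?L = "\<lambda>k. mat (k - 1) k (\<lambda>(i, j). if j = i + 1 then 1 else 0) :: 'k mat"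
  let ?ps = "[(1\<^sub>m (dim_row J), J), (N_mat \<alpha>, 1\<^sub>m (sum_list \<alpha>)), (K_mat \<beta>, L_mat \<beta>),
    (transpose_mat (K_mat \<gamma>), transpose_mat (L_mat \<gamma>))] :: ('k mat \<times> 'k mat) list"
  have S: "S \<in> carrier_mat n n" "invertible_mat S" and T: "T \<in> carrier_mat m m" "invertible_mat T"
    and J: "jordan_canonical J"
    and eq: "const_mat S * pencil E A * const_mat T = diag_block_mat (map (\<lambda>(E, A). pencil E A) ?ps)"
    using kron E unfolding kronecker_form_def by auto
  let ?E = "diag_block_mat (map fst ?ps)" and ?A = "diag_block_mat (map snd ?ps)"
  have N_dim: "dim_row (N_mat \<alpha> :: 'k mat) = sum_list \<alpha>" "dim_col (N_mat \<alpha> :: 'k mat) = sum_list \<alpha>"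
    unfolding N_mat_def dim_diag_block_mat by (simp_all add: comp_def)
  have KL_dim: "dim_row (K_mat \<delta> :: 'k mat) = dim_row (L_mat \<delta> :: 'k mat)"
    "dim_col (K_mat \<delta> :: 'k mat) = dim_col (L_mat \<delta> :: 'k mat)" for \<delta>
    unfolding K_mat_def L_mat_def dim_diag_block_mat by (simp_all add: comp_def)
  have same: "dim_row (fst x) = dim_row (snd x) \<and> dim_col (fst x) = dim_col (snd x)" if "x \<in> set ?ps" for x
    using that jordan_canonical_square[OF J] N_dim KL_dim by auto
  have eq2: "pencil (S * E * T) (S * A * T) = pencil ?E ?A"
    unfolding pencil_mult[OF E A S(1) T(1), symmetric] eq by (rule pencil_diag_block[OF same])
  have SET: "S * E * T \<in> carrier_mat n m" "S * A * T \<in> carrier_mat n m"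
    using mult_carrier_mat[OF mult_carrier_mat[OF S(1) E] T(1)] mult_carrier_mat[OF mult_carrier_mat[OF S(1) A] T(1)]
    by auto
  \<comment> \<open>\<open>kronecker_form\<close> does not state that the block sizes add up to
    \<open>n\<close> and \<open>m\<close>; this is read off from the equation of pencils before
    coefficients can be compared.\<close>
  have "?A \<in> carrier_mat n m"
  proof (rule carrier_matI)
    show "dim_row ?A = n" using arg_cong[OF eq2, of dim_row] SET(2) unfolding pencil_dim by (metis carrier_matD(1))
    show "dim_col ?A = m" using arg_cong[OF eq2, of dim_col] SET(2) unfolding pencil_dim by (metis carrier_matD(2))
  qed
  moreover from this have "?E \<in> carrier_mat n m"
    using diag_block_mat_same_dims[of ?ps, OF same] by (intro carrier_matI) (metis carrier_matD)+
  ultimately have "S * E * T = ?E" "S * A * T = ?A"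
    using pencil_inject[OF SET _ _ eq2] by blast+
  then have EA: "pencil_summand E A ?E ?A"
    using pencil_summand_equivalent[OF E A S T] by simp
  have sub: "pencil_summand E A X Y" if "(X, Y) \<in> set ?ps" for X Y
    using pencil_summand_trans[OF EA pencil_summand_diag_block[of ?ps, OF same that]] .
  show "pencil_summand E A (1\<^sub>m (dim_row J)) J" by (rule sub) simp
  show "pencil_summand E A (jordan_block k 0) (1\<^sub>m k)" if k: "k \<in> set \<alpha>"
  proof -
    let ?qs = "map (\<lambda>k. (jordan_block k 0, 1\<^sub>m k)) \<alpha> :: ('k mat \<times> 'k mat) list"
    have "pencil_summand (diag_block_mat (map fst ?qs)) (diag_block_mat (map snd ?qs)) (jordan_block k 0) (1\<^sub>m k)"
      by (rule pencil_summand_diag_block) (use k in auto)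
    then have "pencil_summand (N_mat \<alpha>) (1\<^sub>m (sum_list \<alpha>)) (jordan_block k (0 :: 'k)) (1\<^sub>m k)"
      by (simp add: N_mat_def comp_def diag_block_one)
    then show ?thesis using pencil_summand_trans sub[of "N_mat \<alpha>" "1\<^sub>m (sum_list \<alpha>)"] by simp
  qed
  show "pencil_summand E A (?K k) (?L k)" if k: "k \<in> set \<beta>"
  proof -
    let ?qs = "map (\<lambda>k. (?K k, ?L k)) \<beta>"
    have "pencil_summand (diag_block_mat (map fst ?qs)) (diag_block_mat (map snd ?qs)) (?K k) (?L k)"
      by (rule pencil_summand_diag_block) (use k in auto)
    then have "pencil_summand (K_mat \<beta>) (L_mat \<beta>) (?K k) (?L k)"
      by (simp add: K_mat_def L_mat_def comp_def)
    then show ?thesis using pencil_summand_trans[OF sub[of "K_mat \<beta>" "L_mat \<beta>"]] by simp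
  qed
  show "pencil_summand E A (transpose_mat (?K k)) (transpose_mat (?L k))" if k: "k \<in> set \<gamma>"
  proof -
    let ?qs = "map (\<lambda>k. (transpose_mat (?K k), transpose_mat (?L k))) \<gamma>"
    have "pencil_summand (diag_block_mat (map fst ?qs)) (diag_block_mat (map snd ?qs)) (transpose_mat (?K k)) (transpose_mat (?L k))"
      by (rule pencil_summand_diag_block) (use k in auto)
    then have "pencil_summand (transpose_mat (K_mat \<gamma>)) (transpose_mat (L_mat \<gamma>)) (transpose_mat (?K k)) (transpose_mat (?L k))"
      by (simp add: K_mat_def L_mat_def comp_def transpose_diag_block)
    then show ?thesis using pencil_summand_trans[OF sub[of "transpose_mat (K_mat \<gamma>)" "transpose_mat (L_mat \<gamma>)"]] by simp
  qed
qed

text \<open>A similarity is an equivalence of pencils that fixes the identity, so it transforms both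
  coefficients of \<open>s - J\<close> consistently.\<close>

lemma jordan_nf_summand:
  fixes J :: "'a :: field mat"
  assumes J: "J \<in> carrier_mat N N" and nf: "jordan_nf J n_as" and mem: "(k, z) \<in> set n_as"
  shows "pencil_summand (1\<^sub>m N) J (1\<^sub>m k) (jordan_block k z)"
proof -
  obtain P Q where wit: "similar_mat_wit J (jordan_matrix n_as) P Q"
    using nf by (auto simp: jordan_nf_def similar_mat_def)
  note w = similar_mat_witD2[OF J wit]
  have "invertible_mat P" "invertible_mat Q"
    unfolding invertible_mat_def inverts_mat_def using w by auto
  then have "pencil_summand (1\<^sub>m N) J (Q * 1\<^sub>m N * P) (Q * J * P)"
    by (intro pencil_summand_equivalent[OF one_carrier_mat J]) (use w in auto)
  moreover have "Q * 1\<^sub>m N * P = 1\<^sub>m N" using w by simp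
  moreover have "Q * J * P = jordan_matrix n_as"
  proof -
    have "similar_mat_wit (jordan_matrix n_as) J Q P" by (rule similar_mat_wit_sym[OF wit])
    from similar_mat_witD2(3)[OF w(5) this] show ?thesis by simp
  qed
  ultimately have 1: "pencil_summand (1\<^sub>m N) J (1\<^sub>m N) (jordan_matrix n_as)" by simp
  let ?qs = "map (\<lambda>(k, z). (1\<^sub>m k, jordan_block k z)) n_as :: ('a mat \<times> 'a mat) list"
  have "pencil_summand (diag_block_mat (map fst ?qs)) (diag_block_mat (map snd ?qs)) (1\<^sub>m k) (jordan_block k z)"
    by (rule pencil_summand_diag_block) (use mem in force)+
  moreover have "map fst ?qs = map (\<lambda>k. 1\<^sub>m k) (map fst n_as)" "map snd ?qs = map (\<lambda>(k, z). jordan_block k z) n_as"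
    by (induction n_as) auto
  moreover have "sum_list (map fst n_as) = N"
    using carrier_matD(1)[OF w(5)] by (simp only: jordan_matrix_dim)
  ultimately have "pencil_summand (1\<^sub>m N) (jordan_matrix n_as) (1\<^sub>m k) (jordan_block k z)"
    by (simp only: diag_block_one jordan_matrix_def)
  then show ?thesis using pencil_summand_trans[OF 1] by blast
qed

context dissipative_nonnegative
begin

text \<open>\<open>J\<close> enters through a complex Jordan normal form of \<open>cmat J\<close>,
  whether it is built from real or from complex cells. The blocks of this form are summands of the
  complexified pencil, so the chain arguments apply in the complexified locale.\<close>

lemma finite_jordan_block:
  fixes E A :: "'k mat"
  assumes E: "E \<in> carrier_mat n m" and A: "A \<in> carrier_mat n m" and ran: "ran_stacked E A = L O D"
    and kron: "kronecker_form E A S T J \<alpha> \<beta> \<gamma>" and block: "has_jordan_block J k z"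
  shows "Re z = 0 \<Longrightarrow> z \<noteq> 0 \<Longrightarrow> k \<le> 1" and "z = 0 \<Longrightarrow> k \<le> 2"
proof -
  interpret C: dissipative_nonnegative n "complexification L" "complexification D"
    by (rule dissipative_nonnegative_complexification)
  have ranC: "ran_stacked (cmat E) (cmat A) = complexification L O complexification D"
    unfolding complexification_ran_stacked[OF E A] ran complexification_relcomp[OF linear_L linear_D] ..
  have cE: "cmat E \<in> carrier_mat n m" using E by simp
  obtain n_as where nf: "jordan_nf (cmat J) n_as" and mem: "(k, z) \<in> set n_as"
    using block by (auto simp: has_jordan_block_def)
  have "jordan_canonical J" using kron by (simp add: kronecker_form_def)
  then have "dim_row J = dim_col J" by (rule jordan_canonical_square)
  then have J: "cmat J \<in> carrier_mat (dim_row J) (dim_row J)" by (intro carrier_matI) simp_all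
  have "pencil_summand (cmat E) (cmat A) (cmat (1\<^sub>m (dim_row J) :: 'k mat)) (cmat J)"
    by (rule pencil_summand_cmat[OF kronecker_form_summands(1)[OF E A kron]])
  moreover have "cmat (1\<^sub>m (dim_row J) :: 'k mat) = 1\<^sub>m (dim_row J)" by (rule to_complex.mat_hom_one)
  ultimately have "pencil_summand (cmat E) (cmat A) (1\<^sub>m (dim_row J)) (cmat J)" by simp
  then have sum: "pencil_summand (cmat E) (cmat A) (1\<^sub>m k) (jordan_block k z)"
    by (rule pencil_summand_trans[OF _ jordan_nf_summand[OF J nf mem]])
  show "k \<le> 1" if "Re z = 0" "z \<noteq> 0" by (rule C.jordan_block_imaginary[OF cE ranC sum]) (use that in simp_all)
  show "k \<le> 2" if "z = 0" using C.jordan_block_zero[OF cE ranC] sum that by simp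
qed

end

theorem theorem6p6:
  fixes E A :: "'k :: real_or_complex mat" and n m :: nat
  assumes "E \<in> carrier_mat n m" and "A \<in> carrier_mat n m"
    and "\<exists>D L. maximally_dissipative n D \<and> maximally_nonnegative n L \<and> ran_stacked E A = L O D"
  shows
    "(\<exists>S T n1 n2 n3 n4 r c L11 D11 D21 L21.
        S \<in> carrier_mat n n \<and> invertible_mat S \<and>
        T \<in> carrier_mat m m \<and> invertible_mat T \<and>
        L11 \<in> carrier_mat n1 n1 \<and> D11 \<in> carrier_mat n1 n1 \<and>
        D21 \<in> carrier_mat n2 n1 \<and> L21 \<in> carrier_mat n3 n1 \<and>
        const_mat S * pencil E A * const_mat T = block_mat
          [[pencil L11 D11, 0\<^sub>m n1 n2, 0\<^sub>m n1 n3, 0\<^sub>m n1 n4, 0\<^sub>m n1 n4, 0\<^sub>m n1 c],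
           [const_mat D21, s_times (1\<^sub>m n2), 0\<^sub>m n2 n3, 0\<^sub>m n2 n4, 0\<^sub>m n2 n4, 0\<^sub>m n2 c],
           [s_times L21, 0\<^sub>m n3 n2, 1\<^sub>m n3, 0\<^sub>m n3 n4, 0\<^sub>m n3 n4, 0\<^sub>m n3 c],
           [0\<^sub>m n4 n1, 0\<^sub>m n4 n2, 0\<^sub>m n4 n3, s_times (1\<^sub>m n4), - 1\<^sub>m n4, 0\<^sub>m n4 c],
           [0\<^sub>m r n1, 0\<^sub>m r n2, 0\<^sub>m r n3, 0\<^sub>m r n4, 0\<^sub>m r n4, 0\<^sub>m r c]] \<and>
        regular_pencil L11 D11 \<and>
        positive_real (map_mat to_fract (pencil L11 D11)) \<and>
        mat_kernel L11 \<subseteq> mat_kernel L21) \<and>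
     pencil_spectrum E A \<subseteq> {z. Re z \<le> 0} \<and>
     (\<forall>S T J \<alpha> \<beta> \<gamma>. kronecker_form E A S T J \<alpha> \<beta> \<gamma> \<longrightarrow>
        (\<forall>k \<in> set (minimal_indices \<beta>). k \<le> 1) \<and>
        (\<forall>k \<in> set (minimal_indices \<gamma>). k = 0) \<and>
        (\<forall>z \<in> pencil_spectrum E A. z \<noteq> 0 \<and> Re z = 0 \<longrightarrow> semi_simple J z) \<and>
        (\<forall>k \<in> set \<alpha>. k \<le> 2) \<and>
        (\<forall>k. has_jordan_block J k 0 \<longrightarrow> k \<le> 2) \<and>
        kronecker_index \<alpha> \<gamma> \<le> 2)"
    (is "?normal_form \<and> _ \<and> (\<forall>S T J \<alpha> \<beta> \<gamma>. _ S T J \<alpha> \<beta> \<gamma> \<longrightarrow> ?kronecker S T J \<alpha> \<beta> \<gamma>)")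
proof -
  obtain D L where DL: "maximally_dissipative n D" "maximally_nonnegative n L" and ran: "ran_stacked E A = L O D"
    using assms(3) by blast
  interpret dissipative_nonnegative n L D by (rule maximal_dissipative_nonnegative[OF DL])
  note E = assms(1) and A = assms(2)
  have part1: ?normal_form
  proof -
    obtain S T n1 n2 n3 n4 r c L11 D11 D21 L21 where *:
      "S \<in> carrier_mat n n" "invertible_mat S" "T \<in> carrier_mat m m" "invertible_mat T"
      "L11 \<in> carrier_mat n1 n1" "D11 \<in> carrier_mat n1 n1" "D21 \<in> carrier_mat n2 n1" "L21 \<in> carrier_mat n3 n1"
      "const_mat S * pencil E A * const_mat T = block5x6 n1 n2 n3 n4 r c (pencil L11 D11) (const_mat D21)
        (s_times (1\<^sub>m n2)) (s_times L21) (1\<^sub>m n3) (s_times (1\<^sub>m n4)) (- 1\<^sub>m n4)"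
      and pos: "psd_mat n1 L11" "dissipative_mat n1 D11"
      and **: "regular_pencil L11 D11" "mat_kernel L11 \<subseteq> mat_kernel L21"
      by (rule block_form[OF E A ran])
    have "positive_real (map_mat to_fract (pencil L11 D11))"
      by (rule positive_realI[OF pos])
    then show ?thesis using * ** by blast
  qed
  have part3: "?kronecker S T J \<alpha> \<beta> \<gamma>" if kron: "kronecker_form E A S T J \<alpha> \<beta> \<gamma>" for S T J \<alpha> \<beta> \<gamma>
  proof -
    note sums = kronecker_form_summands[OF E A kron]
    have \<alpha>: "k \<le> 2" if "k \<in> set \<alpha>" for k by (rule jordan_block_infinity[OF E A ran sums(2)[OF that]])
    have \<beta>: "k \<le> 2" if "k \<in> set \<beta>" for k by (rule column_minimal_index[OF E ran sums(3)[OF that]])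
    have \<gamma>: "k \<le> 1" if "k \<in> set \<gamma>" for k by (rule row_minimal_index[OF E ran sums(4)[OF that]])
    have semi: "semi_simple J z" if z: "z \<noteq> 0 \<and> Re z = 0" for z
    proof -
      have "\<not> 2 \<le> k" if "has_jordan_block J k z" for k
        using finite_jordan_block(1)[OF E A ran kron that] z by simp
      then show ?thesis by (auto simp: semi_simple_def)
    qed
    show ?thesis
    proof (intro conjI)
      \<comment> \<open>The lists hold block sizes, which exceed the minimal indices by one; the
        bounds 2 and 1 on the sizes become 1 and 0.\<close>
      show "\<forall>k\<in>set (minimal_indices \<beta>). k \<le> 1" using \<beta> by (fastforce simp: minimal_indices_def)
      show "\<forall>k\<in>set (minimal_indices \<gamma>). k = 0" using \<gamma> by (simp add: minimal_indices_def)
      show "\<forall>z\<in>pencil_spectrum E A. z \<noteq> 0 \<and> Re z = 0 \<longrightarrow> semi_simple J z" using semi by simp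
      show "\<forall>k\<in>set \<alpha>. k \<le> 2" using \<alpha> by simp
      show "\<forall>k. has_jordan_block J k 0 \<longrightarrow> k \<le> 2"
        using finite_jordan_block(2)[OF E A ran kron _ refl] by simp
      show "kronecker_index \<alpha> \<gamma> \<le> 2"
        unfolding kronecker_index_def using \<alpha> \<gamma> by (subst Max_le_iff) fastforce+
    qed
  qed
  show ?thesis using part1 pencil_spectrum_left_half_plane[OF E A ran] part3 by blast
qed

end
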